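(* Let $\mathcal H^{*}$ be the space of all harmonic maps from $\mathbb D$ to $S^2_1$, and define the subsets $\mathcal H_{+},\mathcal H_{-},\mathcal H_{0}$ of $\mathcal H^{*}$ by $$\mathcal H_{+}=\{\psi\in\mathcal H^{*}:\langle\psi_x,\psi_x\rangle\langle\psi_y,\psi_y\rangle>0\ \text{on }\mathbb D\},$$ $$\mathcal H_{-}=\{\psi\in\mathcal H^{*}:\langle\psi_x,\psi_x\rangle\langle\psi_y,\psi_y\rangle<0\ \text{on }\mathbb D\},$$ $$\mathcal H_{0}=\{\psi\in\mathcal H^{*}:\langle\psi_x,\psi_x\rangle\langle\psi_y,\psi_y\rangle=0\ \text{on }\mathbb D\}.$$ Then there are the following bijective correspondences: $$\mathcal H^{*}\longleftrightarrow \mathcal A^{*}/\mathcal G,\qquad \mathcal H_{\pm}\longleftrightarrow \mathcal A_{\pm}/\mathcal G,\qquad \mathcal H_{0}\longleftrightarrow \mathcal A_{0}/\mathcal G .$$ Here $\mathcal G$ is the gauge transformation group of the bundle $\psi^{*}G=\mathbb D\times K$. These correspondences are described by $\alpha=\Psi^{-1}\mathrm d\Psi$ via a framing $\Psi$ of $\psi$.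
   Context: $G=\mathrm{SL}(2;\mathbb R)$, $\mathfrak g=\mathfrak{sl}(2;\mathbb R)$ with scalar product $\langle X,Y\rangle=\frac12\mathrm{tr}(XY)$, which identifies $\mathfrak g$ with Minkowski 3-space $\mathbb E^3_1$ (signature $(-,+,+)$). Put $$\mathbf i=\begin{pmatrix}0&-1\\1&0\end{pmatrix},\quad \mathbf j'=\begin{pmatrix}0&1\\1&0\end{pmatrix},\quad \mathbf k'=\begin{pmatrix}-1&0\\0&1\end{pmatrix}.$$ $S^2_1=\{X\in\mathfrak g:\langle X,X\rangle=1\}$ is the pseudosphere with its induced Lorentz metric. $\mathrm{Ad}(g)X=gXg^{-1}$ acts transitively and isometrically on $S^2_1$; the isotropy group $K$ of $\mathbf k'$ is the group of diagonal matrices in $G$, so $S^2_1=G/K$, and $G\to S^2_1$, $g\mapsto\mathrm{Ad}(g)\mathbf k'$, is a principal $K$-bundle. Let $\mathfrak k=\mathbb R\mathbf k'$ (diagonal matrices) and $\mathfrak m=\mathbb R\mathbf i\oplus\mathbb R\mathbf j'$ (off-diagonal matrices), $\mathfrak g=\mathfrak k\oplus\mathfrak m$. $\mathbb D$ is a simply connected region of the Minkowski plane $(\mathbb R^2(x,y),\mathrm dx\,\mathrm dy)$ containing the origin. A smooth map $\psi:\mathbb D\to S^2_1$ is harmonic if its tension field $\mathrm{tr}(\nabla\mathrm d\psi)$ vanishes; equivalently, $\psi_{xy}=\rho\,\psi$ for some function $\rho$ on $\mathbb D$. A framing of a smooth map $\psi:\mathbb D\to S^2_1$ is a smooth map $\Psi:\mathbb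 D\to G$ with $\psi=\mathrm{Ad}(\Psi)\mathbf k'$; framings exist and are unique up to right multiplication by smooth maps $\mathbb D\to K$. The pull-back bundle $\psi^{*}G$ is the trivial bundle $\mathbb D\times K$, so its gauge group $\mathcal G$ is identified with $C^\infty(\mathbb D,K)$. A $\mathfrak g$-valued 1-form $\alpha$ on $\mathbb D$ (equivalently a connection on $\mathbb D\times G$) is decomposed as $\alpha=\alpha_0+\alpha_1$ with $\alpha_0$ $\mathfrak k$-valued and $\alpha_1=\alpha'_{\mathfrak m}\,\mathrm dx+\alpha''_{\mathfrak m}\,\mathrm dy$ $\mathfrak m$-valued. Let $*$ be the operator with $*\mathrm dx=\mathrm dx$, $*\mathrm dy=-\mathrm dy$, and $[\alpha\wedge\beta](X,Y)=[\alpha(X),\beta(Y)]-[\alpha(Y),\beta(X)]$. The form $\alpha$ is admissible if $$\mathrm d\alpha+\tfrac12[\alpha\wedge\alpha]=0,\qquad \mathrm d( *\alpha_1)+[\alpha_0\wedge*\alpha_1]=0.$$ $\mathcal A^{*}$ is the set of admissible forms. Put $\mathscr S(\alpha)=\langle\alpha'_{\mathfrak m},\alpha'_{\mathfrak m}\rangle\,\langle\alpha''_{\mathfrak m},\alpha''_{\mathfrak m}\rangle$, a function on $\mathbb D$, and let $\mathcal A_{+},\mathcal A_{-},\mathcal A_0\subset\mathcal A^{*}$ be the subsets of those $\alpha$ with $\mathscr S(\alpha)>0$, $\mathscr S(\alpha)<0$, $\mathscr S(\alpha)=0$ on $\mathbb D$, respectively. The gauge group $\mathcal G$ acts on these sets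 by $g^{*}\alpha=g^{-1}\mathrm dg+\mathrm{Ad}(g^{-1})\alpha$.
   Formalization: Harmonic maps are taken up to congruence ψ ↦ Ad(a)ψ, a ∈ SL(2;R), in H*, H±, H0: Ψ and aΨ give the same Ψ⁻¹dΨ (e.g. the constant maps k′ and −k′ both give α = 0), so without this quotient the described correspondence is not injective. *)

theory Defs
  imports "HOL-Analysis.Analysis"
begin

text \<open>
  Conventions.  The Minkowski plane is \<open>real \<times> real\<close> with null coordinates \<open>(x, y)\<close>.  Maps and
  1-forms on a region \<open>D\<close> are total functions normalised to be \<open>undefined\<close> outside \<open>D\<close>
  (\<^const>\<open>extensional\<close>), so that equality in HOL is equality on \<open>D\<close>.  As \<open>D\<close> will be open,
  derivatives at points of \<open>D\<close> do not see this normalisation.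
\<close>

type_synonym mat2 = "real^2^2"

fun Ck_on :: "nat \<Rightarrow> 'a set \<Rightarrow> ('a::real_normed_vector \<Rightarrow> 'b::real_normed_vector) \<Rightarrow> bool" where
  "Ck_on 0 S f \<longleftrightarrow> continuous_on S f"
| "Ck_on (Suc k) S f \<longleftrightarrow> (\<forall>x\<in>S. f differentiable (at x)) \<and>
     (\<forall>v. Ck_on k S (\<lambda>x. frechet_derivative f (at x) v))"

text \<open>\<open>C\<^sup>\<infinity>\<close> on an open subset of a finite-dimensional space.\<close>
definition smooth_on :: "'a set \<Rightarrow> ('a::euclidean_space \<Rightarrow> 'b::real_normed_vector) \<Rightarrow> bool" where
  "smooth_on S f \<longleftrightarrow> (\<forall>k. Ck_on k S f)"

definition dx_of :: "(real \<times> real \<Rightarrow> 'b::real_normed_vector) \<Rightarrow> real \<times> real \<Rightarrow> 'b" where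
  "dx_of f p = frechet_derivative f (at p) (1, 0)"

definition dy_of :: "(real \<times> real \<Rightarrow> 'b::real_normed_vector) \<Rightarrow> real \<times> real \<Rightarrow> 'b" where
  "dy_of f p = frechet_derivative f (at p) (0, 1)"


subsection \<open>The group, its Lie algebra and the pseudosphere\<close>

definition SL2 :: "mat2 set" where "SL2 = {A. det A = 1}"

definition sl2 :: "mat2 set" where "sl2 = {X. trace X = 0}"

definition sp :: "mat2 \<Rightarrow> mat2 \<Rightarrow> real" where "sp X Y = trace (X ** Y) / 2"

definition kk :: mat2 where "kk = vector [vector [-1, 0], vector [0, 1]]"

definition S21 :: "mat2 set" where "S21 = {X \<in> sl2. sp X X = 1}"

definition Ad :: "mat2 \<Rightarrow> mat2 \<Rightarrow> mat2" where "Ad g X = g ** X ** matrix_inv g"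

definition lie :: "mat2 \<Rightarrow> mat2 \<Rightarrow> mat2" where "lie X Y = X ** Y - Y ** X"

definition K_group :: "mat2 set" where "K_group = {g \<in> SL2. Ad g kk = kk}"

text \<open>The projections of the Lie algebra onto its diagonal and its off-diagonal matrices.\<close>

definition k_part :: "mat2 \<Rightarrow> mat2" where
  "k_part X = (\<chi> i j. if i = j then X $ i $ j else 0)"

definition m_part :: "mat2 \<Rightarrow> mat2" where
  "m_part X = (\<chi> i j. if i = j then 0 else X $ i $ j)"


subsection \<open>Harmonic maps\<close>

text \<open>
  The Levi-Civita connection of the pseudosphere is the tangential part of the flat connection of
  the ambient Minkowski space; at \<open>p\<close> the unit normal is \<open>p\<close> itself.
\<close>

definition tangential :: "mat2 \<Rightarrow> mat2 \<Rightarrow> mat2" where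
  "tangential p V = V - sp V p *\<^sub>R p"

text \<open>\<open>(\<nabla>d\<psi>)(X, Y)\<close> for constant vector fields \<open>X\<close>, \<open>Y\<close>; these are parallel for \<open>dx dy\<close>.\<close>
definition second_ff ::
  "(real \<times> real \<Rightarrow> mat2) \<Rightarrow> real \<times> real \<Rightarrow> real \<times> real \<Rightarrow> real \<times> real \<Rightarrow> mat2" where
  "second_ff \<psi> p X Y =
     tangential (\<psi> p) (frechet_derivative (\<lambda>q. frechet_derivative \<psi> (at q) Y) (at p) X)"

text \<open>
  The metric \<open>dx dy\<close> has the Gram matrix with diagonal entries \<open>0\<close> and off-diagonal entries \<open>1/2\<close>
  in the coordinate frame; its inverse has off-diagonal entries \<open>2\<close>.
\<close>
definition tension_field :: "(real \<times> real \<Rightarrow> mat2) \<Rightarrow> real \<times> real \<Rightarrow> mat2" where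
  "tension_field \<psi> p =
     2 *\<^sub>R second_ff \<psi> p (1, 0) (0, 1) + 2 *\<^sub>R second_ff \<psi> p (0, 1) (1, 0)"

definition harmonic_maps :: "(real \<times> real) set \<Rightarrow> (real \<times> real \<Rightarrow> mat2) set" where
  "harmonic_maps D =
     {\<psi> \<in> D \<rightarrow>\<^sub>E S21. smooth_on D \<psi> \<and> (\<forall>p\<in>D. tension_field \<psi> p = 0)}"

definition H_prod :: "(real \<times> real \<Rightarrow> mat2) \<Rightarrow> real \<times> real \<Rightarrow> real" where
  "H_prod \<psi> p = sp (dx_of \<psi> p) (dx_of \<psi> p) * sp (dy_of \<psi> p) (dy_of \<psi> p)"

definition H_plus :: "(real \<times> real) set \<Rightarrow> (real \<times> real \<Rightarrow> mat2) set" where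
  "H_plus D = {\<psi> \<in> harmonic_maps D. \<forall>p\<in>D. H_prod \<psi> p > 0}"

definition H_minus :: "(real \<times> real) set \<Rightarrow> (real \<times> real \<Rightarrow> mat2) set" where
  "H_minus D = {\<psi> \<in> harmonic_maps D. \<forall>p\<in>D. H_prod \<psi> p < 0}"

definition H_zero :: "(real \<times> real) set \<Rightarrow> (real \<times> real \<Rightarrow> mat2) set" where
  "H_zero D = {\<psi> \<in> harmonic_maps D. \<forall>p\<in>D. H_prod \<psi> p = 0}"

text \<open>
  Rigid motions of the pseudosphere.  If \<open>\<Psi>\<close> frames \<open>\<psi>\<close>, then \<open>a\<Psi>\<close> frames \<open>Ad a \<psi>\<close> and has the same
  \<open>\<Psi>\<^sup>-\<^sup>1 d\<Psi>\<close>, so a harmonic map can be recovered from its gauge class only up to this relation.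
\<close>
definition congr_rel ::
  "(real \<times> real) set \<Rightarrow> ((real \<times> real \<Rightarrow> mat2) \<times> (real \<times> real \<Rightarrow> mat2)) set" where
  "congr_rel D = {(\<psi>, \<lambda>p\<in>D. Ad a (\<psi> p)) | \<psi> a. a \<in> SL2}"


subsection \<open>Lie algebra valued 1-forms\<close>

text \<open>\<open>\<alpha> p v\<close> is the value of the form \<open>\<alpha>\<close> at the point \<open>p\<close> on the tangent vector \<open>v\<close>.\<close>
type_synonym form1 = "real \<times> real \<Rightarrow> real \<times> real \<Rightarrow> mat2"

definition forms1 :: "(real \<times> real) set \<Rightarrow> form1 set" where
  "forms1 D = {\<alpha> \<in> extensional D. (\<forall>p\<in>D. linear (\<alpha> p)) \<and> (\<forall>p\<in>D. \<forall>v. \<alpha> p v \<in> sl2) \<and>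
     (\<forall>v. smooth_on D (\<lambda>p. \<alpha> p v))}"

definition form_k :: "form1 \<Rightarrow> form1" where "form_k \<alpha> p v = k_part (\<alpha> p v)"

definition form_m :: "form1 \<Rightarrow> form1" where "form_m \<alpha> p v = m_part (\<alpha> p v)"

text \<open>The operator with \<open>*dx = dx\<close> and \<open>*dy = -dy\<close>.\<close>
definition star :: "form1 \<Rightarrow> form1" where "star \<alpha> p v = \<alpha> p (fst v, - snd v)"

text \<open>The exterior derivative, evaluated on the constant vector fields \<open>X\<close>, \<open>Y\<close>.\<close>
definition ext_d :: "form1 \<Rightarrow> real \<times> real \<Rightarrow> real \<times> real \<Rightarrow> real \<times> real \<Rightarrow> mat2" where
  "ext_d \<alpha> p X Y =
     frechet_derivative (\<lambda>q. \<alpha> q Y) (at p) X - frechet_derivative (\<lambda>q. \<alpha> q X) (at p) Y"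

definition wedge_lie ::
  "form1 \<Rightarrow> form1 \<Rightarrow> real \<times> real \<Rightarrow> real \<times> real \<Rightarrow> real \<times> real \<Rightarrow> mat2" where
  "wedge_lie \<alpha> \<beta> p X Y = lie (\<alpha> p X) (\<beta> p Y) - lie (\<alpha> p Y) (\<beta> p X)"

definition admissible_forms :: "(real \<times> real) set \<Rightarrow> form1 set" where
  "admissible_forms D = {\<alpha> \<in> forms1 D.
     (\<forall>p\<in>D. \<forall>X Y. ext_d \<alpha> p X Y + (1/2) *\<^sub>R wedge_lie \<alpha> \<alpha> p X Y = 0) \<and>
     (\<forall>p\<in>D. \<forall>X Y. ext_d (star (form_m \<alpha>)) p X Y
        + wedge_lie (form_k \<alpha>) (star (form_m \<alpha>)) p X Y = 0)}"

text \<open>The coefficients of \<open>dx\<close> and \<open>dy\<close> in a form are its values on \<open>(1, 0)\<close> and \<open>(0, 1)\<close>.\<close>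
definition A_prod :: "form1 \<Rightarrow> real \<times> real \<Rightarrow> real" where
  "A_prod \<alpha> p = sp (form_m \<alpha> p (1, 0)) (form_m \<alpha> p (1, 0))
     * sp (form_m \<alpha> p (0, 1)) (form_m \<alpha> p (0, 1))"

definition A_plus :: "(real \<times> real) set \<Rightarrow> form1 set" where
  "A_plus D = {\<alpha> \<in> admissible_forms D. \<forall>p\<in>D. A_prod \<alpha> p > 0}"

definition A_minus :: "(real \<times> real) set \<Rightarrow> form1 set" where
  "A_minus D = {\<alpha> \<in> admissible_forms D. \<forall>p\<in>D. A_prod \<alpha> p < 0}"

definition A_zero :: "(real \<times> real) set \<Rightarrow> form1 set" where
  "A_zero D = {\<alpha> \<in> admissible_forms D. \<forall>p\<in>D. A_prod \<alpha> p = 0}"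


subsection \<open>Gauge transformations and framings\<close>

definition gauge_group :: "(real \<times> real) set \<Rightarrow> (real \<times> real \<Rightarrow> mat2) set" where
  "gauge_group D = {g \<in> D \<rightarrow>\<^sub>E K_group. smooth_on D g}"

text \<open>\<open>\<Psi>\<^sup>-\<^sup>1 d\<Psi>\<close>\<close>
definition log_deriv :: "(real \<times> real) set \<Rightarrow> (real \<times> real \<Rightarrow> mat2) \<Rightarrow> form1" where
  "log_deriv D \<Psi> = (\<lambda>p\<in>D. \<lambda>v. matrix_inv (\<Psi> p) ** frechet_derivative \<Psi> (at p) v)"

definition gauge_act :: "(real \<times> real) set \<Rightarrow> (real \<times> real \<Rightarrow> mat2) \<Rightarrow> form1 \<Rightarrow> form1" where
  "gauge_act D g \<alpha> = (\<lambda>p\<in>D. \<lambda>v. log_deriv D g p v + Ad (matrix_inv (g p)) (\<alpha> p v))"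

definition gauge_rel :: "(real \<times> real) set \<Rightarrow> (form1 \<times> form1) set" where
  "gauge_rel D = {(\<alpha>, gauge_act D g \<alpha>) | \<alpha> g. g \<in> gauge_group D}"

definition framings :: "(real \<times> real) set \<Rightarrow> (real \<times> real \<Rightarrow> mat2) \<Rightarrow> (real \<times> real \<Rightarrow> mat2) set" where
  "framings D \<psi> = {\<Psi> \<in> D \<rightarrow>\<^sub>E SL2. smooth_on D \<Psi> \<and> (\<forall>p\<in>D. \<psi> p = Ad (\<Psi> p) kk)}"

end

theory Submission
  imports Defs "HOL-Complex_Analysis.Riemann_Mapping"
begin

text \<open>
  If \<open>\<Psi>\<close> frames \<open>\<psi>\<close>, then \<open>\<alpha> = \<Psi>\<^sup>-\<^sup>1 d\<Psi>\<close> is flat, and writing \<open>d\<psi> = \<Psi> [\<alpha>, kk] \<Psi>\<^sup>-\<^sup>1\<close> shows that the tension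
  field of \<open>\<psi>\<close> vanishes exactly when the second admissibility equation holds.  The gauge class of
  \<open>\<alpha>\<close> is the set of all \<open>\<Phi>\<^sup>-\<^sup>1 d\<Phi>\<close> with \<open>\<Phi>\<close> a framing of \<open>\<psi>\<close>, and two maps into the group with the
  same logarithmic derivative differ by a constant left factor.  So the bijection comes down to two
  existence results.

  Framings: the eigenline of \<open>\<psi>\<close> for \<open>-1\<close> is spanned by a square root of a nowhere vanishing
  complex function on \<open>D\<close>, and the square root exists because \<open>D\<close> is simply connected.

  Integration of flat forms: by the Riemann mapping theorem \<open>D\<close> may be replaced by the disc or the
  plane, where \<open>\<Psi>\<close> is defined by parallel transport along rays.  With \<open>u(p, t) = \<Psi>(t p)\<close>, variation of
  constants gives \<open>\<Psi>(q) \<Psi>(p)\<^sup>-\<^sup>1 - 1 = \<integral> u(q, t) (\<alpha>\<^bsub>tq\<^esub>(q) - \<alpha>\<^bsub>tp\<^esub>(p)) u(p, t)\<^sup>-\<^sup>1 dt\<close>; so \<open>\<Psi>\<close> is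
  differentiable, and by flatness its derivative is the integral of an exact \<open>t\<close>-derivative.
\<close>

section \<open>Smooth maps\<close>

text \<open>Along a ray the flat system is a linear ordinary differential equation, solved by a
  Picard series. The obstacle is that a solution assembled ray by ray must be differentiable across
  the rays, with the prescribed derivative; this is where flatness enters. The estimates are uniform
  on closed balls about the origin, so the domain has to be a union of such balls, which is what the
  Riemann map arranges.

  The inverse is replaced throughout by the adjugate of a 2 by 2 matrix, which is linear and agrees
  with the inverse when the determinant is 1. For traceless forms it satisfies the differential
  equation of the inverse before the determinant is known, and determinant 1 then follows.

  Smoothness is obtained by bootstrapping: \<open>d\<Psi> = \<Psi> \<alpha>\<close>, and a square
  root \<open>h\<close> of \<open>w\<close> has derivative \<open>dw / (2 h)\<close>, so each order
  of differentiability yields the next.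

  No representatives are chosen: a congruence class is sent to the union of the logarithmic
  derivatives of all framings of all its members, and this union turns out to be one gauge
  class.\<close>

lemma has_derivative_cong_open:
  assumes "open S" "x \<in> S" "\<And>y. y \<in> S \<Longrightarrow> f y = g y"
  shows "(f has_derivative f') (at x) \<longleftrightarrow> (g has_derivative f') (at x)"
  using has_derivative_transform_within_open[OF _ assms(1,2), of f f' UNIV g]
    has_derivative_transform_within_open[OF _ assms(1,2), of g f' UNIV f] assms(3) by auto

lemma frechet_derivative_cong_open:
  assumes "open S" "x \<in> S" "\<And>y. y \<in> S \<Longrightarrow> f y = g y"
  shows "frechet_derivative f (at x) = frechet_derivative g (at x)"
  using has_derivative_cong_open[OF assms] by (simp add: frechet_derivative_def)

text \<open>Derivatives at points of an open set depend only on the values there, so a map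
  normalised to \<open>undefined\<close> off \<open>D\<close> is as smooth as the formula that
  defines it on \<open>D\<close>.\<close>

lemma Ck_on_cong:
  assumes "open S" "\<And>x. x \<in> S \<Longrightarrow> f x = g x"
  shows "Ck_on k S f \<longleftrightarrow> Ck_on k S g"
  using assms(2)
proof (induction k arbitrary: f g)
  case 0
  then show ?case by (simp cong: continuous_on_cong)
next
  case (Suc k)
  have eq: "frechet_derivative f (at x) = frechet_derivative g (at x)" if "x \<in> S" for x
    using frechet_derivative_cong_open[OF assms(1) that Suc.prems] by simp
  have "f differentiable (at x) \<longleftrightarrow> g differentiable (at x)" if "x \<in> S" for x
    using has_derivative_cong_open[OF assms(1) that Suc.prems] by (simp add: differentiable_def)
  moreover have "Ck_on k S (\<lambda>x. frechet_derivative f (at x) v) \<longleftrightarrow>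
      Ck_on k S (\<lambda>x. frechet_derivative g (at x) v)" for v
    by (rule Suc.IH) (simp add: eq)
  ultimately show ?case by simp
qed

text \<open>\<open>Ck_on\<close> speaks of \<open>frechet_derivative\<close>; uniqueness of the
  derivative lets an explicit formula \<open>f'\<close> take its place.\<close>

lemma Ck_on_SucI:
  assumes "open S" "\<And>x. x \<in> S \<Longrightarrow> (f has_derivative f' x) (at x)"
    "\<And>v. Ck_on k S (\<lambda>x. f' x v)"
  shows "Ck_on (Suc k) S f"
proof -
  have "frechet_derivative f (at x) = f' x" if "x \<in> S" for x
    using frechet_derivative_at[OF assms(2)[OF that]] by simp
  then have "Ck_on k S (\<lambda>x. frechet_derivative f (at x) v)" for v
    using Ck_on_cong[OF assms(1), of "\<lambda>x. frechet_derivative f (at x) v" "\<lambda>x. f' x v"] assms(3) by simp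
  then show ?thesis using assms(2) by (auto simp: differentiable_def)
qed

lemma Ck_on_Suc_has_derivative:
  "Ck_on (Suc k) S f \<Longrightarrow> x \<in> S \<Longrightarrow> (f has_derivative frechet_derivative f (at x)) (at x)"
  by (simp add: frechet_derivative_works[symmetric])

lemma Ck_on_Suc_weaken: "Ck_on (Suc k) S f \<Longrightarrow> Ck_on k S f"
proof (induction k arbitrary: f)
  case 0
  then show ?case
    by (auto intro!: continuous_at_imp_continuous_on differentiable_imp_continuous_within)
next
  case (Suc k)
  then show ?case by (auto simp del: Ck_on.simps(2) simp: Ck_on.simps(2)[of _ S f] intro: Suc.IH)
qed

lemma Ck_on_const: "Ck_on k S (\<lambda>_. c)"
  by (induction k arbitrary: c) auto

lemma Ck_on_add:
  assumes "open S"
  shows "Ck_on k S f \<Longrightarrow> Ck_on k S g \<Longrightarrow> Ck_on k S (\<lambda>x. f x + g x)"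
proof (induction k arbitrary: f g)
  case (Suc k)
  show ?case
    by (rule Ck_on_SucI[OF assms(1) has_derivative_add[OF
          Ck_on_Suc_has_derivative[OF Suc.prems(1)] Ck_on_Suc_has_derivative[OF Suc.prems(2)]]])
      (use Suc in auto)
qed (auto intro: continuous_intros)

lemma Ck_on_bounded_linear:
  assumes "open S" "bounded_linear L"
  shows "Ck_on k S f \<Longrightarrow> Ck_on k S (\<lambda>x. L (f x))"
proof (induction k arbitrary: f)
  case 0
  then show ?case by (simp add: bounded_linear.continuous_on[OF assms(2)])
next
  case (Suc k)
  show ?case
    by (rule Ck_on_SucI[OF assms(1) bounded_linear.has_derivative[OF assms(2)
          Ck_on_Suc_has_derivative[OF Suc.prems(1)]]])
      (use Suc in auto)
qed

lemma Ck_on_bounded_bilinear: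
  assumes "open S" "bounded_bilinear B"
  shows "Ck_on k S f \<Longrightarrow> Ck_on k S g \<Longrightarrow> Ck_on k S (\<lambda>x. B (f x) (g x))"
proof (induction k arbitrary: f g)
  case 0
  then show ?case by (simp add: bounded_bilinear.continuous_on[OF assms(2)])
next
  case (Suc k)
  show ?case
  proof (rule Ck_on_SucI[OF assms(1) bounded_bilinear.FDERIV[OF assms(2)
          Ck_on_Suc_has_derivative[OF Suc.prems(1)] Ck_on_Suc_has_derivative[OF Suc.prems(2)]]])
    show "Ck_on k S (\<lambda>x. B (f x) (frechet_derivative g (at x) v) +
        B (frechet_derivative f (at x) v) (g x))" for v
      using Suc.prems Ck_on_Suc_weaken[OF Suc.prems(1)] Ck_on_Suc_weaken[OF Suc.prems(2)]
      by (intro Ck_on_add assms(1) Suc.IH) auto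
  qed
qed

lemma Ck_on_inverse:
  fixes f :: "'a::real_normed_vector \<Rightarrow> 'b::real_normed_field"
  assumes "open S" "\<And>x. x \<in> S \<Longrightarrow> f x \<noteq> 0"
  shows "Ck_on k S f \<Longrightarrow> Ck_on k S (\<lambda>x. inverse (f x))"
proof (induction k)
  case 0
  then show ?case using assms(2) by (auto intro: continuous_intros)
next
  case (Suc k)
  note mult = Ck_on_bounded_bilinear[OF assms(1) bounded_bilinear_mult]
  have inv: "Ck_on k S (\<lambda>x. inverse (f x))"
    using Suc Ck_on_Suc_weaken by blast
  show ?case
  proof (rule Ck_on_SucI[OF assms(1)])
    show "((\<lambda>x. inverse (f x)) has_derivative
        (\<lambda>v. - (inverse (f x) * frechet_derivative f (at x) v * inverse (f x)))) (at x)" if "x \<in> S" for x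
      by (rule has_derivative_compose[OF Ck_on_Suc_has_derivative[OF Suc.prems that] has_derivative_inverse'])
        (use assms(2) that in auto)
    show "Ck_on k S (\<lambda>x. - (inverse (f x) * frechet_derivative f (at x) v * inverse (f x)))" for v
      using Suc.prems
      by (intro Ck_on_bounded_linear[OF assms(1) bounded_linear_minus[OF bounded_linear_ident]] mult inv) auto
  qed
qed

text \<open>Bootstrapping: the derivative may be expressed through \<open>f\<close> itself. This
  serves for square roots and for solutions of \<open>d\<Psi> = \<Psi> \<alpha>\<close>.\<close>

lemma smooth_on_SucI:
  fixes f :: "'a::euclidean_space \<Rightarrow> 'b::real_normed_vector"
  assumes "open S" "\<And>x. x \<in> S \<Longrightarrow> (f has_derivative f' x) (at x)"
    "\<And>k v. Ck_on k S f \<Longrightarrow> Ck_on k S (\<lambda>x. f' x v)"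
  shows "smooth_on S f"
  unfolding smooth_on_def
proof
  show "Ck_on k S f" for k
  proof (induction k)
    case 0
    then show ?case
      using assms(2) by (auto intro!: continuous_at_imp_continuous_on has_derivative_continuous)
  next
    case (Suc k)
    show ?case by (rule Ck_on_SucI[OF assms(1,2)]) (use assms(3) Suc in auto)
  qed
qed

lemma smooth_on_cong:
  assumes "open S" "\<And>x. x \<in> S \<Longrightarrow> f x = g x"
  shows "smooth_on S f \<longleftrightarrow> smooth_on S g"
  using Ck_on_cong[OF assms] by (simp add: smooth_on_def)

lemma smooth_on_const: "smooth_on S (\<lambda>_. c)"
  by (simp add: smooth_on_def Ck_on_const)

lemma smooth_on_add:
  "open S \<Longrightarrow> smooth_on S f \<Longrightarrow> smooth_on S g \<Longrightarrow> smooth_on S (\<lambda>x. f x + g x)"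
  by (simp add: smooth_on_def Ck_on_add)

lemma smooth_on_bounded_linear:
  "open S \<Longrightarrow> bounded_linear L \<Longrightarrow> smooth_on S f \<Longrightarrow> smooth_on S (\<lambda>x. L (f x))"
  by (simp add: smooth_on_def Ck_on_bounded_linear)

lemma smooth_on_bounded_bilinear:
  "open S \<Longrightarrow> bounded_bilinear B \<Longrightarrow> smooth_on S f \<Longrightarrow> smooth_on S g \<Longrightarrow>
    smooth_on S (\<lambda>x. B (f x) (g x))"
  by (simp add: smooth_on_def Ck_on_bounded_bilinear)

lemma smooth_on_inverse:
  fixes f :: "'a::euclidean_space \<Rightarrow> 'b::real_normed_field"
  shows "open S \<Longrightarrow> (\<And>x. x \<in> S \<Longrightarrow> f x \<noteq> 0) \<Longrightarrow> smooth_on S f \<Longrightarrow>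
    smooth_on S (\<lambda>x. inverse (f x))"
  by (simp add: smooth_on_def Ck_on_inverse)

lemma smooth_on_frechet_derivative:
  "smooth_on S f \<Longrightarrow> smooth_on S (\<lambda>x. frechet_derivative f (at x) v)"
  by (metis Ck_on.simps(2) smooth_on_def)

lemma smooth_on_has_derivative:
  "smooth_on S f \<Longrightarrow> x \<in> S \<Longrightarrow> (f has_derivative frechet_derivative f (at x)) (at x)"
  unfolding smooth_on_def by (metis Ck_on_Suc_has_derivative)

lemma smooth_on_imp_continuous_on: "smooth_on S f \<Longrightarrow> continuous_on S f"
  unfolding smooth_on_def by (metis Ck_on.simps(1))

section \<open>Symmetry of mixed partial derivatives\<close>

lemma mixed_difference_mean_value:
  fixes f :: "real \<times> real \<Rightarrow> real"
  assumes h: "h > 0" and box: "\<And>s t. 0 \<le> s \<Longrightarrow> s \<le> h \<Longrightarrow> 0 \<le> t \<Longrightarrow> t \<le> h \<Longrightarrow> (a + s, b + t) \<in> S"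
    and d: "\<And>p. p \<in> S \<Longrightarrow> (f has_derivative f' p) (at p)"
    and dd: "\<And>p. p \<in> S \<Longrightarrow> ((\<lambda>q. f' q (1, 0)) has_derivative g p) (at p)"
  obtains s t where "0 < s" "s < h" "0 < t" "t < h"
    "f (a + h, b + h) - f (a + h, b) - f (a, b + h) + f (a, b) = h * h * g (a + s, b + t) (0, 1)"
proof -
  have *: "((\<lambda>x. f (x, y)) has_real_derivative f' (x, y) (1, 0)) (at x)" if "(x, y) \<in> S" for x y
  proof (rule has_derivative_imp_has_field_derivative)
    show "((\<lambda>x. f (x, y)) has_derivative (\<lambda>s. f' (x, y) (s, 0))) (at x)"
      by (rule has_derivative_compose[of "\<lambda>x. (x, y)" "\<lambda>s. (s, 0)" x UNIV f, OF _ d[OF that]])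
        (auto intro!: has_derivative_Pair has_derivative_ident has_derivative_const)
    show "s * f' (x, y) (1, 0) = f' (x, y) (s, 0)" for s
      using linear_scale[OF has_derivative_linear[OF d[OF that]], of s "(1, 0)"] by simp
  qed
  \<comment> \<open>The mean value theorem is applied in the first coordinate to the difference of
    \<open>f\<close> along the upper and lower edges of the square, and afterwards in the second
    coordinate to the partial derivative found.\<close>
  have "((\<lambda>x. f (x, b + h) - f (x, b)) has_real_derivative f' (x, b + h) (1, 0) - f' (x, b) (1, 0)) (at x)"
    if "a \<le> x" "x \<le> a + h" for x
    using box[of "x - a" h] box[of "x - a" 0] that h by (intro DERIV_diff *) auto
  from MVT2[OF _ this, of a "a + h"] h obtain x where x: "a < x" "x < a + h" and
    1: "f (a + h, b + h) - f (a + h, b) - (f (a, b + h) - f (a, b)) = h * (f' (x, b + h) (1, 0) - f' (x, b) (1, 0))"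
    by auto
  have "((\<lambda>y. f' (x, y) (1, 0)) has_real_derivative g (x, y) (0, 1)) (at y)"
    if "b \<le> y" "y \<le> b + h" for y
  proof -
    have "(x, y) \<in> S" using box[of "x - a" "y - b"] that x by simp
    note der = dd[OF this]
    show ?thesis
    proof (rule has_derivative_imp_has_field_derivative)
      show "((\<lambda>y. f' (x, y) (1, 0)) has_derivative (\<lambda>s. g (x, y) (0, s))) (at y)"
        by (rule has_derivative_compose[of "\<lambda>y. (x, y)" "\<lambda>s. (0, s)" y UNIV "\<lambda>q. f' q (1, 0)", OF _ der])
          (auto intro!: has_derivative_Pair has_derivative_ident has_derivative_const)
      show "s * g (x, y) (0, 1) = g (x, y) (0, s)" for s
        using linear_scale[OF has_derivative_linear[OF der], of s "(0, 1)"] by simp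
    qed
  qed
  from MVT2[OF _ this, of b "b + h"] h obtain y where y: "b < y" "y < b + h" and
    2: "f' (x, b + h) (1, 0) - f' (x, b) (1, 0) = h * g (x, y) (0, 1)"
    by auto
  show ?thesis
    by (rule that[of "x - a" "y - b"]) (use x y 1 2 in auto)
qed

text \<open>The second difference over a square does not change when the coordinates are exchanged,
  so it equals \<open>h * h\<close> times either mixed partial at suitable points of the square.
  Continuity at the corner then forbids a gap between the two.\<close>

lemma mixed_partials_eq_real:
  fixes f :: "real \<times> real \<Rightarrow> real"
  assumes "open S" "(a, b) \<in> S"
    and d: "\<And>p. p \<in> S \<Longrightarrow> (f has_derivative f' p) (at p)"
    and d1: "\<And>p. p \<in> S \<Longrightarrow> ((\<lambda>q. f' q (1, 0)) has_derivative g1 p) (at p)"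
    and d2: "\<And>p. p \<in> S \<Longrightarrow> ((\<lambda>q. f' q (0, 1)) has_derivative g2 p) (at p)"
    and c1: "continuous_on S (\<lambda>p. g1 p (0, 1))" and c2: "continuous_on S (\<lambda>p. g2 p (1, 0))"
  shows "g1 (a, b) (0, 1) = g2 (a, b) (1, 0)"
proof (rule ccontr)
  assume ne: "g1 (a, b) (0, 1) \<noteq> g2 (a, b) (1, 0)"
  define e where "e = \<bar>g1 (a, b) (0, 1) - g2 (a, b) (1, 0)\<bar> / 2"
  have "e > 0" using ne by (simp add: e_def)
  have "isCont (\<lambda>p. g1 p (0, 1)) (a, b)" "isCont (\<lambda>p. g2 p (1, 0)) (a, b)"
    using c1 c2 assms(1,2) by (auto simp: continuous_on_eq_continuous_at)
  note ct = this[unfolded continuous_at_eps_delta]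
  from ct(1)[rule_format, OF \<open>e > 0\<close>] obtain r1 where r1: "r1 > 0"
    "\<And>q. dist q (a, b) < r1 \<Longrightarrow> dist (g1 q (0, 1)) (g1 (a, b) (0, 1)) < e"
    by blast
  from ct(2)[rule_format, OF \<open>e > 0\<close>] obtain r2 where r2: "r2 > 0"
    "\<And>q. dist q (a, b) < r2 \<Longrightarrow> dist (g2 q (1, 0)) (g2 (a, b) (1, 0)) < e"
    by blast
  obtain r3 where r3: "r3 > 0" "ball (a, b) r3 \<subseteq> S"
    using assms(1,2) open_contains_ball by blast
  \<comment> \<open>Points of the square of side \<open>h\<close> lie within \<open>2 * h\<close> of
    its corner; the divisor 3 keeps this strictly below all three radii.\<close>
  define h where "h = min r1 (min r2 r3) / 3"
  have h: "h > 0" "2 * h < r1" "2 * h < r2" "2 * h < r3"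
    using r1 r2 r3 by (auto simp: h_def)
  have near: "dist (a + s, b + t) (a, b) \<le> 2 * h" if "0 \<le> s" "s \<le> h" "0 \<le> t" "t \<le> h" for s t
    using sqrt_sum_squares_le_sum_abs[of s t] that by (simp add: dist_Pair_Pair dist_real_def)
  have box: "(a + s, b + t) \<in> S" if "0 \<le> s" "s \<le> h" "0 \<le> t" "t \<le> h" for s t
    using near[OF that] r3(2) h(4) by (auto simp: subset_eq dist_commute)
  obtain s t where 1: "0 < s" "s < h" "0 < t" "t < h"
    "f (a + h, b + h) - f (a + h, b) - f (a, b + h) + f (a, b) = h * h * g1 (a + s, b + t) (0, 1)"
    by (rule mixed_difference_mean_value[OF h(1) box d d1])
  \<comment> \<open>Exchanging the coordinates makes the same second difference yield the other
    mixed partial.\<close>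
  define S' where "S' = prod.swap -` S"
  have "bounded_linear (prod.swap :: real \<times> real \<Rightarrow> real \<times> real)"
    using bounded_linear_Pair[OF bounded_linear_snd bounded_linear_fst] by (simp add: prod.swap_def[abs_def])
  note sw = has_derivative_compose[OF bounded_linear_imp_has_derivative[OF this]]
  have d': "((\<lambda>p. f (prod.swap p)) has_derivative (\<lambda>v. f' (prod.swap p) (prod.swap v))) (at p)"
    if "p \<in> S'" for p
    using sw[OF d] that by (simp add: S'_def)
  have d2': "((\<lambda>q. f' (prod.swap q) (prod.swap (1, 0))) has_derivative (\<lambda>v. g2 (prod.swap p) (prod.swap v))) (at p)"
    if "p \<in> S'" for p
    using sw[OF d2, of p] that by (simp add: S'_def)
  obtain s' t' where 2: "0 < s'" "s' < h" "0 < t'" "t' < h"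
    "f (a + h, b + h) - f (a, b + h) - f (a + h, b) + f (a, b) = h * h * g2 (a + t', b + s') (1, 0)"
    by (rule mixed_difference_mean_value[where S = S', OF h(1) _ d' d2', of b a]) (auto simp: S'_def box)
  have "g1 (a + s, b + t) (0, 1) = g2 (a + t', b + s') (1, 0)"
    using 1(5) 2(5) h(1) by (simp add: algebra_simps)
  moreover have "dist (g1 (a + s, b + t) (0, 1)) (g1 (a, b) (0, 1)) < e"
    using near[of s t] 1 h by (intro r1(2)) auto
  moreover have "dist (g2 (a + t', b + s') (1, 0)) (g2 (a, b) (1, 0)) < e"
    using near[of t' s'] 2 h by (intro r2(2)) auto
  ultimately show False
    using dist_triangle3[of "g1 (a, b) (0, 1)" "g2 (a, b) (1, 0)" "g1 (a + s, b + t) (0, 1)"]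
    by (simp add: e_def dist_real_def[of "g1 (a, b) (0, 1)" "g2 (a, b) (1, 0)"])
qed

lemma smooth_on_mixed_partials_eq:
  fixes f :: "real \<times> real \<Rightarrow> 'b::euclidean_space"
  assumes "open S" "p \<in> S" "smooth_on S f"
  shows "frechet_derivative (\<lambda>q. frechet_derivative f (at q) (1, 0)) (at p) (0, 1) =
    frechet_derivative (\<lambda>q. frechet_derivative f (at q) (0, 1)) (at p) (1, 0)"
proof (rule euclidean_eqI)
  fix b :: 'b
  note s1 = smooth_on_frechet_derivative[OF assms(3)]
  obtain a c where p: "p = (a, c)" by fastforce
  show "frechet_derivative (\<lambda>q. frechet_derivative f (at q) (1, 0)) (at p) (0, 1) \<bullet> b =
    frechet_derivative (\<lambda>q. frechet_derivative f (at q) (0, 1)) (at p) (1, 0) \<bullet> b"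
    unfolding p
    by (rule mixed_partials_eq_real[OF assms(1) assms(2)[unfolded p]
          has_derivative_inner_left[OF smooth_on_has_derivative[OF assms(3)]]
          has_derivative_inner_left[OF smooth_on_has_derivative[OF s1]]
          has_derivative_inner_left[OF smooth_on_has_derivative[OF s1]]])
      (assumption | rule continuous_on_inner[OF smooth_on_imp_continuous_on continuous_on_const]
        smooth_on_frechet_derivative assms)+
qed

section \<open>Flat connections on balls\<close>

lemma bounded_bilinear_matrix_mult: "bounded_bilinear ((**) :: real^2^2 \<Rightarrow> real^2^2 \<Rightarrow> real^2^2)"
  unfolding bilinear_conv_bounded_bilinear[symmetric] bilinear_def
  by (auto intro!: linearI simp: matrix_matrix_mult_def vec_eq_iff algebra_simps sum.distrib sum_distrib_left)

lemmas matrix_simps2 = vec_eq_iff forall_2 matrix_matrix_mult_def sum_2 mat_def trace_def det_2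

text \<open>The Cayley-Hamilton form of the adjugate. It is linear in \<open>A\<close>, so it is
  differentiated like any bounded linear map, without a rule for inverses.\<close>

definition adjugate2 :: "real^2^2 \<Rightarrow> real^2^2" where
  "adjugate2 A = trace A *\<^sub>R mat 1 - A"

lemma mult_adjugate2: "A ** adjugate2 A = det A *\<^sub>R mat 1"
  and adjugate2_mult: "adjugate2 A ** A = det A *\<^sub>R mat 1"
  by (simp_all add: adjugate2_def matrix_simps2 algebra_simps)

lemma adjugate2_mult_rev: "adjugate2 (A ** B) = adjugate2 B ** adjugate2 A"
  by (simp add: adjugate2_def matrix_simps2 algebra_simps)

lemma adjugate2_traceless: "trace X = 0 \<Longrightarrow> adjugate2 X = - X"
  by (simp add: adjugate2_def)

lemma adjugate2_mat_1: "adjugate2 (mat 1) = mat 1"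
  by (simp add: adjugate2_def matrix_simps2)

lemma bounded_linear_adjugate2: "bounded_linear adjugate2"
  unfolding linear_conv_bounded_linear[symmetric]
  by (rule linearI) (simp_all add: adjugate2_def matrix_simps2 algebra_simps)

interpretation mat_mult: bounded_bilinear "(**) :: real^2^2 \<Rightarrow> real^2^2 \<Rightarrow> real^2^2"
  by (rule bounded_bilinear_matrix_mult)

text \<open>The condition \<open>balls\<close> covers the disc and the plane alike. The balls are
  closed, hence compact, which gives bounds for \<alpha>; the radius exceeds \<open>norm p\<close>
  so that uniform convergence on the ball gives continuity at \<open>p\<close>.\<close>

locale radial_form =
  fixes \<Omega> :: "'e::euclidean_space set" and \<alpha> :: "'e \<Rightarrow> 'e \<Rightarrow> real^2^2"
  assumes balls: "\<And>p. p \<in> \<Omega> \<Longrightarrow> \<exists>r>norm p. cball 0 r \<subseteq> \<Omega>"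
    and lin: "\<And>p. p \<in> \<Omega> \<Longrightarrow> linear (\<alpha> p)"
    and cont: "continuous_on (\<Omega> \<times> UNIV) (\<lambda>(p, v). \<alpha> p v)"
begin

lemma open_domain: "open \<Omega>"
  unfolding open_contains_ball
proof
  fix p assume "p \<in> \<Omega>"
  then obtain r where "r > norm p" "cball 0 r \<subseteq> \<Omega>" using balls by blast
  moreover have "ball p (r - norm p) \<subseteq> cball 0 r"
  proof
    fix q assume "q \<in> ball p (r - norm p)"
    then show "q \<in> cball 0 r"
      using norm_triangle_sub[of q p] by (simp add: dist_norm norm_minus_commute)
  qed
  ultimately show "\<exists>e>0. ball p e \<subseteq> \<Omega>" by (intro exI[of _ "r - norm p"]) auto
qed

lemma scale_in: "p \<in> \<Omega> \<Longrightarrow> t \<in> {0..1} \<Longrightarrow> t *\<^sub>R p \<in> \<Omega>"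
proof -
  assume p: "p \<in> \<Omega>" and t: "t \<in> {0..1}"
  then obtain r where r: "r > norm p" "cball 0 r \<subseteq> \<Omega>" using balls by blast
  have "norm (t *\<^sub>R p) \<le> r" using t r(1) mult_left_le_one_le[of "norm p" t] by simp
  then show ?thesis using r by auto
qed

lemma continuous_on_form:
  assumes "continuous_on S f" "continuous_on S g" "\<And>x. x \<in> S \<Longrightarrow> f x \<in> \<Omega>"
  shows "continuous_on S (\<lambda>x. \<alpha> (f x) (g x))"
  using continuous_on_compose2[OF cont, of S "\<lambda>x. (f x, g x)"] assms
  by (auto intro!: continuous_intros)

lemma continuous_on_radial_integral:
  fixes d :: "'e \<Rightarrow> real^2^2"
  assumes "continuous_on \<Omega> d"
  shows "continuous_on \<Omega> (\<lambda>p. integral {0..1} (\<lambda>t::real. d (t *\<^sub>R p) ** \<alpha> (t *\<^sub>R p) p))"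
proof -
  have "continuous_on (\<Omega> \<times> cbox 0 1) (\<lambda>(p, t::real). d (t *\<^sub>R p) ** \<alpha> (t *\<^sub>R p) p)"
    unfolding split_beta
    by (intro mat_mult.continuous_on continuous_on_form continuous_on_compose2[OF assms]
        continuous_intros) (auto simp: scale_in)
  from integral_continuous_on_param[OF this] show ?thesis by simp
qed

text \<open>The terms, not the partial sums, of the Picard series for parallel transport from 0 to
  \<open>p\<close> along the ray: iterated integrals of \<alpha>, rescaled to the parameter interval
  from 0 to 1.\<close>

primrec picard :: "nat \<Rightarrow> 'e \<Rightarrow> real^2^2" where
  "picard 0 = (\<lambda>p. mat 1)"
| "picard (Suc n) = (\<lambda>p. integral {0..1} (\<lambda>t. picard n (t *\<^sub>R p) ** \<alpha> (t *\<^sub>R p) p))"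

lemma continuous_on_picard: "continuous_on \<Omega> (picard n)"
  by (induction n) (auto intro: continuous_on_radial_integral)

lemma continuous_on_radial_integrand:
  fixes d :: "'e \<Rightarrow> real^2^2"
  assumes "p \<in> \<Omega>" "continuous_on \<Omega> d"
  shows "continuous_on {0..1} (\<lambda>t. d (t *\<^sub>R p) ** \<alpha> (t *\<^sub>R p) p)"
  by (intro mat_mult.continuous_on continuous_on_form continuous_on_compose2[OF assms(2)]
        continuous_intros) (auto simp: scale_in assms(1))

text \<open>The bound is stated at \<open>t *\<^sub>R p\<close> because the power of
  \<open>t\<close> must be carried through the induction: integrating \<open>s ^ n\<close> is what
  turns \<open>fact n\<close> into \<open>fact (Suc n)\<close>. The last conclusion exposes the
  operator bound \<open>K\<close> of \<alpha> on the ball.\<close>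

lemma picard_bound:
  assumes "cball 0 r \<subseteq> \<Omega>"
  obtains K where "K > 0"
    "\<And>n p t. p \<in> cball 0 r \<Longrightarrow> t \<in> {0..1} \<Longrightarrow>
      norm (picard n (t *\<^sub>R p)) \<le> norm (mat 1 :: real^2^2) * ((K * t) ^ n / fact n)"
    "\<And>(X :: real^2^2) q v. q \<in> cball 0 r \<Longrightarrow> v \<in> cball 0 r \<Longrightarrow> norm (X ** \<alpha> q v) \<le> K * norm X"
proof -
  from mat_mult.pos_bounded obtain B where B0: "B > 0 \<and> (\<forall>(X :: real^2^2) (Y :: real^2^2). norm (X ** Y) \<le> norm X * norm Y * B)" ..
  then have B: "B > 0" "norm (X ** Y) \<le> norm X * norm Y * B" for X :: "real^2^2" and Y :: "real^2^2" by simp_all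
  have "compact ((\<lambda>(q, v). \<alpha> q v) ` (cball 0 r \<times> cball 0 r))"
    by (intro compact_continuous_image compact_Times compact_cball continuous_on_subset[OF cont])
      (use assms in auto)
  from compact_imp_bounded[OF this] obtain C where
    C0: "C > 0" "\<forall>X\<in>(\<lambda>(q, v). \<alpha> q v) ` (cball 0 r \<times> cball 0 r). norm X \<le> C"
    unfolding bounded_pos by blast
  have C: "C > 0" "\<And>q v. q \<in> cball 0 r \<Longrightarrow> v \<in> cball 0 r \<Longrightarrow> norm (\<alpha> q v) \<le> C"
    using C0(1) bspec[OF C0(2), OF image_eqI[OF refl SigmaI]] by auto
  define K where "K = C * B"
  have K: "norm (X ** \<alpha> q v) \<le> K * norm X" if "q \<in> cball 0 r" "v \<in> cball 0 r" for X :: "real^2^2" and q v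
  proof -
    have "norm (X ** \<alpha> q v) \<le> norm X * norm (\<alpha> q v) * B" by (rule B(2))
    also have "\<dots> \<le> norm X * C * B" using C(2)[OF that] C0(1) B(1) by (intro mult_mono) auto
    finally show ?thesis by (simp add: K_def mult_ac)
  qed
  have "K > 0" using B C by (simp add: K_def)
  have bound: "norm (picard n (t *\<^sub>R p)) \<le> norm (mat 1 :: real^2^2) * ((K * t) ^ n / fact n)"
    if "p \<in> cball 0 r" "t \<in> {0..1}" for n p t
    using that
  proof (induction n arbitrary: t)
    case (Suc n)
    have sc: "c *\<^sub>R p \<in> cball 0 r" if "c \<in> {0..1}" for c
      using that Suc.prems(1) mult_left_le_one_le[of "norm p" c] by simp
    have in\<Omega>: "p \<in> \<Omega>" using Suc.prems assms by auto
    let ?N = "norm (mat 1 :: real^2^2)"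
    have i: "((\<lambda>s. ?N * (K * t) ^ Suc n / fact n * s ^ n) has_integral
       (?N * (K * t) ^ Suc n / fact n * (1 ^ Suc n / real (Suc n)) - ?N * (K * t) ^ Suc n / fact n * (0 ^ Suc n / real (Suc n)))) {0..1}"
      by (rule fundamental_theorem_of_calculus)
        (auto intro!: derivative_eq_intros simp: has_real_derivative_iff_has_vector_derivative[symmetric] simp del: power_Suc fact_Suc)
    have "norm (integral {0..1} (\<lambda>s. picard n (s *\<^sub>R t *\<^sub>R p) ** \<alpha> (s *\<^sub>R t *\<^sub>R p) (t *\<^sub>R p)))
      \<le> integral {0..1} (\<lambda>s. ?N * (K * t) ^ Suc n / fact n * s ^ n)"
    proof (rule integral_norm_bound_integral)
      show "(\<lambda>s. picard n (s *\<^sub>R t *\<^sub>R p) ** \<alpha> (s *\<^sub>R t *\<^sub>R p) (t *\<^sub>R p)) integrable_on {0..1}"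
        by (intro integrable_continuous_real continuous_on_radial_integrand continuous_on_picard
            scale_in in\<Omega> Suc.prems)
      show "(\<lambda>s. ?N * (K * t) ^ Suc n / fact n * s ^ n) integrable_on {0..1}"
        using i by blast
      fix s :: real assume s: "s \<in> {0..1}"
      have st: "s * t \<in> {0..1}" using s Suc.prems(2) by (auto intro: mult_le_one)
      \<comment> \<open>Linearity of the form extracts a factor \<open>t\<close>; what remains is
        the integrand for \<open>p\<close> at the parameter \<open>s * t\<close>, to which the
        induction hypothesis applies.\<close>
      have "\<alpha> (s *\<^sub>R t *\<^sub>R p) (t *\<^sub>R p) = t *\<^sub>R \<alpha> (s *\<^sub>R t *\<^sub>R p) p"
        using linear_scale[OF lin] scale_in[OF in\<Omega> st] by simp
      then have "norm (picard n (s *\<^sub>R t *\<^sub>R p) ** \<alpha> (s *\<^sub>R t *\<^sub>R p) (t *\<^sub>R p)) =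
        t * norm (picard n ((s * t) *\<^sub>R p) ** \<alpha> ((s * t) *\<^sub>R p) p)"
        using Suc.prems(2) by (simp add: mat_mult.scaleR_right)
      also have "\<dots> \<le> t * (K * norm (picard n ((s * t) *\<^sub>R p)))"
        using Suc.prems sc[OF st] by (intro mult_left_mono K) auto
      also have "\<dots> \<le> t * (K * (?N * ((K * (s * t)) ^ n / fact n)))"
        using Suc.prems \<open>K > 0\<close> st by (intro mult_left_mono Suc.IH) auto
      also have "\<dots> = ?N * (K * t) ^ Suc n / fact n * s ^ n"
        by (simp add: power_mult_distrib mult_ac)
      finally show "norm (picard n (s *\<^sub>R t *\<^sub>R p) ** \<alpha> (s *\<^sub>R t *\<^sub>R p) (t *\<^sub>R p))
        \<le> ?N * (K * t) ^ Suc n / fact n * s ^ n" .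
    qed
    also have "\<dots> = ?N * ((K * t) ^ Suc n / fact (Suc n))"
      unfolding integral_unique[OF i] by (simp add: mult_ac del: power_Suc of_nat_Suc)
    finally show ?case by simp
  qed simp
  show ?thesis using that[OF \<open>K > 0\<close> bound K] by blast
qed

text \<open>The solution is the sum of the Picard series. The factorial bound makes it converge
  uniformly on each closed ball inside \<Omega>, which gives continuity and permits passing to the
  limit under the integral along a ray.\<close>

lemma radial_integral_equation:
  obtains \<Psi> where "continuous_on \<Omega> \<Psi>"
    "\<And>p. p \<in> \<Omega> \<Longrightarrow> \<Psi> p = mat 1 + integral {0..1} (\<lambda>t. \<Psi> (t *\<^sub>R p) ** \<alpha> (t *\<^sub>R p) p)"
proof -
  define S where "S = (\<lambda>n p. \<Sum>i<n. picard i p)"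
  define \<Psi> where "\<Psi> = (\<lambda>p. suminf (\<lambda>i. picard i p))"
  have ul: "uniform_limit (cball 0 r) S \<Psi> sequentially" if r: "cball 0 r \<subseteq> \<Omega>" for r
  proof -
    obtain K where K: "K > 0" "\<And>n p t. p \<in> cball 0 r \<Longrightarrow> t \<in> {0..1} \<Longrightarrow>
      norm (picard n (t *\<^sub>R p)) \<le> norm (mat 1 :: real^2^2) * ((K * t) ^ n / fact n)"
      by (rule picard_bound[OF r]) blast
    show ?thesis
      unfolding S_def \<Psi>_def
    proof (rule Weierstrass_m_test)
      show "norm (picard n p) \<le> norm (mat 1 :: real^2^2) * (K ^ n / fact n)" if "p \<in> cball 0 r" for n p
        using K(2)[OF that, of 1 n] by simp
      show "summable (\<lambda>n. norm (mat 1 :: real^2^2) * (K ^ n / fact n))"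
        using summable_exp[of K] by (intro summable_mult) (simp add: divide_inverse mult.commute)
    qed
  qed
  have contS: "continuous_on \<Omega> (S n)" for n
    unfolding S_def by (intro continuous_on_sum continuous_on_picard)
  have cont\<Psi>: "continuous_on \<Omega> \<Psi>"
    unfolding continuous_on_eq_continuous_at[OF open_domain]
  proof
    fix p assume "p \<in> \<Omega>"
    then obtain r where r: "r > norm p" "cball 0 r \<subseteq> \<Omega>" using balls by blast
    have "continuous_on (cball 0 r) \<Psi>"
      by (rule uniform_limit_theorem[OF _ ul[OF r(2)]])
        (auto intro!: always_eventually continuous_on_subset[OF contS r(2)])
    then have "continuous_on (ball 0 r) \<Psi>" by (rule continuous_on_subset) auto
    then show "isCont \<Psi> p" using r(1) by (simp add: continuous_on_eq_continuous_at)
  qed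
  show ?thesis
  proof (rule that[OF cont\<Psi>])
    fix p assume p: "p \<in> \<Omega>"
    then obtain r where r: "r > norm p" "cball 0 r \<subseteq> \<Omega>" using balls by blast
    have sc: "t *\<^sub>R p \<in> cball 0 r" if "t \<in> {0..1}" for t
      using that r(1) mult_left_le_one_le[of "norm p" t] by simp
    have contr: "continuous_on {0..1} (\<lambda>t. d (t *\<^sub>R p))" if "continuous_on \<Omega> d" for d :: "'e \<Rightarrow> real^2^2"
      by (intro continuous_on_compose2[OF that] continuous_intros) (auto simp: scale_in p)
    have "uniform_limit {0..1} (\<lambda>n t. S n (t *\<^sub>R p) ** \<alpha> (t *\<^sub>R p) p)
        (\<lambda>t. \<Psi> (t *\<^sub>R p) ** \<alpha> (t *\<^sub>R p) p) sequentially"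
    proof (rule mat_mult.bounded_uniform_limit)
      show "uniform_limit {0..1} (\<lambda>n t. S n (t *\<^sub>R p)) (\<lambda>t. \<Psi> (t *\<^sub>R p)) sequentially"
      proof (rule uniform_limitI)
        fix e :: real assume "e > 0"
        from uniform_limitD[OF ul[OF r(2)] this]
        show "\<forall>\<^sub>F n in sequentially. \<forall>t\<in>{0..1}. dist (S n (t *\<^sub>R p)) (\<Psi> (t *\<^sub>R p)) < e"
          by (rule eventually_mono) (use sc in blast)
      qed
      show "uniform_limit {0..1} (\<lambda>n t. \<alpha> (t *\<^sub>R p) p) (\<lambda>t. \<alpha> (t *\<^sub>R p) p) sequentially"
        by (rule uniform_limit_const)
      show "bounded ((\<lambda>t. \<alpha> (t *\<^sub>R p) p) ` {0..1})"
        by (intro compact_imp_bounded compact_continuous_image compact_Icc continuous_on_form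
            continuous_intros) (auto simp: scale_in p)
      show "bounded ((\<lambda>t. \<Psi> (t *\<^sub>R p)) ` {0..1})"
        by (intro compact_imp_bounded compact_continuous_image compact_Icc contr cont\<Psi>)
    qed
    then obtain I J where IJ: "\<And>n. ((\<lambda>t. S n (t *\<^sub>R p) ** \<alpha> (t *\<^sub>R p) p) has_integral I n) {0..1}"
      "((\<lambda>t. \<Psi> (t *\<^sub>R p) ** \<alpha> (t *\<^sub>R p) p) has_integral J) {0..1}" "I \<longlonglongrightarrow> J"
      by (rule uniform_limit_integral[OF _ continuous_on_radial_integrand[OF p contS] sequentially_bot]) blast
    \<comment> \<open>Integrating a partial sum shifts the index by one; the missing term of index 0
      is the identity matrix.\<close>
    have "S (Suc n) p = mat 1 + I n" for n
    proof -
      have "I n = integral {0..1} (\<lambda>t. S n (t *\<^sub>R p) ** \<alpha> (t *\<^sub>R p) p)"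
        using integral_unique[OF IJ(1)] by simp
      also have "\<dots> = (\<Sum>i<n. integral {0..1} (\<lambda>t. picard i (t *\<^sub>R p) ** \<alpha> (t *\<^sub>R p) p))"
        unfolding S_def mat_mult.sum_left
        by (rule integral_sum)
          (auto intro!: integrable_continuous_real continuous_on_radial_integrand p continuous_on_picard)
      finally show ?thesis by (simp add: S_def sum.lessThan_Suc_shift del: sum.lessThan_Suc)
    qed
    moreover have "(\<lambda>n. S (Suc n) p) \<longlonglongrightarrow> \<Psi> p"
      using tendsto_uniform_limitI[OF ul[OF r(2)], of p] r(1) by (intro LIMSEQ_Suc) auto
    ultimately have "(\<lambda>n. mat 1 + I n) \<longlonglongrightarrow> \<Psi> p" by simp
    moreover have "(\<lambda>n. mat 1 + I n) \<longlonglongrightarrow> mat 1 + J" using IJ(3) by (intro tendsto_intros)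
    ultimately have "\<Psi> p = mat 1 + J" using LIMSEQ_unique by blast
    then show "\<Psi> p = mat 1 + integral {0..1} (\<lambda>t. \<Psi> (t *\<^sub>R p) ** \<alpha> (t *\<^sub>R p) p)"
      using IJ(2) by (simp add: integral_unique)
  qed
qed

end

text \<open>A Caratheodory criterion: the quotients \<open>h b\<close> need only be continuous at \<open>p\<close>.\<close>
lemma has_derivative_from_components:
  fixes f :: "'e::euclidean_space \<Rightarrow> 'f::real_normed_vector"
  assumes S: "open S" "p \<in> S"
    and f: "\<And>q. q \<in> S \<Longrightarrow> f q = f p + (\<Sum>b\<in>Basis. ((q - p) \<bullet> b) *\<^sub>R h b q)"
    and h: "\<And>b. b \<in> Basis \<Longrightarrow> isCont (h b) p"
  shows "(f has_derivative (\<lambda>w. \<Sum>b\<in>Basis. (w \<bullet> b) *\<^sub>R h b p)) (at p)"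
proof -
  have "((\<lambda>q. ((q - p) \<bullet> b) *\<^sub>R h b q) has_derivative (\<lambda>w. (w \<bullet> b) *\<^sub>R h b p)) (at p)"
    if b: "b \<in> Basis" for b
    unfolding has_derivative_iff_norm
  proof
    show "bounded_linear (\<lambda>w. (w \<bullet> b) *\<^sub>R h b p)"
      using bounded_linear_compose[OF bounded_linear_scaleR_left bounded_linear_inner_left] by blast
    have "((\<lambda>q. norm (h b q - h b p)) \<longlongrightarrow> 0) (at p)"
      using h[OF b] by (simp add: isCont_def LIM_zero tendsto_norm_zero)
    then show "((\<lambda>q. norm (((q - p) \<bullet> b) *\<^sub>R h b q - ((p - p) \<bullet> b) *\<^sub>R h b p - ((q - p) \<bullet> b) *\<^sub>R h b p) / norm (q - p)) \<longlongrightarrow> 0) (at p)"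
    proof (rule Lim_null_comparison[rotated], intro always_eventually allI)
      fix q
      have "norm (((q - p) \<bullet> b) *\<^sub>R h b q - ((p - p) \<bullet> b) *\<^sub>R h b p - ((q - p) \<bullet> b) *\<^sub>R h b p)
        = \<bar>(q - p) \<bullet> b\<bar> * norm (h b q - h b p)"
        by (simp add: scaleR_diff_right[symmetric])
      also have "\<dots> \<le> norm (q - p) * norm (h b q - h b p)"
        by (intro mult_right_mono Basis_le_norm b) auto
      finally show "norm (norm (((q - p) \<bullet> b) *\<^sub>R h b q - ((p - p) \<bullet> b) *\<^sub>R h b p - ((q - p) \<bullet> b) *\<^sub>R h b p) / norm (q - p))
        \<le> norm (h b q - h b p)"
        by (cases "q = p") (auto simp: divide_le_eq mult.commute)
    qed
  qed
  from has_derivative_add[OF has_derivative_const[of "f p"] has_derivative_sum[of Basis, OF this]]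
  have "((\<lambda>q. f p + (\<Sum>b\<in>Basis. ((q - p) \<bullet> b) *\<^sub>R h b q)) has_derivative
      (\<lambda>w. \<Sum>b\<in>Basis. (w \<bullet> b) *\<^sub>R h b p)) (at p)"
    by simp
  then show ?thesis
    using has_derivative_cong_open[OF S f] by simp
qed

section \<open>The transport equation along rays and the determinant\<close>

locale radial_solution = radial_form \<Omega> \<alpha>
  for \<Omega> :: "'e::euclidean_space set" and \<alpha> +
  fixes \<Psi> :: "'e \<Rightarrow> real^2^2"
  assumes traceless: "\<And>p v. p \<in> \<Omega> \<Longrightarrow> trace (\<alpha> p v) = 0"
    and continuous_\<Psi>: "continuous_on \<Omega> \<Psi>"
    and integral_eq: "\<And>p. p \<in> \<Omega> \<Longrightarrow> \<Psi> p = mat 1 + integral {0..1} (\<lambda>t. \<Psi> (t *\<^sub>R p) ** \<alpha> (t *\<^sub>R p) p)"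
begin

text \<open>Substituting \<open>s\<close> by \<open>t * s\<close> turns the integral equation at
  \<open>t *\<^sub>R p\<close> into an integral from 0 to \<open>t\<close> along the ray of
  \<open>p\<close>, which the fundamental theorem differentiates.\<close>

lemma radial_ode:
  assumes p: "p \<in> \<Omega>" and t: "t \<in> {0..1}"
  shows "((\<lambda>t. \<Psi> (t *\<^sub>R p)) has_vector_derivative \<Psi> (t *\<^sub>R p) ** \<alpha> (t *\<^sub>R p) p) (at t within {0..1})"
proof -
  define f where "f = (\<lambda>s. \<Psi> (s *\<^sub>R p) ** \<alpha> (s *\<^sub>R p) p)"
  define G where "G = (\<lambda>t. integral {0..t} f)"
  have G: "(G has_vector_derivative f s) (at s within {0..1})" if "s \<in> {0..1}" for s
    unfolding G_def f_def
    by (rule integral_has_vector_derivative[OF continuous_on_radial_integrand[OF p continuous_\<Psi>] that])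
  have "\<Psi> (t *\<^sub>R p) = mat 1 + G t" if t: "t \<in> {0..1}" for t
  proof -
    have sub: "(*) t ` {0..1} \<subseteq> {0..1}" using t by (auto intro: mult_le_one)
    have "((\<lambda>s. t *\<^sub>R f (t * s)) has_integral ((G \<circ> (*) t) 1 - (G \<circ> (*) t) 0)) {0..1}"
    proof (rule fundamental_theorem_of_calculus)
      fix s :: real assume s: "s \<in> {0..1}"
      have "(G has_vector_derivative f (t * s)) (at (t * s) within (*) t ` {0..1})"
        using has_vector_derivative_within_subset[OF G sub] s sub by blast
      moreover have "((*) t has_vector_derivative t) (at s within {0..1})"
        using has_vector_derivative_mult_right[OF has_vector_derivative_id, of t] by simp
      ultimately show "((G \<circ> (*) t) has_vector_derivative t *\<^sub>R f (t * s)) (at s within {0..1})"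
        using vector_diff_chain_within by blast
    qed simp
    moreover have "t *\<^sub>R f (t * s) = \<Psi> (s *\<^sub>R t *\<^sub>R p) ** \<alpha> (s *\<^sub>R t *\<^sub>R p) (t *\<^sub>R p)" if "s \<in> {0..1}" for s
    proof -
      have "t * s \<in> {0..1}" using t that by (auto intro: mult_le_one)
      from linear_scale[OF lin[OF scale_in[OF p this]]] show ?thesis
        by (simp add: f_def mat_mult.scaleR_right mult.commute)
    qed
    ultimately have "((\<lambda>s. \<Psi> (s *\<^sub>R t *\<^sub>R p) ** \<alpha> (s *\<^sub>R t *\<^sub>R p) (t *\<^sub>R p)) has_integral G t) {0..1}"
      using has_integral_eq[of "{0..1}" "\<lambda>s. t *\<^sub>R f (t * s)"] by (simp add: G_def)
    then show ?thesis using integral_eq[OF scale_in[OF p t]] by (simp add: integral_unique)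
  qed
  moreover have "((\<lambda>t. mat 1 + G t) has_vector_derivative f t) (at t within {0..1})"
    using has_vector_derivative_add[OF has_vector_derivative_const G[OF t], of "mat 1"] by simp
  ultimately have "((\<lambda>t. \<Psi> (t *\<^sub>R p)) has_vector_derivative f t) (at t within {0..1})"
    by (rule has_vector_derivative_transform[OF t])
  then show ?thesis by (simp add: f_def)
qed

text \<open>The adjugate reverses products and negates traceless matrices. Hence it satisfies the
  equation expected of the inverse, although invertibility is not yet known.\<close>

lemma adjugate_radial_ode:
  assumes p: "p \<in> \<Omega>" and t: "t \<in> {0..1}"
  shows "((\<lambda>t. adjugate2 (\<Psi> (t *\<^sub>R p))) has_vector_derivative
    - (\<alpha> (t *\<^sub>R p) p ** adjugate2 (\<Psi> (t *\<^sub>R p)))) (at t within {0..1})"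
  using bounded_linear.has_vector_derivative[OF bounded_linear_adjugate2 radial_ode[OF assms]]
  by (simp add: adjugate2_mult_rev adjugate2_traceless traceless scale_in[OF assms] mat_mult.minus_left)

lemma value_at_0:
  assumes "0 \<in> \<Omega>"
  shows "\<Psi> 0 = mat 1"
  using integral_eq[OF assms] linear_0[OF lin[OF assms]] by (simp add: mat_mult.zero_right)

text \<open>The integrand is the \<open>t\<close>-derivative of the product of the transport towards
  \<open>q\<close> with the adjugate of the transport towards \<open>p\<close>; at
  \<open>t = 0\<close> this product is the identity.\<close>

lemma transport_difference:
  assumes p: "p \<in> \<Omega>" and q: "q \<in> \<Omega>"
  shows "((\<lambda>t. \<Psi> (t *\<^sub>R q) ** (\<alpha> (t *\<^sub>R q) q - \<alpha> (t *\<^sub>R p) p) ** adjugate2 (\<Psi> (t *\<^sub>R p)))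
    has_integral (\<Psi> q ** adjugate2 (\<Psi> p) - mat 1)) {0..1}"
proof -
  have "((\<lambda>t. \<Psi> (t *\<^sub>R q) ** adjugate2 (\<Psi> (t *\<^sub>R p))) has_vector_derivative
      \<Psi> (t *\<^sub>R q) ** (\<alpha> (t *\<^sub>R q) q - \<alpha> (t *\<^sub>R p) p) ** adjugate2 (\<Psi> (t *\<^sub>R p))) (at t within {0..1})"
    if t: "t \<in> {0..1}" for t
    by (rule has_vector_derivative_eq_rhs[OF mat_mult.has_vector_derivative[OF radial_ode[OF q t] adjugate_radial_ode[OF p t]]])
      (simp add: mat_mult.minus_right mat_mult.minus_left mat_mult.diff_left mat_mult.diff_right matrix_mul_assoc)
  from fundamental_theorem_of_calculus[OF zero_le_one this] value_at_0 scale_in[OF p, of 0]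
  show ?thesis by (simp add: p adjugate2_mat_1)
qed

text \<open>For \<open>q = p\<close> the integrand in \<open>transport_difference\<close> vanishes.
  Thus invertibility, and with it determinant 1, comes out of the variation formula.\<close>

lemma mult_adjugate_\<Psi>: "p \<in> \<Omega> \<Longrightarrow> \<Psi> p ** adjugate2 (\<Psi> p) = mat 1"
  using has_integral_unique[OF transport_difference[of p p] , of 0] by (simp add: mat_mult.zero_left mat_mult.zero_right)

lemma det_\<Psi>: "p \<in> \<Omega> \<Longrightarrow> det (\<Psi> p) = 1"
  using mult_adjugate_\<Psi>[of p] by (simp add: mult_adjugate2) (simp add: matrix_simps2)

end

text \<open>In \<open>\<alpha>' p w v\<close> the first vector is the direction of differentiation
  and the second the argument of the form. With this order \<open>flat\<close> is the vanishing of
  the curvature on the pair \<open>v\<close>, \<open>w\<close>.\<close>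

locale flat_radial_solution = radial_solution \<Omega> \<alpha> \<Psi>
  for \<Omega> :: "'e::euclidean_space set" and \<alpha> \<Psi> +
  fixes \<alpha>' :: "'e \<Rightarrow> 'e \<Rightarrow> 'e \<Rightarrow> real^2^2"
  assumes deriv: "\<And>p v. p \<in> \<Omega> \<Longrightarrow> ((\<lambda>q. \<alpha> q v) has_derivative (\<lambda>w. \<alpha>' p w v)) (at p)"
    and lin': "\<And>p w. p \<in> \<Omega> \<Longrightarrow> linear (\<alpha>' p w)"
    and cont': "continuous_on (\<Omega> \<times> UNIV \<times> UNIV) (\<lambda>(p, w, v). \<alpha>' p w v)"
    and flat: "\<And>p v w. p \<in> \<Omega> \<Longrightarrow>
      \<alpha>' p v w - \<alpha>' p w v + (\<alpha> p v ** \<alpha> p w - \<alpha> p w ** \<alpha> p v) = 0"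
begin

lemma continuous_on_form':
  assumes "continuous_on S f" "continuous_on S g" "continuous_on S h" "\<And>x. x \<in> S \<Longrightarrow> f x \<in> \<Omega>"
  shows "continuous_on S (\<lambda>x. \<alpha>' (f x) (g x) (h x))"
proof -
  have "continuous_on S (\<lambda>x. (\<lambda>(p, w, v). \<alpha>' p w v) (f x, g x, h x))"
    by (rule continuous_on_compose2[OF cont']) (use assms in \<open>auto intro!: continuous_on_Pair\<close>)
  then show ?thesis by simp
qed

lemma linear_expand:
  assumes "linear (L :: 'e \<Rightarrow> real^2^2)"
  shows "L v = (\<Sum>b\<in>Basis. (v \<bullet> b) *\<^sub>R L b)"
proof -
  have "L (\<Sum>b\<in>Basis. (v \<bullet> b) *\<^sub>R b) = (\<Sum>b\<in>Basis. (v \<bullet> b) *\<^sub>R L b)"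
    by (simp add: linear_sum[OF assms] linear_scale[OF assms])
  then show ?thesis by (simp add: euclidean_representation)
qed

text \<open>The derivative of \<open>r \<mapsto> \<alpha>\<^bsub>tr\<^esub>(r)\<close> at \<open>r\<close> in the direction \<open>w\<close>.\<close>
definition radial_deriv :: "real \<Rightarrow> 'e \<Rightarrow> 'e \<Rightarrow> real^2^2" where
  "radial_deriv t r w = \<alpha> (t *\<^sub>R r) w + t *\<^sub>R \<alpha>' (t *\<^sub>R r) w r"

lemma linear_deriv: "p \<in> \<Omega> \<Longrightarrow> linear (\<lambda>w. \<alpha>' p w v)"
  using has_derivative_linear[OF deriv] .

lemma linear_radial_deriv:
  assumes "r \<in> \<Omega>" "t \<in> {0..1}"
  shows "linear (radial_deriv t r)"
  unfolding radial_deriv_def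
  by (intro linear_compose_add lin linear_compose_scale_right linear_deriv scale_in assms)

text \<open>\<open>deriv\<close> concerns a fixed argument vector, whereas here the argument moves
  with the base point; expanding it in the basis reduces this to the product rule.\<close>

lemma has_derivative_radial:
  assumes r: "r \<in> \<Omega>" and t: "t \<in> {0..1}"
  shows "((\<lambda>r. \<alpha> (t *\<^sub>R r) r) has_derivative radial_deriv t r) (at r)"
proof -
  have tr: "t *\<^sub>R r \<in> \<Omega>" by (rule scale_in[OF r t])
  have "((\<lambda>q. \<alpha> (t *\<^sub>R q) b) has_derivative (\<lambda>w. \<alpha>' (t *\<^sub>R r) (t *\<^sub>R w) b)) (at r)" for b
    by (rule has_derivative_compose[of "\<lambda>q. t *\<^sub>R q" "\<lambda>w. t *\<^sub>R w" r UNIV "\<lambda>q. \<alpha> q b", OF _ deriv[OF tr]])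
      (auto intro!: derivative_intros)
  then have "((\<lambda>q. \<Sum>b\<in>Basis. (q \<bullet> b) *\<^sub>R \<alpha> (t *\<^sub>R q) b) has_derivative
      (\<lambda>w. \<Sum>b\<in>Basis. (r \<bullet> b) *\<^sub>R \<alpha>' (t *\<^sub>R r) (t *\<^sub>R w) b + (w \<bullet> b) *\<^sub>R \<alpha> (t *\<^sub>R r) b)) (at r)"
    by (intro has_derivative_sum has_derivative_scaleR has_derivative_inner_left has_derivative_ident)
  moreover have "(\<Sum>b\<in>Basis. (r \<bullet> b) *\<^sub>R \<alpha>' (t *\<^sub>R r) (t *\<^sub>R w) b + (w \<bullet> b) *\<^sub>R \<alpha> (t *\<^sub>R r) b)
      = radial_deriv t r w" for w
    using linear_expand[OF lin[OF tr], of w] linear_expand[OF lin'[OF tr], of "t *\<^sub>R w" r]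
      linear_scale[OF linear_deriv[OF tr], of t w r]
    by (simp add: sum.distrib radial_deriv_def)
  ultimately have "((\<lambda>q. \<Sum>b\<in>Basis. (q \<bullet> b) *\<^sub>R \<alpha> (t *\<^sub>R q) b) has_derivative radial_deriv t r) (at r)"
    by simp
  moreover have "(\<Sum>b\<in>Basis. (q \<bullet> b) *\<^sub>R \<alpha> (t *\<^sub>R q) b) = \<alpha> (t *\<^sub>R q) q" if "q \<in> \<Omega>" for q
    by (rule linear_expand[OF lin[OF scale_in[OF that t]], symmetric])
  ultimately show ?thesis
    by (rule has_derivative_cong_open[OF open_domain r, THEN iffD1, rotated])
qed

text \<open>Hadamard's lemma: integrating the derivative along the segment from \<open>p\<close> to
  \<open>q\<close> writes the increment as coordinates of \<open>q - p\<close> times functions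
  continuous in \<open>q\<close>, the shape required by
  \<open>has_derivative_from_components\<close>.\<close>

lemma radial_increment:
  assumes B: "ball p e \<subseteq> \<Omega>" "q \<in> ball p e" and t: "t \<in> {0..1}"
  shows "\<alpha> (t *\<^sub>R q) q - \<alpha> (t *\<^sub>R p) p =
    (\<Sum>b\<in>Basis. ((q - p) \<bullet> b) *\<^sub>R integral {0..1} (\<lambda>s. radial_deriv t (p + s *\<^sub>R (q - p)) b))"
proof -
  have seg: "p + s *\<^sub>R (q - p) \<in> \<Omega>" if "s \<in> {0..1}" for s
  proof -
    have "norm (s *\<^sub>R (q - p)) \<le> norm (q - p)" using that mult_left_le_one_le[of "norm (q - p)" s] by simp
    then show ?thesis using B by (auto simp: dist_norm norm_minus_commute subset_eq)
  qed
  have c: "continuous_on {0..1} (\<lambda>s. radial_deriv t (p + s *\<^sub>R (q - p)) b)" for b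
    unfolding radial_deriv_def
    by (intro continuous_intros continuous_on_form continuous_on_form') (auto intro!: scale_in seg t)
  have "((\<lambda>s. radial_deriv t (p + s *\<^sub>R (q - p)) (q - p)) has_integral
      \<alpha> (t *\<^sub>R (p + 1 *\<^sub>R (q - p))) (p + 1 *\<^sub>R (q - p)) - \<alpha> (t *\<^sub>R (p + 0 *\<^sub>R (q - p))) (p + 0 *\<^sub>R (q - p))) {0..1}"
  proof (rule fundamental_theorem_of_calculus)
    fix s :: real assume s: "s \<in> {0..1}"
    show "((\<lambda>s. \<alpha> (t *\<^sub>R (p + s *\<^sub>R (q - p))) (p + s *\<^sub>R (q - p))) has_vector_derivative
        radial_deriv t (p + s *\<^sub>R (q - p)) (q - p)) (at s within {0..1})"
      unfolding has_vector_derivative_def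
    proof (rule has_derivative_eq_rhs)
      show "((\<lambda>s. \<alpha> (t *\<^sub>R (p + s *\<^sub>R (q - p))) (p + s *\<^sub>R (q - p))) has_derivative
        (\<lambda>x. radial_deriv t (p + s *\<^sub>R (q - p)) (x *\<^sub>R (q - p)))) (at s within {0..1})"
        by (rule has_derivative_compose[of "\<lambda>s. p + s *\<^sub>R (q - p)" "\<lambda>x. x *\<^sub>R (q - p)" s _ "\<lambda>r. \<alpha> (t *\<^sub>R r) r",
            OF _ has_derivative_radial[OF seg[OF s] t]])
          (auto intro!: derivative_eq_intros)
      show "(\<lambda>x. radial_deriv t (p + s *\<^sub>R (q - p)) (x *\<^sub>R (q - p))) =
        (\<lambda>x. x *\<^sub>R radial_deriv t (p + s *\<^sub>R (q - p)) (q - p))"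
        using linear_scale[OF linear_radial_deriv[OF seg[OF s] t]] by blast
    qed
  qed simp
  then have "\<alpha> (t *\<^sub>R q) q - \<alpha> (t *\<^sub>R p) p = integral {0..1} (\<lambda>s. radial_deriv t (p + s *\<^sub>R (q - p)) (q - p))"
    by (simp add: integral_unique)
  also have "\<dots> = integral {0..1} (\<lambda>s. \<Sum>b\<in>Basis. ((q - p) \<bullet> b) *\<^sub>R radial_deriv t (p + s *\<^sub>R (q - p)) b)"
    by (rule integral_cong) (rule linear_expand[OF linear_radial_deriv[OF seg t]])
  also have "\<dots> = (\<Sum>b\<in>Basis. ((q - p) \<bullet> b) *\<^sub>R integral {0..1} (\<lambda>s. radial_deriv t (p + s *\<^sub>R (q - p)) b))"
    by (subst integral_sum) (auto intro!: integrable_continuous_real continuous_intros c)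
  finally show ?thesis .
qed

text \<open>The map differentiated first is \<open>\<Psi> q ** adjugate2 (\<Psi> p)\<close> with
  \<open>p\<close> fixed, since this is the product in \<open>transport_difference\<close>;
  multiplying by \<open>\<Psi> p\<close> on the right returns to \<Psi>.\<close>

lemma has_derivative_\<Psi>:
  assumes p: "p \<in> \<Omega>"
  shows "(\<Psi> has_derivative (\<lambda>w. \<Psi> p ** \<alpha> p w)) (at p)"
proof -
  obtain e where e: "e > 0" "ball p e \<subseteq> \<Omega>" using open_domain p open_contains_ball by blast
  \<comment> \<open>\<open>Q b q t\<close> is the coefficient supplied by
    \<open>radial_increment\<close> for the coordinate \<open>b\<close>; \<open>h b q\<close>, its
    integral between the two transports, is the difference quotient in that coordinate.\<close>
  define Q where "Q = (\<lambda>b q t. integral {0..1} (\<lambda>s. radial_deriv t (p + s *\<^sub>R (q - p)) b))"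
  define h where "h = (\<lambda>b q. integral {0..1} (\<lambda>t. \<Psi> (t *\<^sub>R q) ** Q b q t ** adjugate2 (\<Psi> (t *\<^sub>R p))))"
  have in\<Omega>: "t *\<^sub>R (p + s *\<^sub>R (q - p)) \<in> \<Omega>" if "q \<in> ball p e" "t \<in> {0..1}" "s \<in> {0..1}" for q t s
  proof -
    have "norm (s *\<^sub>R (q - p)) \<le> norm (q - p)" using that mult_left_le_one_le[of "norm (q - p)" s] by simp
    then have "p + s *\<^sub>R (q - p) \<in> \<Omega>" using that e by (auto simp: dist_norm norm_minus_commute subset_eq)
    then show ?thesis using scale_in that by blast
  qed
  have in\<Omega>1: "t *\<^sub>R q \<in> \<Omega>" if "q \<in> ball p e" "t \<in> {0..1}" for q t
    using in\<Omega>[of q t 1] that by simp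
  have contQ: "continuous_on (ball p e \<times> {0..1}) (\<lambda>(q, t). Q b q t)" for b
  proof -
    have "continuous_on ((ball p e \<times> {0..1}) \<times> cbox 0 1)
        (\<lambda>(x, s). radial_deriv (snd x) (p + s *\<^sub>R (fst x - p)) b)"
      unfolding radial_deriv_def split_beta
      by (intro continuous_intros continuous_on_form continuous_on_form') (auto intro!: in\<Omega>)
    from integral_continuous_on_param[OF this] show ?thesis by (simp add: Q_def split_beta)
  qed
  have int: "continuous_on (ball p e \<times> cbox 0 1) (\<lambda>(q, t). \<Psi> (t *\<^sub>R q) ** Q b q t ** adjugate2 (\<Psi> (t *\<^sub>R p)))" for b
    using contQ[of b] unfolding split_beta cbox_interval
    by (intro mat_mult.continuous_on bounded_linear.continuous_on[OF bounded_linear_adjugate2]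
        continuous_on_compose2[OF continuous_\<Psi>] continuous_intros)
      (use e(2) in \<open>auto intro!: in\<Omega>1 scale_in p simp: subset_eq\<close>)
  have conth: "isCont (h b) p" for b
    using integral_continuous_on_param[OF int[of b]] e(1)
    by (simp add: h_def continuous_on_eq_continuous_at)
  have "\<Psi> q ** adjugate2 (\<Psi> p) = \<Psi> p ** adjugate2 (\<Psi> p) + (\<Sum>b\<in>Basis. ((q - p) \<bullet> b) *\<^sub>R h b q)"
    if q: "q \<in> ball p e" for q
  proof -
    have c: "continuous_on {0..1} (\<lambda>t. \<Psi> (t *\<^sub>R q) ** Q b q t ** adjugate2 (\<Psi> (t *\<^sub>R p)))" for b
    proof -
      have "continuous_on {0..1} (\<lambda>t. (\<lambda>(q, t). \<Psi> (t *\<^sub>R q) ** Q b q t ** adjugate2 (\<Psi> (t *\<^sub>R p))) (q, t))"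
        by (rule continuous_on_compose2[OF int[of b]]) (use q in \<open>auto intro!: continuous_on_Pair\<close>)
      then show ?thesis by simp
    qed
    have "q \<in> \<Omega>" using q e by blast
    from integral_unique[OF transport_difference[OF p this]]
    have "\<Psi> q ** adjugate2 (\<Psi> p) - mat 1 =
      integral {0..1} (\<lambda>t. \<Psi> (t *\<^sub>R q) ** (\<alpha> (t *\<^sub>R q) q - \<alpha> (t *\<^sub>R p) p) ** adjugate2 (\<Psi> (t *\<^sub>R p)))"
      by simp
    also have "\<dots> = integral {0..1} (\<lambda>t. \<Sum>b\<in>Basis. ((q - p) \<bullet> b) *\<^sub>R (\<Psi> (t *\<^sub>R q) ** Q b q t ** adjugate2 (\<Psi> (t *\<^sub>R p))))"
      by (rule integral_cong)
        (simp add: radial_increment[OF e(2) q] Q_def mat_mult.sum_right mat_mult.sum_left mat_mult.scaleR_left mat_mult.scaleR_right)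
    also have "\<dots> = (\<Sum>b\<in>Basis. ((q - p) \<bullet> b) *\<^sub>R h b q)"
      unfolding h_def
      by (subst integral_sum) (auto intro!: integrable_continuous_real continuous_intros c)
    finally show ?thesis by (simp add: mult_adjugate_\<Psi>[OF p] algebra_simps)
  qed
  from has_derivative_from_components[of "ball p e" p "\<lambda>q. \<Psi> q ** adjugate2 (\<Psi> p)" h, OF open_ball _ this conth] e(1)
  have D: "((\<lambda>q. \<Psi> q ** adjugate2 (\<Psi> p)) has_derivative (\<lambda>w. \<Sum>b\<in>Basis. (w \<bullet> b) *\<^sub>R h b p)) (at p)"
    by simp
  \<comment> \<open>By flatness the integrand of \<open>h b p\<close> is the derivative of \<open>t \<mapsto> \<Psi>(tp) (t \<alpha>\<^bsub>tp\<^esub>(b)) \<Psi>(tp)\<^sup>-\<^sup>1\<close>.\<close>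
  have hp: "h b p = \<Psi> p ** \<alpha> p b ** adjugate2 (\<Psi> p)" for b
  proof -
    have V: "((\<lambda>t. \<Psi> (t *\<^sub>R p) ** (t *\<^sub>R \<alpha> (t *\<^sub>R p) b) ** adjugate2 (\<Psi> (t *\<^sub>R p))) has_vector_derivative
      \<Psi> (t *\<^sub>R p) ** Q b p t ** adjugate2 (\<Psi> (t *\<^sub>R p))) (at t within {0..1})" if t: "t \<in> {0..1}" for t
    proof -
      note tp = scale_in[OF p t]
      have "((\<lambda>t. \<alpha> (t *\<^sub>R p) b) has_derivative (\<lambda>x. \<alpha>' (t *\<^sub>R p) (x *\<^sub>R p) b)) (at t within {0..1})"
        by (rule has_derivative_compose[of "\<lambda>t. t *\<^sub>R p" "\<lambda>x. x *\<^sub>R p" t _ "\<lambda>q. \<alpha> q b", OF _ deriv[OF tp]])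
          (auto intro!: derivative_eq_intros)
      then have 1: "((\<lambda>t. \<alpha> (t *\<^sub>R p) b) has_vector_derivative \<alpha>' (t *\<^sub>R p) p b) (at t within {0..1})"
        using linear_scale[OF linear_deriv[OF tp]] by (simp add: has_vector_derivative_def)
      have 2: "((\<lambda>t. t *\<^sub>R \<alpha> (t *\<^sub>R p) b) has_vector_derivative t *\<^sub>R \<alpha>' (t *\<^sub>R p) p b + \<alpha> (t *\<^sub>R p) b) (at t within {0..1})"
        using bounded_bilinear.has_vector_derivative[OF bounded_bilinear_scaleR has_vector_derivative_id 1] by simp
      note 3 = mat_mult.has_vector_derivative[OF mat_mult.has_vector_derivative[OF radial_ode[OF p t] 2] adjugate_radial_ode[OF p t]]
      \<comment> \<open>Flatness exchanges the derivative of \<open>\<alpha>(b)\<close> along the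
        ray for that of \<open>\<alpha>(p)\<close> in direction \<open>b\<close>, which is the one
        occurring in \<open>Q\<close>. The commutator it costs cancels the terms from
        differentiating the two transports.\<close>
      have eq: "\<alpha>' (t *\<^sub>R p) p b = \<alpha>' (t *\<^sub>R p) b p - (\<alpha> (t *\<^sub>R p) p ** \<alpha> (t *\<^sub>R p) b - \<alpha> (t *\<^sub>R p) b ** \<alpha> (t *\<^sub>R p) p)"
        using flat[OF tp, of p b] by (simp add: algebra_simps eq_neg_iff_add_eq_0)
      have Q: "Q b p t = \<alpha> (t *\<^sub>R p) b + t *\<^sub>R \<alpha>' (t *\<^sub>R p) b p"
        by (simp add: Q_def radial_deriv_def)
      show ?thesis
        by (rule has_vector_derivative_eq_rhs[OF 3])
          (simp add: Q eq mat_mult.minus_right mat_mult.minus_left mat_mult.diff_left mat_mult.diff_right mat_mult.add_left mat_mult.add_right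
            mat_mult.scaleR_left mat_mult.scaleR_right matrix_mul_assoc algebra_simps)
    qed
    from fundamental_theorem_of_calculus[OF _ V] have
      "((\<lambda>t. \<Psi> (t *\<^sub>R p) ** Q b p t ** adjugate2 (\<Psi> (t *\<^sub>R p))) has_integral
        (\<Psi> p ** \<alpha> p b ** adjugate2 (\<Psi> p))) {0..1}"
      by (simp add: mat_mult.zero_left mat_mult.zero_right)
    then show ?thesis by (simp add: h_def integral_unique)
  qed
  have "(\<Sum>b\<in>Basis. (w \<bullet> b) *\<^sub>R h b p) = \<Psi> p ** \<alpha> p w ** adjugate2 (\<Psi> p)" for w
    by (subst linear_expand[OF lin[OF p], of w])
      (simp add: hp mat_mult.sum_right mat_mult.sum_left mat_mult.scaleR_left mat_mult.scaleR_right)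
  with D have "((\<lambda>q. \<Psi> q ** adjugate2 (\<Psi> p)) has_derivative (\<lambda>w. \<Psi> p ** \<alpha> p w ** adjugate2 (\<Psi> p))) (at p)"
    by simp
  from bounded_linear.has_derivative[OF mat_mult.bounded_linear_left this, of "\<Psi> p"]
  show ?thesis
    by (simp add: matrix_mul_assoc[symmetric] adjugate2_mult det_\<Psi>[OF p])
qed

end

section \<open>Flat connections on simply connected regions\<close>

text \<open>The Riemann mapping theorem leaves out the whole plane, but the plane is already radial,
  so the identity serves there.\<close>

lemma simply_connected_biholomorphic_to_radial:
  fixes S :: "complex set"
  assumes "open S" "simply_connected S" "S \<noteq> {}"
  obtains \<Omega> f g where "\<And>z. z \<in> \<Omega> \<Longrightarrow> \<exists>r>norm z. cball 0 r \<subseteq> \<Omega>" "open \<Omega>"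
    "f holomorphic_on S" "g holomorphic_on \<Omega>"
    "\<And>z. z \<in> S \<Longrightarrow> f z \<in> \<Omega>" "\<And>z. z \<in> S \<Longrightarrow> g (f z) = z" "\<And>z. z \<in> \<Omega> \<Longrightarrow> g z \<in> S"
proof (cases "S = UNIV")
  case True
  show ?thesis
    by (rule that[of UNIV "\<lambda>z. z" "\<lambda>z. z"]) (auto simp: True intro: gt_ex)
next
  case False
  then obtain f g where fg: "f holomorphic_on S" "g holomorphic_on ball 0 1"
    "\<forall>z\<in>S. f z \<in> ball 0 1 \<and> g (f z) = z" "\<forall>z\<in>ball 0 1. g z \<in> S \<and> f (g z) = z"
    using simply_connected_eq_biholomorphic_to_disc[OF assms(1)] assms(2,3) by auto
  have "\<exists>r>norm z. cball 0 r \<subseteq> ball 0 1" if z: "z \<in> ball 0 1" for z :: complex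
  proof -
    have "norm z < 1" using z by simp
    then obtain r where "norm z < r" "r < 1" using dense by blast
    then show ?thesis by (intro exI[of _ r]) auto
  qed
  then show ?thesis using fg by (intro that[of "ball 0 1" f g]) auto
qed

lemma trace_scaleR: "trace (c *\<^sub>R X) = c * trace (X :: real^'n^'n)"
  by (simp add: trace_def sum_distrib_left)

text \<open>The form with coefficients \<open>A\<close> and \<open>B\<close> is pulled back by
  \<open>g\<close> to the radial domain and integrated there; composing the solution with
  \<open>f\<close> brings it back to \<open>S\<close>.\<close>

lemma flat_connection_trivial_complex:
  fixes A B :: "complex \<Rightarrow> real^2^2"
  assumes S: "open S" "simply_connected S" "S \<noteq> {}"
    and dA: "\<And>z. z \<in> S \<Longrightarrow> (A has_derivative A' z) (at z)"
    and dB: "\<And>z. z \<in> S \<Longrightarrow> (B has_derivative B' z) (at z)"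
    and cA': "\<And>w. continuous_on S (\<lambda>z. A' z w)" and cB': "\<And>w. continuous_on S (\<lambda>z. B' z w)"
    and tr: "\<And>z. z \<in> S \<Longrightarrow> trace (A z) = 0" "\<And>z. z \<in> S \<Longrightarrow> trace (B z) = 0"
    and flat: "\<And>z. z \<in> S \<Longrightarrow> B' z 1 - A' z \<i> + (A z ** B z - B z ** A z) = 0"
  shows "\<exists>\<Psi>. (\<forall>z\<in>S. det (\<Psi> z) = 1) \<and>
    (\<forall>z\<in>S. (\<Psi> has_derivative (\<lambda>w. \<Psi> z ** (Re w *\<^sub>R A z + Im w *\<^sub>R B z))) (at z))"
proof -
  obtain \<Omega> f g where \<Omega>: "\<And>z. z \<in> \<Omega> \<Longrightarrow> \<exists>r>norm z. cball 0 r \<subseteq> \<Omega>" "open \<Omega>"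
    and fg: "f holomorphic_on S" "g holomorphic_on \<Omega>"
      "\<And>z. z \<in> S \<Longrightarrow> f z \<in> \<Omega>" "\<And>z. z \<in> S \<Longrightarrow> g (f z) = z" "\<And>z. z \<in> \<Omega> \<Longrightarrow> g z \<in> S"
    by (rule simply_connected_biholomorphic_to_radial[OF S]) blast
  define h where "h = deriv g"
  define k where "k = deriv h"
  have hol: "h holomorphic_on \<Omega>" "k holomorphic_on \<Omega>"
    unfolding h_def k_def by (intro holomorphic_deriv fg \<Omega>)+
  have dg: "(g has_derivative (\<lambda>w. h z * w)) (at z)" if "z \<in> \<Omega>" for z
    using holomorphic_derivI[OF fg(2) \<Omega>(2) that] by (simp add: h_def has_field_derivative_def)
  have dh: "(h has_derivative (\<lambda>w. k z * w)) (at z)" if "z \<in> \<Omega>" for z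
    using holomorphic_derivI[OF hol(1) \<Omega>(2) that] by (simp add: k_def has_field_derivative_def)
  note cg = holomorphic_on_imp_continuous_on[OF fg(2)]
    and ch = holomorphic_on_imp_continuous_on[OF hol(1)]
    and ck = holomorphic_on_imp_continuous_on[OF hol(2)]
  have cA: "continuous_on S A" and cB: "continuous_on S B"
    using dA dB by (auto intro!: continuous_at_imp_continuous_on has_derivative_continuous)
  define \<alpha> where "\<alpha> = (\<lambda>z v. Re (h z * v) *\<^sub>R A (g z) + Im (h z * v) *\<^sub>R B (g z))"
  \<comment> \<open>The product rule for the pulled-back form, where \<open>h\<close> and
    \<open>k\<close> are the first two derivatives of \<open>g\<close>. \<open>A'\<close> and
    \<open>B'\<close> are expanded over 1 and \<i> because their continuity is given for fixed
    directions.\<close>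
  define \<alpha>' where "\<alpha>' = (\<lambda>z w v.
    (Re (h z * v) *\<^sub>R (Re (h z * w) *\<^sub>R A' (g z) 1 + Im (h z * w) *\<^sub>R A' (g z) \<i>) + Re (k z * w * v) *\<^sub>R A (g z)) +
    (Im (h z * v) *\<^sub>R (Re (h z * w) *\<^sub>R B' (g z) 1 + Im (h z * w) *\<^sub>R B' (g z) \<i>) + Im (k z * w * v) *\<^sub>R B (g z)))"
  have expand: "L w = Re w *\<^sub>R L 1 + Im w *\<^sub>R L \<i>" if "linear L" for L :: "complex \<Rightarrow> real^2^2" and w
  proof -
    have "L (Re w *\<^sub>R 1 + Im w *\<^sub>R \<i>) = Re w *\<^sub>R L 1 + Im w *\<^sub>R L \<i>"
      by (simp only: linear_add[OF that] linear_scale[OF that])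
    moreover have "Re w *\<^sub>R 1 + Im w *\<^sub>R \<i> = w" by (simp add: complex_eq_iff)
    ultimately show ?thesis by simp
  qed
  interpret radial_form \<Omega> \<alpha>
  proof (rule radial_form.intro)
    show "\<exists>r>norm z. cball 0 r \<subseteq> \<Omega>" if "z \<in> \<Omega>" for z using \<Omega>(1)[OF that] .
    show "linear (\<alpha> z)" if "z \<in> \<Omega>" for z
      by (rule linearI) (simp_all add: \<alpha>_def algebra_simps scaleR_add_left)
    show "continuous_on (\<Omega> \<times> UNIV) (\<lambda>(z, v). \<alpha> z v)"
      unfolding \<alpha>_def split_beta
      by (intro continuous_intros continuous_on_compose2[OF cA] continuous_on_compose2[OF cB]
          continuous_on_compose2[OF cg] continuous_on_compose2[OF ch]) (auto simp: fg(5))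
  qed
  obtain \<Theta> :: "complex \<Rightarrow> real^2^2" where \<Theta>: "continuous_on \<Omega> \<Theta>"
    "\<And>p. p \<in> \<Omega> \<Longrightarrow> \<Theta> p = mat 1 + integral {0..1} (\<lambda>t. \<Theta> (t *\<^sub>R p) ** \<alpha> (t *\<^sub>R p) p)"
    using that by (rule radial_integral_equation)
  interpret flat_radial_solution \<Omega> \<alpha> \<Theta> \<alpha>'
  proof (intro flat_radial_solution.intro radial_solution.intro radial_solution_axioms.intro
      flat_radial_solution_axioms.intro)
    fix z v w assume z: "z \<in> \<Omega>"
    show "trace (\<alpha> z v) = 0"
      using tr[OF fg(5)[OF z]] by (simp add: \<alpha>_def trace_add trace_scaleR)
    show "linear (\<alpha>' z w)"
      by (rule linearI) (simp_all add: \<alpha>'_def algebra_simps scaleR_add_left)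
    show "((\<lambda>q. \<alpha> q v) has_derivative (\<lambda>w. \<alpha>' z w v)) (at z)"
    proof -
      have A: "((\<lambda>q. A (g q)) has_derivative (\<lambda>w. A' (g z) (h z * w))) (at z)"
        and B: "((\<lambda>q. B (g q)) has_derivative (\<lambda>w. B' (g z) (h z * w))) (at z)"
        using has_derivative_compose[OF dg[OF z] dA[OF fg(5)[OF z]]]
          has_derivative_compose[OF dg[OF z] dB[OF fg(5)[OF z]]] by simp_all
      have H: "((\<lambda>q. h q * v) has_derivative (\<lambda>w. k z * w * v)) (at z)"
        by (rule has_derivative_mult_left[OF dh[OF z]])
      have "((\<lambda>q. \<alpha> q v) has_derivative (\<lambda>w.
         (Re (h z * v) *\<^sub>R A' (g z) (h z * w) + Re (k z * w * v) *\<^sub>R A (g z)) +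
         (Im (h z * v) *\<^sub>R B' (g z) (h z * w) + Im (k z * w * v) *\<^sub>R B (g z)))) (at z)"
        unfolding \<alpha>_def
        by (intro has_derivative_add has_derivative_scaleR A B has_derivative_Re has_derivative_Im H)
      moreover have "A' (g z) (h z * w) = Re (h z * w) *\<^sub>R A' (g z) 1 + Im (h z * w) *\<^sub>R A' (g z) \<i>"
        "B' (g z) (h z * w) = Re (h z * w) *\<^sub>R B' (g z) 1 + Im (h z * w) *\<^sub>R B' (g z) \<i>" for w
        using expand[OF has_derivative_linear[OF dA[OF fg(5)[OF z]]]]
          expand[OF has_derivative_linear[OF dB[OF fg(5)[OF z]]]] by blast+
      ultimately show ?thesis by (simp only: \<alpha>'_def)
    qed
    have B': "B' (g z) 1 = A' (g z) \<i> - (A (g z) ** B (g z) - B (g z) ** A (g z))"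
      using flat[OF fg(5)[OF z]] by (simp add: algebra_simps eq_neg_iff_add_eq_0)
    \<comment> \<open>The terms with \<open>k\<close> are symmetric in \<open>v\<close> and
      \<open>w\<close> and cancel; the rest is the curvature of \<open>A\<close> and
      \<open>B\<close> at \<open>g z\<close> times a determinant.\<close>
    show "\<alpha>' z v w - \<alpha>' z w v + (\<alpha> z v ** \<alpha> z w - \<alpha> z w ** \<alpha> z v) = 0"
      unfolding \<alpha>'_def \<alpha>_def B'
      by (simp add: mat_mult.add_left mat_mult.add_right mat_mult.scaleR_left mat_mult.scaleR_right mult.commute[of v w] mult.assoc
         scaleR_add_right scaleR_diff_right algebra_simps del: times_complex.sel)
  next
    show "continuous_on (\<Omega> \<times> UNIV \<times> UNIV) (\<lambda>(z, w, v). \<alpha>' z w v)"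
      unfolding \<alpha>'_def split_beta
      by (intro continuous_intros continuous_on_compose2[OF cA] continuous_on_compose2[OF cB]
          continuous_on_compose2[OF cA'] continuous_on_compose2[OF cB']
          continuous_on_compose2[OF cg] continuous_on_compose2[OF ch] continuous_on_compose2[OF ck])
        (auto simp: fg(5))
  qed (fact \<Theta> radial_form_axioms)+
  show ?thesis
  proof (intro exI[of _ "\<lambda>z. \<Theta> (f z)"] conjI ballI)
    show "det (\<Theta> (f z)) = 1" if "z \<in> S" for z using det_\<Psi> fg(3)[OF that] .
    fix z assume z: "z \<in> S"
    have df: "(f has_derivative (\<lambda>w. deriv f z * w)) (at z)"
      using holomorphic_derivI[OF fg(1) S(1) z] by (simp add: has_field_derivative_def)
    \<comment> \<open>Since \<open>g\<close> after \<open>f\<close> is the identity, their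
      derivatives cancel, so pulling back by \<open>g\<close> and then by \<open>f\<close> restores
      the original form.\<close>
    have "((\<lambda>z. g (f z)) has_derivative (\<lambda>w. h (f z) * (deriv f z * w))) (at z)"
      by (rule has_derivative_compose[OF df dg[OF fg(3)[OF z]]])
    then have "((\<lambda>z. z) has_derivative (\<lambda>w. h (f z) * (deriv f z * w))) (at z)"
      using has_derivative_cong_open[OF S(1) z, of "\<lambda>z. g (f z)" "\<lambda>z. z"] fg(4) by simp
    then have inv: "h (f z) * (deriv f z * w) = w" for w
      using has_derivative_unique[OF has_derivative_ident] by metis
    have "\<alpha> (f z) (deriv f z * w) = Re w *\<^sub>R A z + Im w *\<^sub>R B z" for w
      by (simp only: \<alpha>_def fg(4)[OF z] inv)
    then show "((\<lambda>z. \<Theta> (f z)) has_derivative (\<lambda>w. \<Theta> (f z) ** (Re w *\<^sub>R A z + Im w *\<^sub>R B z))) (at z)"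
      using has_derivative_compose[OF df has_derivative_\<Psi>[OF fg(3)[OF z]]] by simp
  qed
qed

lemma flat_connection_trivial:
  fixes A B :: "real \<times> real \<Rightarrow> real^2^2"
  assumes D: "open D" "simply_connected D" "D \<noteq> {}"
    and dA: "\<And>p. p \<in> D \<Longrightarrow> (A has_derivative A' p) (at p)"
    and dB: "\<And>p. p \<in> D \<Longrightarrow> (B has_derivative B' p) (at p)"
    and cA': "\<And>w. continuous_on D (\<lambda>p. A' p w)" and cB': "\<And>w. continuous_on D (\<lambda>p. B' p w)"
    and tr: "\<And>p. p \<in> D \<Longrightarrow> trace (A p) = 0" "\<And>p. p \<in> D \<Longrightarrow> trace (B p) = 0"
    and flat: "\<And>p. p \<in> D \<Longrightarrow> B' p (1, 0) - A' p (0, 1) + (A p ** B p - B p ** A p) = 0"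
  shows "\<exists>\<Psi>. (\<forall>p\<in>D. det (\<Psi> p) = 1) \<and>
    (\<forall>p\<in>D. (\<Psi> has_derivative (\<lambda>w. \<Psi> p ** (fst w *\<^sub>R A p + snd w *\<^sub>R B p))) (at p))"
proof -
  define c where "c = (\<lambda>z. (Re z, Im z))"
  define d where "d = (\<lambda>p. Complex (fst p) (snd p))"
  have cd: "c (d p) = p" "d (c z) = z" for p z by (simp_all add: c_def d_def)
  have blc: "bounded_linear c"
    unfolding c_def by (intro bounded_linear_Pair bounded_linear_Re bounded_linear_Im)
  have "linear d" by (rule linearI) (simp_all add: d_def complex_eq_iff)
  then have bld: "bounded_linear d" by (simp add: linear_conv_bounded_linear)
  note dc = bounded_linear_imp_has_derivative[OF blc] and dd = bounded_linear_imp_has_derivative[OF bld]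
  note contc = linear_continuous_on[OF blc] and contd = linear_continuous_on[OF bld]
  define S where "S = c -` D"
  have inS: "d p \<in> S \<longleftrightarrow> p \<in> D" for p by (simp add: S_def cd)
  have S1: "open S" unfolding S_def by (rule open_vimage[OF D(1) contc])
  have "D homeomorphic S"
    unfolding homeomorphic_def homeomorphism_def
  proof (intro exI conjI ballI)
    have "z \<in> d ` D" if "z \<in> S" for z
      using that image_eqI[of z d "c z" D] by (simp add: S_def cd)
    then show "d ` D = S" by (auto simp: S_def cd)
    have "p \<in> c ` S" if "p \<in> D" for p
      using that image_eqI[of p c "d p" S] by (simp add: inS cd)
    then show "c ` S = D" by (auto simp: S_def)
  qed (simp_all add: cd contc contd)
  then have S2: "simply_connected S" using D(2) homeomorphic_simply_connected by blast
  have S3: "S \<noteq> {}" using D(3) inS by blast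
  have SA: "((\<lambda>z. A (c z)) has_derivative (\<lambda>w. A' (c z) (c w))) (at z)" if "z \<in> S" for z
    using has_derivative_compose[OF dc dA] that by (simp add: S_def)
  have SB: "((\<lambda>z. B (c z)) has_derivative (\<lambda>w. B' (c z) (c w))) (at z)" if "z \<in> S" for z
    using has_derivative_compose[OF dc dB] that by (simp add: S_def)
  have SC: "continuous_on S (\<lambda>z. A' (c z) (c w))" "continuous_on S (\<lambda>z. B' (c z) (c w))" for w
    by (rule continuous_on_compose2[OF cA' contc] continuous_on_compose2[OF cB' contc], force simp: S_def)+
  have ST: "trace (A (c z)) = 0" "trace (B (c z)) = 0"
    "B' (c z) (c 1) - A' (c z) (c \<i>) + (A (c z) ** B (c z) - B (c z) ** A (c z)) = 0" if "z \<in> S" for z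
    using that tr flat by (simp_all add: S_def c_def)
  have "\<exists>\<Psi>. (\<forall>z\<in>S. det (\<Psi> z) = 1) \<and>
    (\<forall>z\<in>S. (\<Psi> has_derivative (\<lambda>w. \<Psi> z ** (Re w *\<^sub>R A (c z) + Im w *\<^sub>R B (c z)))) (at z))"
    by (rule flat_connection_trivial_complex[OF S1 S2 S3 SA SB SC ST])
  then obtain \<Psi> where \<Psi>: "\<forall>z\<in>S. det (\<Psi> z) = 1"
    "\<forall>z\<in>S. (\<Psi> has_derivative (\<lambda>w. \<Psi> z ** (Re w *\<^sub>R A (c z) + Im w *\<^sub>R B (c z)))) (at z)"
    by auto
  show ?thesis
  proof (intro exI[of _ "\<lambda>p. \<Psi> (d p)"] conjI ballI)
    fix p assume p: "p \<in> D"
    show "det (\<Psi> (d p)) = 1" using \<Psi>(1) inS p by blast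
    show "((\<lambda>p. \<Psi> (d p)) has_derivative (\<lambda>w. \<Psi> (d p) ** (fst w *\<^sub>R A p + snd w *\<^sub>R B p))) (at p)"
      using has_derivative_compose[OF dd \<Psi>(2)[THEN bspec, OF inS[THEN iffD2, OF p]]] by (simp add: cd) (simp add: d_def)
  qed
qed

section \<open>Framed maps\<close>

lemma matrix_inv_SL2:
  assumes "A \<in> SL2"
  shows "matrix_inv A = adjugate2 A"
proof -
  have d: "det A = 1" using assms by (simp add: SL2_def)
  have "invertible A" using d by (simp add: invertible_det_nz)
  then have "A ** matrix_inv A = mat 1" unfolding matrix_inv_def invertible_def by (rule someI2_ex) blast
  then have "adjugate2 A ** A ** matrix_inv A = adjugate2 A"
    by (simp add: matrix_mul_assoc[symmetric])
  then show ?thesis by (simp add: adjugate2_mult d)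
qed

lemma adjugate2_adjugate2: "adjugate2 (adjugate2 A) = A"
  by (simp add: adjugate2_def matrix_simps2)

lemma mat_1_SL2: "mat 1 \<in> SL2"
  by (simp add: SL2_def)

lemma mult_SL2: "A \<in> SL2 \<Longrightarrow> B \<in> SL2 \<Longrightarrow> A ** B \<in> SL2"
  by (simp add: SL2_def det_mul)

lemma adjugate2_SL2: "A \<in> SL2 \<Longrightarrow> adjugate2 A \<in> SL2"
  by (simp add: SL2_def adjugate2_def det_2 trace_def sum_2 mat_def mult.commute)

lemma SL2_mult_adjugate2: "A \<in> SL2 \<Longrightarrow> A ** adjugate2 A = mat 1"
  and SL2_adjugate2_mult: "A \<in> SL2 \<Longrightarrow> adjugate2 A ** A = mat 1"
  by (simp_all add: SL2_def mult_adjugate2 adjugate2_mult)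

lemma SL2_adjugate2_cancel:
  assumes "A \<in> SL2"
  shows "A ** (adjugate2 A ** X) = X" "adjugate2 A ** (A ** X) = X"
  by (simp_all add: matrix_mul_assoc SL2_mult_adjugate2 SL2_adjugate2_mult assms)

lemma Ad_SL2: "g \<in> SL2 \<Longrightarrow> Ad g X = g ** X ** adjugate2 g"
  by (simp add: Ad_def matrix_inv_SL2)

lemma Ad_mult:
  assumes "a \<in> SL2" "b \<in> SL2"
  shows "Ad (a ** b) X = Ad a (Ad b X)"
  by (simp add: Ad_SL2 assms mult_SL2 adjugate2_mult_rev matrix_mul_assoc)

lemma Ad_mat_1: "Ad (mat 1) X = X"
  by (simp add: Ad_SL2 mat_1_SL2 adjugate2_mat_1)

lemma Ad_adjugate2_cancel:
  assumes "a \<in> SL2"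
  shows "Ad (adjugate2 a) (Ad a X) = X"
  using assms by (simp add: Ad_mult[symmetric] adjugate2_SL2 SL2_adjugate2_mult Ad_mat_1)

lemma conj_mult:
  assumes "g \<in> SL2"
  shows "(g ** X ** adjugate2 g) ** (g ** Y ** adjugate2 g) = g ** (X ** Y) ** adjugate2 g"
  by (simp add: matrix_mul_assoc[symmetric] SL2_adjugate2_cancel assms)

lemma trace_conj:
  assumes "g \<in> SL2"
  shows "trace (g ** X ** adjugate2 g) = trace X"
proof -
  have "trace (g ** X ** adjugate2 g) = trace (adjugate2 g ** (g ** X))"
    by (rule trace_mul_sym)
  then show ?thesis by (simp add: SL2_adjugate2_cancel assms)
qed

lemma sp_conj: "g \<in> SL2 \<Longrightarrow> sp (g ** X ** adjugate2 g) (g ** Y ** adjugate2 g) = sp X Y"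
  by (simp add: sp_def conj_mult trace_conj)

lemma conj_eq_0_iff:
  assumes "g \<in> SL2"
  shows "g ** X ** adjugate2 g = 0 \<longleftrightarrow> X = 0"
proof
  assume "g ** X ** adjugate2 g = 0"
  then have "adjugate2 g ** (g ** X ** adjugate2 g) ** g = 0" by (simp add: mat_mult.zero_left mat_mult.zero_right)
  then show "X = 0" by (simp add: matrix_mul_assoc[symmetric] SL2_adjugate2_cancel SL2_adjugate2_mult assms)
qed (simp add: mat_mult.zero_left mat_mult.zero_right)

lemma kk_nth: "kk $ 1 $ 1 = - 1" "kk $ 1 $ 2 = 0" "kk $ 2 $ 1 = 0" "kk $ 2 $ 2 = 1"
  by (simp_all add: kk_def)

lemma linear_expand2:
  assumes "linear (L :: real \<times> real \<Rightarrow> 'b::real_vector)"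
  shows "L v = fst v *\<^sub>R L (1, 0) + snd v *\<^sub>R L (0, 1)"
proof -
  have "L (fst v *\<^sub>R (1, 0) + snd v *\<^sub>R (0, 1)) = fst v *\<^sub>R L (1, 0) + snd v *\<^sub>R L (0, 1)"
    by (simp only: linear_add[OF assms] linear_scale[OF assms])
  then show ?thesis by simp
qed

lemma lie_simps:
  "lie (X + Y) Z = lie X Z + lie Y Z" "lie Z (X + Y) = lie Z X + lie Z Y"
  "lie (c *\<^sub>R X) Z = c *\<^sub>R lie X Z" "lie Z (c *\<^sub>R X) = c *\<^sub>R lie Z X"
  by (simp_all add: lie_def mat_mult.add_left mat_mult.add_right mat_mult.scaleR_left mat_mult.scaleR_right algebra_simps)

lemma bounded_linear_k_part: "bounded_linear k_part"
  unfolding linear_conv_bounded_linear[symmetric]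
  by (rule linearI) (simp_all add: k_part_def vec_eq_iff)

lemma bounded_linear_m_part: "bounded_linear m_part"
  unfolding linear_conv_bounded_linear[symmetric]
  by (rule linearI) (simp_all add: m_part_def vec_eq_iff)

text \<open>A 2-form on the plane is its value on the coordinate frame times a determinant. With
  \<open>wedge_lie_basis\<close> this reduces each admissibility equation to a single pair of
  vectors.\<close>

lemma ext_d_basis:
  assumes S: "open S" "p \<in> S" and lin: "\<And>q. q \<in> S \<Longrightarrow> linear (\<beta> q)"
    and d: "\<And>v. (\<lambda>q. \<beta> q v) differentiable (at p)"
  shows "ext_d \<beta> p X Y = (fst X * snd Y - snd X * fst Y) *\<^sub>R ext_d \<beta> p (1, 0) (0, 1)"
proof -
  define B where "B = (\<lambda>v. frechet_derivative (\<lambda>q. \<beta> q v) (at p))"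
  have B: "((\<lambda>q. \<beta> q v) has_derivative B v) (at p)" for v
    using d by (simp add: B_def frechet_derivative_works[symmetric])
  have "B v w = fst v *\<^sub>R B (1, 0) w + snd v *\<^sub>R B (0, 1) w" for v w
  proof -
    have "((\<lambda>q. fst v *\<^sub>R \<beta> q (1, 0) + snd v *\<^sub>R \<beta> q (0, 1)) has_derivative
        (\<lambda>w. fst v *\<^sub>R B (1, 0) w + snd v *\<^sub>R B (0, 1) w)) (at p)"
      by (intro has_derivative_add has_derivative_scaleR_right B)
    then have "((\<lambda>q. \<beta> q v) has_derivative (\<lambda>w. fst v *\<^sub>R B (1, 0) w + snd v *\<^sub>R B (0, 1) w)) (at p)"
      by (simp only: has_derivative_cong_open[OF S, of "\<lambda>q. \<beta> q v"
            "\<lambda>q. fst v *\<^sub>R \<beta> q (1, 0) + snd v *\<^sub>R \<beta> q (0, 1)", OF linear_expand2[OF lin]])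
    from has_derivative_unique[OF B this] show ?thesis by metis
  qed
  moreover have "B v w = fst w *\<^sub>R B v (1, 0) + snd w *\<^sub>R B v (0, 1)" for v w
    by (rule linear_expand2[OF has_derivative_linear[OF B]])
  ultimately have *: "B v w = fst v *\<^sub>R (fst w *\<^sub>R B (1, 0) (1, 0) + snd w *\<^sub>R B (1, 0) (0, 1)) +
      snd v *\<^sub>R (fst w *\<^sub>R B (0, 1) (1, 0) + snd w *\<^sub>R B (0, 1) (0, 1))" for v w
    by metis
  have e: "ext_d \<beta> p X Y = B Y X - B X Y" for X Y by (simp add: ext_d_def B_def)
  show ?thesis
    unfolding e *[of Y X] *[of X Y] by (simp add: algebra_simps)
qed

lemma wedge_lie_basis:
  assumes "linear (\<alpha> p)" "linear (\<beta> p)"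
  shows "wedge_lie \<alpha> \<beta> p X Y = (fst X * snd Y - snd X * fst Y) *\<^sub>R wedge_lie \<alpha> \<beta> p (1, 0) (0, 1)"
  unfolding wedge_lie_def linear_expand2[OF assms(1), of X] linear_expand2[OF assms(1), of Y]
    linear_expand2[OF assms(2), of X] linear_expand2[OF assms(2), of Y]
  by (simp add: lie_simps algebra_simps)

lemma smooth_on_matrix_mult:
  fixes f g :: "'a::euclidean_space \<Rightarrow> real^2^2"
  shows "open S \<Longrightarrow> smooth_on S f \<Longrightarrow> smooth_on S g \<Longrightarrow> smooth_on S (\<lambda>x. f x ** g x)"
  by (rule smooth_on_bounded_bilinear[OF _ bounded_bilinear_matrix_mult])

lemma smooth_on_adjugate2: "open S \<Longrightarrow> smooth_on S f \<Longrightarrow> smooth_on S (\<lambda>x. adjugate2 (f x))"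
  by (rule smooth_on_bounded_linear[OF _ bounded_linear_adjugate2])

lemma smooth_on_minus: "open S \<Longrightarrow> smooth_on S f \<Longrightarrow> smooth_on S (\<lambda>x. - f x)"
  by (rule smooth_on_bounded_linear[OF _ bounded_linear_minus[OF bounded_linear_ident]])

section \<open>The logarithmic derivative of a map into the group\<close>

locale SL2_map =
  fixes D :: "(real \<times> real) set" and \<Psi> :: "real \<times> real \<Rightarrow> mat2"
  assumes open_D: "open D" and \<Psi>_in: "\<Psi> \<in> D \<rightarrow>\<^sub>E SL2" and smooth_\<Psi>: "smooth_on D \<Psi>"
begin

abbreviation "\<alpha> \<equiv> log_deriv D \<Psi>"

lemma SL2: "p \<in> D \<Longrightarrow> \<Psi> p \<in> SL2"
  using \<Psi>_in by auto

lemma log_deriv_eq: "p \<in> D \<Longrightarrow> \<alpha> p v = adjugate2 (\<Psi> p) ** frechet_derivative \<Psi> (at p) v"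
  by (simp add: log_deriv_def matrix_inv_SL2 SL2)

lemma d_\<Psi>: "p \<in> D \<Longrightarrow> (\<Psi> has_derivative (\<lambda>v. \<Psi> p ** \<alpha> p v)) (at p)"
  using smooth_on_has_derivative[OF smooth_\<Psi>] by (simp add: log_deriv_eq SL2_adjugate2_cancel SL2)

lemma
  assumes p: "p \<in> D"
  shows d_adjugate_\<Psi>: "((\<lambda>q. adjugate2 (\<Psi> q)) has_derivative (\<lambda>v. - (\<alpha> p v ** adjugate2 (\<Psi> p)))) (at p)"
    and trace_log_deriv: "trace (\<alpha> p v) = 0"
proof -
  have d: "((\<lambda>q. adjugate2 (\<Psi> q)) has_derivative (\<lambda>v. adjugate2 (\<Psi> p ** \<alpha> p v))) (at p)"
    by (rule bounded_linear.has_derivative[OF bounded_linear_adjugate2 d_\<Psi>[OF p]])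
  \<comment> \<open>Differentiating the constant product of the adjugate with \<Psi> gives that
    \<open>\<alpha> p v\<close> plus its adjugate is 0, and this sum is the trace times the
    identity.\<close>
  have "((\<lambda>q. adjugate2 (\<Psi> q) ** \<Psi> q) has_derivative (\<lambda>v. 0)) (at p)"
    using has_derivative_cong_open[OF open_D p, of "\<lambda>q. adjugate2 (\<Psi> q) ** \<Psi> q" "\<lambda>q. mat 1" "\<lambda>v. 0"]
    by (simp add: SL2_adjugate2_mult SL2)
  from has_derivative_unique[OF mat_mult.FDERIV[OF d d_\<Psi>[OF p]] this]
  have "adjugate2 (\<Psi> p) ** (\<Psi> p ** \<alpha> p v) + adjugate2 (\<Psi> p ** \<alpha> p v) ** \<Psi> p = 0" for v
    by metis
  then have *: "\<alpha> p v + adjugate2 (\<alpha> p v) = 0" for v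
    by (simp add: SL2_adjugate2_cancel SL2 p adjugate2_mult_rev matrix_mul_assoc[symmetric] SL2_adjugate2_mult)
  show tr: "trace (\<alpha> p v) = 0" for v
    using arg_cong[OF *[of v], of "\<lambda>X. X $ 1 $ 1"] by (simp add: adjugate2_def mat_def)
  then show "((\<lambda>q. adjugate2 (\<Psi> q)) has_derivative (\<lambda>v. - (\<alpha> p v ** adjugate2 (\<Psi> p)))) (at p)"
    using d by (simp add: adjugate2_mult_rev adjugate2_traceless mat_mult.minus_left)
qed

lemma smooth_log_deriv: "smooth_on D (\<lambda>p. \<alpha> p v)"
  using smooth_on_cong[OF open_D, of "\<lambda>p. \<alpha> p v" "\<lambda>p. adjugate2 (\<Psi> p) ** frechet_derivative \<Psi> (at p) v"]
  by (simp add: log_deriv_eq smooth_on_matrix_mult smooth_on_adjugate2 smooth_on_frechet_derivative open_D smooth_\<Psi>)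

lemma linear_log_deriv:
  assumes p: "p \<in> D"
  shows "linear (\<alpha> p)"
proof -
  have "\<alpha> p = (**) (adjugate2 (\<Psi> p)) \<circ> frechet_derivative \<Psi> (at p)"
    using log_deriv_eq[OF p] by (simp add: fun_eq_iff)
  then show ?thesis
    using linear_compose[OF has_derivative_linear[OF smooth_on_has_derivative[OF smooth_\<Psi> p]]
      bounded_linear.linear[OF mat_mult.bounded_linear_right]] by simp
qed

lemma log_deriv_forms1: "\<alpha> \<in> forms1 D"
  unfolding forms1_def sl2_def
  using linear_log_deriv trace_log_deriv smooth_log_deriv by (auto simp: log_deriv_def)

lemma d_log_deriv:
  assumes p: "p \<in> D"
  shows "frechet_derivative (\<lambda>q. \<alpha> q v) (at p) w =
    adjugate2 (\<Psi> p) ** frechet_derivative (\<lambda>q. frechet_derivative \<Psi> (at q) v) (at p) w - \<alpha> p w ** \<alpha> p v"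
proof -
  have "((\<lambda>q. adjugate2 (\<Psi> q) ** frechet_derivative \<Psi> (at q) v) has_derivative
    (\<lambda>w. adjugate2 (\<Psi> p) ** frechet_derivative (\<lambda>q. frechet_derivative \<Psi> (at q) v) (at p) w +
      - (\<alpha> p w ** adjugate2 (\<Psi> p)) ** frechet_derivative \<Psi> (at p) v)) (at p)"
    by (intro mat_mult.FDERIV d_adjugate_\<Psi> p smooth_on_has_derivative[OF smooth_on_frechet_derivative[OF smooth_\<Psi>]])
  then have "((\<lambda>q. \<alpha> q v) has_derivative
    (\<lambda>w. adjugate2 (\<Psi> p) ** frechet_derivative (\<lambda>q. frechet_derivative \<Psi> (at q) v) (at p) w +
      - (\<alpha> p w ** adjugate2 (\<Psi> p)) ** frechet_derivative \<Psi> (at p) v)) (at p)"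
    using has_derivative_cong_open[OF open_D p, of "\<lambda>q. \<alpha> q v"] log_deriv_eq by simp
  from frechet_derivative_at[OF this, symmetric] show ?thesis
    by (simp add: log_deriv_eq[OF p, of v] mat_mult.minus_left matrix_mul_assoc)
qed

text \<open>The second derivatives of \<Psi> cancel by symmetry and leave a commutator. The factor
  1/2 is there because \<open>wedge_lie \<alpha> \<alpha>\<close> contains that commutator
  twice.\<close>

lemma log_deriv_flat:
  assumes p: "p \<in> D"
  shows "ext_d \<alpha> p X Y + (1/2) *\<^sub>R wedge_lie \<alpha> \<alpha> p X Y = 0"
proof -
  have d: "(\<lambda>q. \<alpha> q v) differentiable (at p)" for v
    unfolding differentiable_def by (intro exI, rule smooth_on_has_derivative[OF smooth_log_deriv p])
  have 0: "ext_d \<alpha> p (1, 0) (0, 1) + (1/2) *\<^sub>R wedge_lie \<alpha> \<alpha> p (1, 0) (0, 1) = 0"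
    using smooth_on_mixed_partials_eq[OF open_D p smooth_\<Psi>]
    by (simp add: ext_d_def d_log_deriv[OF p] wedge_lie_def lie_def scaleR_right_diff_distrib scaleR_half_double)
  have e: "ext_d \<alpha> p X Y = (fst X * snd Y - snd X * fst Y) *\<^sub>R ext_d \<alpha> p (1, 0) (0, 1)"
    by (rule ext_d_basis[OF open_D p linear_log_deriv d])
  have w: "wedge_lie \<alpha> \<alpha> p X Y = (fst X * snd Y - snd X * fst Y) *\<^sub>R wedge_lie \<alpha> \<alpha> p (1, 0) (0, 1)"
    by (intro wedge_lie_basis linear_log_deriv p)
  have "ext_d \<alpha> p X Y + (1/2) *\<^sub>R wedge_lie \<alpha> \<alpha> p X Y = (fst X * snd Y - snd X * fst Y) *\<^sub>R
      (ext_d \<alpha> p (1, 0) (0, 1) + (1/2) *\<^sub>R wedge_lie \<alpha> \<alpha> p (1, 0) (0, 1))"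
    unfolding e w by (simp add: scaleR_add_right)
  then show ?thesis by (simp add: 0)
qed

text \<open>In the moving frame \<Psi>, differentiation becomes \<open>X' + lie \<alpha> X\<close>.
  Applied to \<open>kk\<close> and then to \<open>lie \<alpha> kk\<close>, this turns the
  derivatives of \<psi> into algebra of \<alpha>.\<close>

lemma d_conj:
  assumes p: "p \<in> D" and X: "(X has_derivative X') (at p)"
  shows "((\<lambda>q. \<Psi> q ** X q ** adjugate2 (\<Psi> q)) has_derivative
    (\<lambda>w. \<Psi> p ** (lie (\<alpha> p w) (X p) + X' w) ** adjugate2 (\<Psi> p))) (at p)"
  by (rule has_derivative_eq_rhs[OF mat_mult.FDERIV[OF mat_mult.FDERIV[OF d_\<Psi>[OF p] X] d_adjugate_\<Psi>[OF p]]])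
    (auto simp: lie_def mat_mult.minus_left mat_mult.minus_right mat_mult.diff_left mat_mult.diff_right mat_mult.add_left mat_mult.add_right matrix_mul_assoc)

end

text \<open>Subtracting the \<open>kk\<close> component removes the diagonal part, hence the bracket
  of two off-diagonal factors. A diagonal matrix commutes with \<open>kk\<close>, so by the Jacobi
  identity it moves inside the outer bracket with \<open>kk\<close>. In use, \<open>a\<close> and
  \<open>b\<close> are the values of \<alpha> on the coordinate vectors, \<open>c\<close> is the
  x-derivative of the value on \<open>(0, 1)\<close>, and \<open>d\<close> the y-derivative of the
  value on \<open>(1, 0)\<close>.\<close>

lemma tangential_sum_algebra:
  fixes a b c d :: mat2
  assumes "trace a = 0" "trace b = 0"
  defines "Z \<equiv> lie a (lie b kk) + lie c kk" and "W \<equiv> lie b (lie a kk) + lie d kk"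
  shows "(Z - sp Z kk *\<^sub>R kk) + (W - sp W kk *\<^sub>R kk) =
    lie (m_part c + lie (k_part a) (m_part b) + (m_part d + lie (k_part b) (m_part a))) kk"
proof -
  have "a $ 2 $ 2 = - a $ 1 $ 1" "b $ 2 $ 2 = - b $ 1 $ 1"
    using assms(1,2) by (simp_all add: trace_def sum_2)
  then show ?thesis
    unfolding Z_def W_def
    by (simp add: matrix_simps2 lie_def sp_def kk_nth k_part_def m_part_def) (simp add: field_simps)
qed

lemma lie_kk_eq_0_iff:
  assumes "X $ 1 $ 1 = 0" "X $ 2 $ 2 = 0"
  shows "lie X kk = 0 \<longleftrightarrow> X = 0"
  using assms by (auto simp: matrix_simps2 lie_def kk_nth)

text \<open>Bracketing with \<open>kk\<close> reverses causal character on off-diagonal matrices. In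
  the product over both coordinates the sign disappears: the factor is 16, so the sign classes on
  the two sides agree.\<close>

lemma sp_lie_kk: "sp (lie X kk) (lie X kk) = - 4 * sp (m_part X) (m_part X)"
  by (simp add: matrix_simps2 lie_def sp_def kk_nth m_part_def)

lemma frechet_derivative_bounded_linear:
  assumes "bounded_linear L" "(f has_derivative f') (at p)"
  shows "frechet_derivative (\<lambda>q. L (f q)) (at p) w = L (f' w)"
  using frechet_derivative_at[OF bounded_linear.has_derivative[OF assms]] by metis

section \<open>Harmonicity and admissibility in a moving frame\<close>

context SL2_map
begin

text \<open>The quantity shared by both sides: the second admissibility form on the pair
  \<open>(0, 1)\<close>, \<open>(1, 0)\<close>, and, up to conjugation, a factor 2 and the bracket
  with \<open>kk\<close>, the tension field.\<close>

definition harmonic_defect :: "real \<times> real \<Rightarrow> mat2" where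
  "harmonic_defect p =
     m_part (frechet_derivative (\<lambda>q. \<alpha> q (0, 1)) (at p) (1, 0)) +
       lie (k_part (\<alpha> p (1, 0))) (m_part (\<alpha> p (0, 1))) +
     (m_part (frechet_derivative (\<lambda>q. \<alpha> q (1, 0)) (at p) (0, 1)) +
       lie (k_part (\<alpha> p (0, 1))) (m_part (\<alpha> p (1, 0))))"

lemma d_log_deriv_has: "p \<in> D \<Longrightarrow>
    ((\<lambda>q. \<alpha> q v) has_derivative frechet_derivative (\<lambda>q. \<alpha> q v) (at p)) (at p)"
  by (rule smooth_on_has_derivative[OF smooth_log_deriv])

text \<open>\<open>star\<close> changes the sign of the \<open>dy\<close> coefficient, which makes
  the antisymmetric exterior derivative the negative of the symmetric sum in
  \<open>harmonic_defect\<close>. The first admissibility equation is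
  \<open>log_deriv_flat\<close>.\<close>

lemma admissible_iff: "\<alpha> \<in> admissible_forms D \<longleftrightarrow> (\<forall>p\<in>D. harmonic_defect p = 0)"
proof -
  have eq: "ext_d (star (form_m \<alpha>)) p X Y + wedge_lie (form_k \<alpha>) (star (form_m \<alpha>)) p X Y =
      (snd X * fst Y - fst X * snd Y) *\<^sub>R harmonic_defect p" if p: "p \<in> D" for p X Y
  proof -
    have lin: "linear (star (form_m \<alpha>) q)" if q: "q \<in> D" for q
    proof -
      have "linear (\<lambda>v :: real \<times> real. (fst v, - snd v))" by (rule linearI) simp_all
      from linear_compose[OF linear_compose[OF this linear_log_deriv[OF q]] bounded_linear.linear[OF bounded_linear_m_part]]
      show ?thesis by (simp add: comp_def star_def[abs_def] form_m_def)
    qed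
    have link: "linear (form_k \<alpha> p)"
      using linear_compose[OF linear_log_deriv[OF p] bounded_linear.linear[OF bounded_linear_k_part]]
      by (simp add: comp_def form_k_def[abs_def])
    have d: "(\<lambda>q. star (form_m \<alpha>) q v) differentiable (at p)" for v
      unfolding star_def form_m_def differentiable_def
      by (intro exI, rule bounded_linear.has_derivative[OF bounded_linear_m_part d_log_deriv_has[OF p]])
    have neg: "star (form_m \<alpha>) q (0, 1) = - m_part (\<alpha> q (0, 1))" if "q \<in> D" for q
      using linear_scale[OF linear_log_deriv[OF that], of "-1" "(0, 1)"]
        linear_scale[OF bounded_linear.linear[OF bounded_linear_m_part], of "-1" "\<alpha> q (0, 1)"]
      by (simp add: star_def form_m_def)
    have "frechet_derivative (\<lambda>q. star (form_m \<alpha>) q (0, 1)) (at p) =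
        frechet_derivative (\<lambda>q. - m_part (\<alpha> q (0, 1))) (at p)"
      by (rule frechet_derivative_cong_open[OF open_D p neg])
    then have 1: "frechet_derivative (\<lambda>q. star (form_m \<alpha>) q (0, 1)) (at p) (1, 0) =
        - m_part (frechet_derivative (\<lambda>q. \<alpha> q (0, 1)) (at p) (1, 0))"
      using frechet_derivative_bounded_linear[OF bounded_linear_minus[OF bounded_linear_m_part]
          d_log_deriv_has[OF p, of "(0, 1)"]] by simp
    have 2: "frechet_derivative (\<lambda>q. star (form_m \<alpha>) q (1, 0)) (at p) (0, 1) =
        m_part (frechet_derivative (\<lambda>q. \<alpha> q (1, 0)) (at p) (0, 1))"
      using frechet_derivative_bounded_linear[OF bounded_linear_m_part d_log_deriv_has[OF p, of "(1, 0)"]]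
      by (simp add: star_def form_m_def)
    have 0: "ext_d (star (form_m \<alpha>)) p (1, 0) (0, 1) + wedge_lie (form_k \<alpha>) (star (form_m \<alpha>)) p (1, 0) (0, 1) =
      - harmonic_defect p"
      unfolding ext_d_def 1 2 wedge_lie_def neg[OF p] harmonic_defect_def
      by (simp add: star_def form_m_def form_k_def lie_def mat_mult.minus_left mat_mult.minus_right)
    have e: "ext_d (star (form_m \<alpha>)) p X Y =
        (fst X * snd Y - snd X * fst Y) *\<^sub>R ext_d (star (form_m \<alpha>)) p (1, 0) (0, 1)"
      by (rule ext_d_basis[OF open_D p lin d])
    have w: "wedge_lie (form_k \<alpha>) (star (form_m \<alpha>)) p X Y =
        (fst X * snd Y - snd X * fst Y) *\<^sub>R wedge_lie (form_k \<alpha>) (star (form_m \<alpha>)) p (1, 0) (0, 1)"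
      by (intro wedge_lie_basis link lin p)
    have "ext_d (star (form_m \<alpha>)) p X Y + wedge_lie (form_k \<alpha>) (star (form_m \<alpha>)) p X Y =
      (fst X * snd Y - snd X * fst Y) *\<^sub>R (- harmonic_defect p)"
      unfolding e w 0[symmetric] by (simp only: scaleR_add_right)
    then show ?thesis by (simp add: algebra_simps)
  qed
  have "(\<forall>X Y. ext_d (star (form_m \<alpha>)) p X Y + wedge_lie (form_k \<alpha>) (star (form_m \<alpha>)) p X Y = 0)
      \<longleftrightarrow> harmonic_defect p = 0" (is "(\<forall>X Y. ?l X Y = 0) \<longleftrightarrow> _") if p: "p \<in> D" for p
  proof
    assume "\<forall>X Y. ?l X Y = 0"
    then have "?l (0, 1) (1, 0) = 0" by blast
    then show "harmonic_defect p = 0" by (simp add: eq[OF p])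
  qed (simp add: eq[OF p])
  then show ?thesis
    using log_deriv_forms1 log_deriv_flat by (simp add: admissible_forms_def)
qed

context
  fixes \<psi> :: "real \<times> real \<Rightarrow> mat2"
  assumes \<psi>: "\<And>p. p \<in> D \<Longrightarrow> \<psi> p = Ad (\<Psi> p) kk"
begin

lemma frame_eq: "p \<in> D \<Longrightarrow> \<psi> p = \<Psi> p ** kk ** adjugate2 (\<Psi> p)"
  by (simp add: \<psi> Ad_SL2 SL2)

lemma d_frame:
  assumes p: "p \<in> D"
  shows "frechet_derivative \<psi> (at p) v = \<Psi> p ** lie (\<alpha> p v) kk ** adjugate2 (\<Psi> p)"
proof -
  have "(\<psi> has_derivative (\<lambda>w. \<Psi> p ** (lie (\<alpha> p w) kk + 0) ** adjugate2 (\<Psi> p))) (at p)"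
    by (rule has_derivative_cong_open[OF open_D p frame_eq, THEN iffD2], assumption)
      (rule d_conj[OF p has_derivative_const])
  from frechet_derivative_at[OF this, symmetric] show ?thesis by simp
qed

lemma d2_frame:
  assumes p: "p \<in> D"
  shows "frechet_derivative (\<lambda>q. frechet_derivative \<psi> (at q) v) (at p) w = \<Psi> p **
    (lie (\<alpha> p w) (lie (\<alpha> p v) kk) + lie (frechet_derivative (\<lambda>q. \<alpha> q v) (at p) w) kk) ** adjugate2 (\<Psi> p)"
proof -
  have "bounded_linear (\<lambda>X. lie X kk)"
    unfolding linear_conv_bounded_linear[symmetric] by (rule linearI) (simp_all add: lie_simps)
  note X = bounded_linear.has_derivative[OF this d_log_deriv_has[OF p, of v]]
  have "((\<lambda>q. frechet_derivative \<psi> (at q) v) has_derivative (\<lambda>w. \<Psi> p **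
    (lie (\<alpha> p w) (lie (\<alpha> p v) kk) + lie (frechet_derivative (\<lambda>q. \<alpha> q v) (at p) w) kk) **
      adjugate2 (\<Psi> p))) (at p)"
    by (rule has_derivative_cong_open[OF open_D p d_frame, THEN iffD2], assumption) (rule d_conj[OF p X])
  from frechet_derivative_at[OF this, symmetric] show ?thesis by simp
qed

lemma tension_frame:
  assumes p: "p \<in> D"
  shows "tension_field \<psi> p = \<Psi> p ** (2 *\<^sub>R lie (harmonic_defect p) kk) ** adjugate2 (\<Psi> p)"
proof -
  have t: "tangential (\<psi> p) (\<Psi> p ** Z ** adjugate2 (\<Psi> p)) =
      \<Psi> p ** (Z - sp Z kk *\<^sub>R kk) ** adjugate2 (\<Psi> p)" for Z
    by (simp add: tangential_def frame_eq[OF p] sp_conj SL2[OF p] mat_mult.diff_left mat_mult.diff_right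
        mat_mult.scaleR_left mat_mult.scaleR_right)
  show ?thesis
    unfolding tension_field_def second_ff_def d2_frame[OF p] t harmonic_defect_def
      tangential_sum_algebra[OF trace_log_deriv[OF p] trace_log_deriv[OF p], symmetric]
    by (simp add: mat_mult.add_left mat_mult.add_right mat_mult.scaleR_left mat_mult.scaleR_right scaleR_add_right)
qed

lemma smooth_frame: "smooth_on D \<psi>"
  using smooth_on_cong[OF open_D frame_eq]
  by (simp add: smooth_on_matrix_mult smooth_on_adjugate2 smooth_on_const open_D smooth_\<Psi>)

lemma frame_in_S21:
  assumes p: "p \<in> D"
  shows "\<psi> p \<in> S21"
proof -
  have "trace kk = 0" "sp kk kk = 1" by (simp_all add: sp_def matrix_simps2 kk_nth)
  then show ?thesis
    by (simp add: S21_def sl2_def frame_eq[OF p] sp_conj[OF SL2[OF p]] trace_conj[OF SL2[OF p]])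
qed

text \<open>The tension field arises from the defect by injective linear maps: the defect is
  off-diagonal, where bracketing with \<open>kk\<close> is injective, and conjugation by
  \<open>\<Psi> p\<close> is injective everywhere.\<close>

lemma harmonic_iff_admissible:
  assumes "\<psi> \<in> extensional D"
  shows "\<psi> \<in> harmonic_maps D \<longleftrightarrow> \<alpha> \<in> admissible_forms D"
proof -
  have "tension_field \<psi> p = 0 \<longleftrightarrow> harmonic_defect p = 0" if p: "p \<in> D" for p
  proof -
    have "harmonic_defect p $ 1 $ 1 = 0" "harmonic_defect p $ 2 $ 2 = 0"
      by (simp_all add: harmonic_defect_def lie_def k_part_def m_part_def matrix_matrix_mult_def sum_2)
    from lie_kk_eq_0_iff[OF this] show ?thesis
      by (simp add: tension_frame[OF p] conj_eq_0_iff SL2[OF p])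
  qed
  then show ?thesis
    unfolding admissible_iff harmonic_maps_def using assms smooth_frame frame_in_S21
    by (auto simp: PiE_def)
qed

lemma H_prod_frame: "p \<in> D \<Longrightarrow> H_prod \<psi> p = 16 * A_prod \<alpha> p"
  by (simp add: H_prod_def A_prod_def dx_of_def dy_of_def d_frame sp_conj SL2 sp_lie_kk form_m_def)

end

end

section \<open>Existence of framings\<close>

text \<open>Because \<open>k\<close> vanishes at \<open>p\<close>, the remainder splits into the
  remainder of \<open>k\<close> times \<open>m q\<close>, and \<open>k' (q - p)\<close> times
  \<open>m q - m p\<close>. Both are small compared with \<open>q - p\<close> as soon as
  \<open>m\<close> is continuous.\<close>

lemma has_derivative_times_continuous:
  fixes k m :: "'a::real_normed_vector \<Rightarrow> 'b::real_normed_field"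
  assumes k: "(k has_derivative k') (at p)" and k0: "k p = 0" and m: "isCont m p"
  shows "((\<lambda>q. k q * m q) has_derivative (\<lambda>v. k' v * m p)) (at p)"
  unfolding has_derivative_iff_norm
proof
  have bl: "bounded_linear k'" using k by (rule has_derivative_bounded_linear)
  then show "bounded_linear (\<lambda>v. k' v * m p)" by (rule bounded_linear_mult_const)
  obtain K where K: "\<And>x. norm (k' x) \<le> norm x * K" using bounded_linear.bounded[OF bl] by blast
  have m': "(m \<longlongrightarrow> m p) (at p)" using m by (simp add: isCont_def)
  have "((\<lambda>q. norm (k q - k p - k' (q - p)) / norm (q - p) * norm (m q) + K * norm (m q - m p))
      \<longlongrightarrow> 0 * norm (m p) + K * norm (m p - m p)) (at p)"
    using k unfolding has_derivative_iff_norm by (intro tendsto_intros m') auto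
  then have lim: "((\<lambda>q. norm (k q - k p - k' (q - p)) / norm (q - p) * norm (m q) + K * norm (m q - m p))
      \<longlongrightarrow> 0) (at p)" by simp
  show "((\<lambda>q. norm (k q * m q - k p * m p - k' (q - p) * m p) / norm (q - p)) \<longlongrightarrow> 0) (at p)"
  proof (rule Lim_null_comparison[OF _ lim], intro always_eventually allI)
    fix q
    have "norm (k q * m q - k p * m p - k' (q - p) * m p) =
        norm ((k q - k p - k' (q - p)) * m q + k' (q - p) * (m q - m p))"
      by (simp add: k0 algebra_simps)
    also have "\<dots> \<le> norm (k q - k p - k' (q - p)) * norm (m q) + norm (k' (q - p)) * norm (m q - m p)"
      by (intro norm_triangle_le) (simp add: norm_mult)
    also have "\<dots> \<le> norm (k q - k p - k' (q - p)) * norm (m q) + norm (q - p) * K * norm (m q - m p)"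
      by (intro add_left_mono mult_right_mono K) auto
    finally show "norm (norm (k q * m q - k p * m p - k' (q - p) * m p) / norm (q - p)) \<le>
        norm (k q - k p - k' (q - p)) / norm (q - p) * norm (m q) + K * norm (m q - m p)"
      by (cases "q = p") (auto simp: field_simps)
  qed
qed

text \<open>Factoring the difference of squares gives
  \<open>h q - h p = (w q - w p) / (h q + h p)\<close>, whose denominator is continuous and nonzero
  near \<open>p\<close>. So \<open>h\<close> is differentiable with derivative
  \<open>dw / (2 h)\<close>, and bootstrapping does the rest.\<close>

lemma smooth_on_continuous_sqrt:
  fixes h w :: "'a::euclidean_space \<Rightarrow> complex"
  assumes S: "open S" and w: "smooth_on S w" and h: "continuous_on S h"
    and hw: "\<And>p. p \<in> S \<Longrightarrow> w p = (h p)\<^sup>2" and w0: "\<And>p. p \<in> S \<Longrightarrow> w p \<noteq> 0"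
  shows "smooth_on S h"
proof (rule smooth_on_SucI[OF S])
  have h0: "h p \<noteq> 0" if "p \<in> S" for p using hw[OF that] w0[OF that] by auto
  show "(h has_derivative (\<lambda>v. frechet_derivative w (at p) v * inverse (2 * h p))) (at p)" if p: "p \<in> S" for p
  proof -
    have ch: "isCont h p" using h p S by (simp add: continuous_on_eq_continuous_at)
    have "isCont (\<lambda>q. inverse (h q + h p)) p"
      by (rule continuous_at_within_inverse[OF continuous_add[OF ch continuous_const]])
        (simp add: h0[OF p])
    moreover have "((\<lambda>q. w q - w p) has_derivative frechet_derivative w (at p)) (at p)"
      using has_derivative_diff[OF smooth_on_has_derivative[OF w p] has_derivative_const[of "w p"]] by simp
    ultimately have "((\<lambda>q. (w q - w p) * inverse (h q + h p)) has_derivative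
        (\<lambda>v. frechet_derivative w (at p) v * inverse (h p + h p))) (at p)"
      by (intro has_derivative_times_continuous) simp_all
    from has_derivative_add[OF has_derivative_const[of "h p"] this]
    have d: "((\<lambda>q. h p + (w q - w p) * inverse (h q + h p)) has_derivative
        (\<lambda>v. frechet_derivative w (at p) v * inverse (2 * h p))) (at p)"
      by (simp only: mult_2 add_0_left)
    have "((\<lambda>q. h q + h p) \<longlongrightarrow> h p + h p) (at p)"
      using ch by (intro tendsto_intros) (simp add: isCont_def)
    then have "\<forall>\<^sub>F q in at p. h q + h p \<noteq> 0"
      by (rule tendsto_imp_eventually_ne) (use h0[OF p] in simp)
    moreover have "\<forall>\<^sub>F q in at p. q \<in> S"
      using S p by (simp add: eventually_at_in_open')
    ultimately have "\<forall>\<^sub>F q in at p. h p + (w q - w p) * inverse (h q + h p) = h q"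
    proof eventually_elim
      case (elim q)
      then have "(w q - w p) = (h q - h p) * (h q + h p)"
        by (simp add: hw p power2_eq_square algebra_simps)
      then show ?case using elim(1) by (simp add: mult.assoc)
    qed
    from has_derivative_transform_eventually[OF d this] show ?thesis by simp
  qed
  show "Ck_on k S (\<lambda>p. frechet_derivative w (at p) v * inverse (2 * h p))" if "Ck_on k S h" for k v
    using smooth_on_frechet_derivative[OF w, of v] h0
    by (intro Ck_on_bounded_bilinear[OF S bounded_bilinear_mult] Ck_on_inverse[OF S]
        Ck_on_const that) (auto simp: smooth_on_def)
qed

lemma smooth_on_matrixI:
  fixes f :: "'a::euclidean_space \<Rightarrow> real^2^2"
  assumes S: "open S" and f: "\<And>i j. smooth_on S (\<lambda>p. f p $ i $ j)"
  shows "smooth_on S f"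
proof -
  define E where "E = (\<lambda>i j :: 2. axis i (axis j 1) :: real^2^2)"
  have "f = (\<lambda>p. f p $ 1 $ 1 *\<^sub>R E 1 1 + f p $ 1 $ 2 *\<^sub>R E 1 2 + f p $ 2 $ 1 *\<^sub>R E 2 1 + f p $ 2 $ 2 *\<^sub>R E 2 2)"
    by (simp add: fun_eq_iff vec_eq_iff forall_2 E_def axis_def)
  moreover have "smooth_on S \<dots>"
    by (intro smooth_on_add S smooth_on_bounded_linear[OF S bounded_linear_scaleR_left] f)
  ultimately show ?thesis by simp
qed

text \<open>
  For \<open>\<psi>\<close> with rows \<open>(x, y)\<close> and \<open>(z, -x)\<close>, the columns of \<open>1 - \<psi>\<close>, read as complex numbers, are real
  multiples of one eigenvector for \<open>-1\<close>.  The sum of their squares is the right-hand side of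
  \<open>(a + b \<i>)\<^sup>2\<close> below.
\<close>
lemma negative_eigenvector:
  fixes x y z a b :: real
  assumes S: "x\<^sup>2 + y * z = 1" and re: "a\<^sup>2 - b\<^sup>2 = y\<^sup>2 - z\<^sup>2 - 4 * x"
    and im: "a * b = - z * (1 - x) - y * (1 + x)"
  shows "a\<^sup>2 + b\<^sup>2 = 2 + 2 * x\<^sup>2 + y\<^sup>2 + z\<^sup>2" "(1 + x) * a + y * b = 0" "z * a + (1 - x) * b = 0"
proof -
  have "(a\<^sup>2 + b\<^sup>2)\<^sup>2 = (a\<^sup>2 - b\<^sup>2)\<^sup>2 + 4 * (a * b)\<^sup>2"
    by (simp add: power2_eq_square algebra_simps)
  also have "\<dots> = (2 + 2 * x\<^sup>2 + y\<^sup>2 + z\<^sup>2)\<^sup>2 - 4 * (1 - (x\<^sup>2 + y * z))\<^sup>2"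
    unfolding re im by (simp add: power2_eq_square algebra_simps)
  finally have "(a\<^sup>2 + b\<^sup>2)\<^sup>2 = (2 + 2 * x\<^sup>2 + y\<^sup>2 + z\<^sup>2)\<^sup>2" by (simp add: S)
  then show N: "a\<^sup>2 + b\<^sup>2 = 2 + 2 * x\<^sup>2 + y\<^sup>2 + z\<^sup>2"
    by (rule power2_eq_imp_eq) simp_all
  have a2: "a\<^sup>2 = (1 - x)\<^sup>2 + y\<^sup>2" and b2: "b\<^sup>2 = (1 + x)\<^sup>2 + z\<^sup>2"
    using N re by (simp_all add: power2_eq_square algebra_simps)
  \<comment> \<open>The data determine \<open>a\<close> and \<open>b\<close> only up to a common
    sign, so each linear relation is proved through its square, which depends on
    \<open>a\<^sup>2\<close>, \<open>b\<^sup>2\<close> and \<open>a * b\<close> alone.\<close>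
  have "((1 + x) * a + y * b)\<^sup>2 = (1 + x)\<^sup>2 * a\<^sup>2 + 2 * (1 + x) * y * (a * b) + y\<^sup>2 * b\<^sup>2"
    by (simp add: power2_eq_square algebra_simps)
  also have "\<dots> = (1 - (x\<^sup>2 + y * z))\<^sup>2"
    unfolding a2 b2 im by (simp add: power2_eq_square algebra_simps)
  finally show "(1 + x) * a + y * b = 0" by (simp add: S)
  have "(z * a + (1 - x) * b)\<^sup>2 = z\<^sup>2 * a\<^sup>2 + 2 * z * (1 - x) * (a * b) + (1 - x)\<^sup>2 * b\<^sup>2"
    by (simp add: power2_eq_square algebra_simps)
  also have "\<dots> = (1 - (x\<^sup>2 + y * z))\<^sup>2"
    unfolding a2 b2 im by (simp add: power2_eq_square algebra_simps)
  finally show "z * a + (1 - x) * b = 0" by (simp add: S)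
qed

text \<open>If the columns of \<open>1 - \<psi>\<close> are \<open>r v\<close> and
  \<open>s v\<close>, their complex squares add up to
  \<open>(r\<^sup>2 + s\<^sup>2) v\<^sup>2\<close>. Squaring removes the ambiguous sign of
  \<open>v\<close>, and \<open>r\<close>, \<open>s\<close> do not both vanish because
  \<open>1 - \<psi>\<close> has trace 2. So a continuous square root of this sum is a nonvanishing
  global eigenvector.\<close>

lemma framings_nonempty:
  assumes D: "open D" "simply_connected D" and \<psi>: "\<psi> \<in> D \<rightarrow>\<^sub>E S21" "smooth_on D \<psi>"
  shows "framings D \<psi> \<noteq> {}"
proof -
  define x y z where "x = (\<lambda>p. \<psi> p $ 1 $ 1)" and "y = (\<lambda>p. \<psi> p $ 1 $ 2)" and "z = (\<lambda>p. \<psi> p $ 2 $ 1)"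
  have x': "\<psi> p $ 2 $ 2 = - x p" and xyz: "(x p)\<^sup>2 + y p * z p = 1" if "p \<in> D" for p
  proof -
    have "\<psi> p \<in> S21" using that \<psi> by auto
    then have tr: "trace (\<psi> p) = 0" and sp: "sp (\<psi> p) (\<psi> p) = 1" by (simp_all add: S21_def sl2_def)
    show t: "\<psi> p $ 2 $ 2 = - x p" using tr by (simp add: trace_def sum_2 x_def)
    show "(x p)\<^sup>2 + y p * z p = 1"
      using sp t[unfolded x_def] by (simp add: sp_def matrix_simps2 x_def y_def z_def power2_eq_square)
  qed
  have nth: "smooth_on D (\<lambda>p. \<psi> p $ i $ j)" for i j
    by (rule smooth_on_bounded_linear[OF D(1) bounded_linear_compose[OF bounded_linear_vec_nth bounded_linear_vec_nth] \<psi>(2)])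
  have s: "smooth_on D x" "smooth_on D y" "smooth_on D z"
    unfolding x_def y_def z_def by (rule nth)+
  note mult = smooth_on_bounded_bilinear[OF D(1) bounded_bilinear_mult]
    and add = smooth_on_add[OF D(1)] and minus = smooth_on_minus[OF D(1)]
  define re im where "re = (\<lambda>p. (y p * y p + - (z p * z p)) + - (4 * x p))"
    and "im = (\<lambda>p. 2 * (- (z p * (1 + - x p)) + - (y p * (1 + x p))))"
  define w where "w = (\<lambda>p. re p *\<^sub>R 1 + im p *\<^sub>R \<i>)"
  have "smooth_on D re" "smooth_on D im"
    unfolding re_def im_def by (intro add minus mult s smooth_on_const)+
  then have sw: "smooth_on D w"
    unfolding w_def by (intro add smooth_on_bounded_linear[OF D(1) bounded_linear_scaleR_left])
  have w0: "w p \<noteq> 0" if "p \<in> D" for p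
  proof
    assume "w p = 0"
    then have "re p = 0" "im p = 0" by (auto simp: w_def complex_eq_iff)
    \<comment> \<open>The case \<open>a = b = 0\<close> of the norm identity, whose right-hand side
      is at least 2.\<close>
    then have "0\<^sup>2 + 0\<^sup>2 = 2 + 2 * (x p)\<^sup>2 + (y p)\<^sup>2 + (z p)\<^sup>2"
      by (intro negative_eigenvector(1) xyz that) (simp_all add: re_def im_def power2_eq_square)
    moreover have "(x p)\<^sup>2 \<ge> 0" "(y p)\<^sup>2 \<ge> 0" "(z p)\<^sup>2 \<ge> 0" by simp_all
    ultimately show False by simp
  qed
  obtain h where h: "continuous_on D h" "\<And>p. p \<in> D \<Longrightarrow> w p = (h p)\<^sup>2"
    using continuous_sqrt_on_simply_connected[OF smooth_on_imp_continuous_on[OF sw] D(2)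
        open_imp_locally_path_connected[OF D(1)] w0] by blast
  have sh: "smooth_on D h" by (rule smooth_on_continuous_sqrt[OF D(1) sw h w0])
  define a b where "a = (\<lambda>p. Re (h p))" and "b = (\<lambda>p. Im (h p))"
  have sab: "smooth_on D a" "smooth_on D b"
    unfolding a_def b_def
    by (rule smooth_on_bounded_linear[OF D(1) bounded_linear_Re sh]
        smooth_on_bounded_linear[OF D(1) bounded_linear_Im sh])+
  define N where "N = (\<lambda>p. a p * a p + b p * b p)"
  have ab: "a p * a p + b p * b p > 0" "(1 + x p) * a p + y p * b p = 0" "z p * a p + (1 - x p) * b p = 0"
    if p: "p \<in> D" for p
  proof -
    have "re p = Re ((h p)\<^sup>2)" "im p = Im ((h p)\<^sup>2)" 
      using arg_cong[OF h(2)[OF p], of Re] arg_cong[OF h(2)[OF p], of Im] by (simp_all add: w_def)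
    then have 1: "(a p)\<^sup>2 - (b p)\<^sup>2 = (y p)\<^sup>2 - (z p)\<^sup>2 - 4 * x p"
      "a p * b p = - z p * (1 - x p) - y p * (1 + x p)"
      by (simp_all add: re_def im_def a_def b_def power2_eq_square algebra_simps)
    note e = negative_eigenvector[OF xyz[OF p] 1]
    show "(1 + x p) * a p + y p * b p = 0" "z p * a p + (1 - x p) * b p = 0" by (fact e)+
    have "2 * (x p)\<^sup>2 + (y p)\<^sup>2 + (z p)\<^sup>2 \<ge> 0" by simp
    with e(1) show "a p * a p + b p * b p > 0" unfolding power2_eq_square by linarith
  qed
  \<comment> \<open>The vector \<open>(c, d)\<close> is \<open>1 + \<psi>\<close> applied to the
    rotated vector \<open>(-b, a)\<close>, hence lies in the eigenspace for 1. Before the division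
    its determinant with \<open>(a, b)\<close> is \<open>2 * N\<close>.\<close>
  define c where "c = (\<lambda>p. (y p * a p + - ((1 + x p) * b p)) * inverse (2 * N p))"
  define d where "d = (\<lambda>p. ((1 + - x p) * a p + - (z p * b p)) * inverse (2 * N p))"
  have inv: "smooth_on D (\<lambda>p. inverse (2 * N p))"
    unfolding N_def
    by (intro smooth_on_inverse[OF D(1)] add mult sab smooth_on_const) (use ab(1) in force)
  have scd: "smooth_on D c" "smooth_on D d"
    unfolding c_def d_def by (intro add minus mult s sab inv smooth_on_const)+
  define \<Psi> where "\<Psi> = (\<lambda>p\<in>D. vector [vector [a p, c p], vector [b p, d p]] :: mat2)"
  have \<Psi>_nth: "\<Psi> p $ 1 $ 1 = a p" "\<Psi> p $ 1 $ 2 = c p" "\<Psi> p $ 2 $ 1 = b p" "\<Psi> p $ 2 $ 2 = d p" if "p \<in> D" for p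
    using that by (simp_all add: \<Psi>_def)
  have "smooth_on D (\<lambda>p. \<Psi> p $ i $ j)" for i j
    using smooth_on_cong[OF D(1) \<Psi>_nth(1)] smooth_on_cong[OF D(1) \<Psi>_nth(2)]
      smooth_on_cong[OF D(1) \<Psi>_nth(3)] smooth_on_cong[OF D(1) \<Psi>_nth(4)] scd sab
      exhaust_2[of i] exhaust_2[of j] by auto
  then have s\<Psi>: "smooth_on D \<Psi>" by (rule smooth_on_matrixI[OF D(1)])
  have \<Psi>: "\<Psi> p \<in> SL2" "\<psi> p = Ad (\<Psi> p) kk" if p: "p \<in> D" for p
  proof -
    note E = ab[OF p]
    have N: "N p > 0" using E(1) by (simp add: N_def)
    have c: "2 * N p * c p = y p * a p - (1 + x p) * b p" and d: "2 * N p * d p = (1 - x p) * a p - z p * b p"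
      using N by (simp_all add: c_def d_def)
    have "2 * N p * (a p * d p - b p * c p) = a p * (2 * N p * d p) - b p * (2 * N p * c p)"
      by (simp add: algebra_simps)
    also have "\<dots> = 2 * N p - a p * ((1 + x p) * a p + y p * b p) - b p * (z p * a p + (1 - x p) * b p)"
      unfolding c d by (simp add: N_def algebra_simps)
    also have "\<dots> = 2 * N p" using E by simp
    finally have det: "a p * d p - b p * c p = 1" using N by simp
    then show SL: "\<Psi> p \<in> SL2" by (simp add: SL2_def det_2 \<Psi>_nth p mult.commute)
    have "2 * N p * (x p * c p + y p * d p) = x p * (2 * N p * c p) + y p * (2 * N p * d p)"
      by (simp add: algebra_simps)
    also have "\<dots> = 2 * N p * c p + (1 - ((x p)\<^sup>2 + y p * z p)) * b p"
      unfolding c d by (simp add: algebra_simps power2_eq_square)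
    finally have c': "x p * c p + y p * d p = c p" using N by (simp add: xyz[OF p])
    have "2 * N p * (z p * c p - x p * d p) = z p * (2 * N p * c p) - x p * (2 * N p * d p)"
      by (simp add: algebra_simps)
    also have "\<dots> = 2 * N p * d p + ((x p)\<^sup>2 + y p * z p - 1) * a p"
      unfolding c d by (simp add: algebra_simps power2_eq_square)
    finally have d': "z p * c p - x p * d p = d p" using N by (simp add: xyz[OF p])
    have "\<psi> p ** \<Psi> p = \<Psi> p ** kk"
      using E(2,3) c' d'
      by (simp add: matrix_simps2 \<Psi>_nth p kk_nth x' x_def[symmetric] y_def[symmetric] z_def[symmetric] algebra_simps)
        (simp add: x_def y_def z_def algebra_simps eq_neg_iff_add_eq_0)
    then have "\<psi> p ** \<Psi> p ** adjugate2 (\<Psi> p) = \<Psi> p ** kk ** adjugate2 (\<Psi> p)" by simp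
    then show "\<psi> p = Ad (\<Psi> p) kk"
      by (simp add: Ad_SL2 SL matrix_mul_assoc[symmetric] SL2_mult_adjugate2)
  qed
  have "\<Psi> \<in> framings D \<psi>"
    unfolding framings_def using \<Psi> s\<Psi> by (auto simp: \<Psi>_def)
  then show ?thesis by blast
qed

section \<open>The correspondence\<close>

lemma framings_iff: "open D \<Longrightarrow> \<Psi> \<in> framings D \<psi> \<longleftrightarrow> SL2_map D \<Psi> \<and> (\<forall>p\<in>D. \<psi> p = Ad (\<Psi> p) kk)"
  by (auto simp: framings_def SL2_map_def)

lemma SL2_map_mult:
  assumes "SL2_map D \<Phi>" "SL2_map D \<Psi>"
  shows "SL2_map D (\<lambda>p\<in>D. \<Phi> p ** \<Psi> p)"
proof -
  interpret \<Phi>: SL2_map D \<Phi> by (rule assms)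
  interpret \<Psi>: SL2_map D \<Psi> by (rule assms)
  show ?thesis
  proof
    show "open D" by (rule \<Phi>.open_D)
    show "(\<lambda>p\<in>D. \<Phi> p ** \<Psi> p) \<in> D \<rightarrow>\<^sub>E SL2"
      by (auto intro: mult_SL2 \<Phi>.SL2 \<Psi>.SL2)
    show "smooth_on D (\<lambda>p\<in>D. \<Phi> p ** \<Psi> p)"
      using smooth_on_cong[OF \<Phi>.open_D, of "\<lambda>p\<in>D. \<Phi> p ** \<Psi> p" "\<lambda>p. \<Phi> p ** \<Psi> p"]
      by (simp add: smooth_on_matrix_mult \<Phi>.open_D \<Phi>.smooth_\<Psi> \<Psi>.smooth_\<Psi>)
  qed
qed

lemma SL2_map_adjugate2:
  assumes "SL2_map D \<Phi>"
  shows "SL2_map D (\<lambda>p\<in>D. adjugate2 (\<Phi> p))"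
proof -
  interpret \<Phi>: SL2_map D \<Phi> by (rule assms)
  show ?thesis
  proof
    show "open D" by (rule \<Phi>.open_D)
    show "(\<lambda>p\<in>D. adjugate2 (\<Phi> p)) \<in> D \<rightarrow>\<^sub>E SL2"
      by (auto intro: adjugate2_SL2 \<Phi>.SL2)
    show "smooth_on D (\<lambda>p\<in>D. adjugate2 (\<Phi> p))"
      using smooth_on_cong[OF \<Phi>.open_D, of "\<lambda>p\<in>D. adjugate2 (\<Phi> p)" "\<lambda>p. adjugate2 (\<Phi> p)"]
      by (simp add: smooth_on_adjugate2 \<Phi>.open_D \<Phi>.smooth_\<Psi>)
  qed
qed

lemma SL2_map_const:
  assumes "open D" "a \<in> SL2"
  shows "SL2_map D (\<lambda>p\<in>D. a)"
proof
  show "smooth_on D (\<lambda>p\<in>D. a)"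
    using smooth_on_cong[OF assms(1), of "\<lambda>p\<in>D. a" "\<lambda>p. a"] by (simp add: smooth_on_const)
qed (use assms in auto)

lemma SL2_map_left_translate:
  assumes "SL2_map D \<Psi>" "a \<in> SL2"
  shows "SL2_map D (\<lambda>p\<in>D. a ** \<Psi> p)"
proof -
  have "open D" using assms(1) by (rule SL2_map.open_D)
  from SL2_map_mult[OF SL2_map_const[OF this assms(2)] assms(1)] show ?thesis
    by (simp cong: restrict_cong)
qed

text \<open>The product rule. When \<open>g\<close> takes values in the isotropy group, this
  identifies a change of framing with a gauge transformation.\<close>

lemma log_deriv_mult:
  assumes "SL2_map D \<Psi>" "SL2_map D g"
  shows "log_deriv D (\<lambda>p\<in>D. \<Psi> p ** g p) = gauge_act D g (log_deriv D \<Psi>)"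
proof -
  interpret \<Psi>: SL2_map D \<Psi> by (rule assms)
  interpret g: SL2_map D g by (rule assms)
  interpret \<Psi>g: SL2_map D "\<lambda>p\<in>D. \<Psi> p ** g p" by (rule SL2_map_mult[OF assms])
  have "log_deriv D (\<lambda>p\<in>D. \<Psi> p ** g p) p v = gauge_act D g (log_deriv D \<Psi>) p v" if p: "p \<in> D" for p v
  proof -
    have "((\<lambda>p\<in>D. \<Psi> p ** g p) has_derivative
        (\<lambda>v. \<Psi> p ** (g p ** log_deriv D g p v) + (\<Psi> p ** log_deriv D \<Psi> p v) ** g p)) (at p)"
      by (rule has_derivative_cong_open[OF \<Psi>.open_D p, THEN iffD2, of _ "\<lambda>p. \<Psi> p ** g p"])
        (simp_all add: mat_mult.FDERIV[OF \<Psi>.d_\<Psi>[OF p] g.d_\<Psi>[OF p]])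
    from fun_cong[OF has_derivative_unique[OF \<Psi>g.d_\<Psi>[OF p] this], of v]
    have "\<Psi> p ** g p ** log_deriv D (\<lambda>p\<in>D. \<Psi> p ** g p) p v =
        \<Psi> p ** (g p ** log_deriv D g p v) + (\<Psi> p ** log_deriv D \<Psi> p v) ** g p"
      using p by simp
    then have "adjugate2 (g p) ** (adjugate2 (\<Psi> p) ** (\<Psi> p ** g p ** log_deriv D (\<lambda>p\<in>D. \<Psi> p ** g p) p v)) =
        log_deriv D g p v + adjugate2 (g p) ** (log_deriv D \<Psi> p v ** g p)"
      by (simp add: mat_mult.add_right matrix_mul_assoc[symmetric] SL2_adjugate2_cancel \<Psi>.SL2 g.SL2 p)
    then show ?thesis
      by (simp add: gauge_act_def p matrix_inv_SL2 g.SL2 Ad_SL2 adjugate2_SL2 adjugate2_adjugate2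
          matrix_mul_assoc[symmetric] SL2_adjugate2_cancel \<Psi>.SL2)
  qed
  then show ?thesis by (auto simp: fun_eq_iff gauge_act_def log_deriv_def)
qed

lemma log_deriv_left_translate:
  assumes "SL2_map D \<Psi>" "a \<in> SL2"
  shows "log_deriv D (\<lambda>p\<in>D. a ** \<Psi> p) = log_deriv D \<Psi>"
proof -
  interpret \<Psi>: SL2_map D \<Psi> by (rule assms)
  interpret a\<Psi>: SL2_map D "\<lambda>p\<in>D. a ** \<Psi> p" by (rule SL2_map_left_translate[OF assms])
  have "log_deriv D (\<lambda>p\<in>D. a ** \<Psi> p) p v = log_deriv D \<Psi> p v" if p: "p \<in> D" for p v
  proof -
    have "((\<lambda>p\<in>D. a ** \<Psi> p) has_derivative (\<lambda>v. a ** (\<Psi> p ** log_deriv D \<Psi> p v))) (at p)"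
      by (rule has_derivative_cong_open[OF \<Psi>.open_D p, THEN iffD2, of _ "\<lambda>p. a ** \<Psi> p"])
        (simp_all add: bounded_linear.has_derivative[OF mat_mult.bounded_linear_right \<Psi>.d_\<Psi>[OF p]])
    from fun_cong[OF has_derivative_unique[OF a\<Psi>.d_\<Psi>[OF p] this], of v]
    have "a ** \<Psi> p ** log_deriv D (\<lambda>p\<in>D. a ** \<Psi> p) p v = a ** (\<Psi> p ** log_deriv D \<Psi> p v)"
      using p by simp
    then have "adjugate2 (\<Psi> p) ** (adjugate2 a ** (a ** (\<Psi> p ** log_deriv D (\<lambda>p\<in>D. a ** \<Psi> p) p v))) =
        adjugate2 (\<Psi> p) ** (adjugate2 a ** (a ** (\<Psi> p ** log_deriv D \<Psi> p v)))"
      by (simp add: matrix_mul_assoc)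
    then show ?thesis by (simp add: SL2_adjugate2_cancel assms(2) \<Psi>.SL2 p)
  qed
  then show ?thesis by (auto simp: fun_eq_iff log_deriv_def)
qed

text \<open>In the derivative of \<open>\<Psi> q ** adjugate2 (\<Phi> q)\<close> the two logarithmic
  derivatives enter with opposite signs and cancel, so this product is constant on the connected
  region; its value is \<open>a\<close>.\<close>

lemma log_deriv_eq_imp_left_translate:
  assumes "SL2_map D \<Phi>" "SL2_map D \<Psi>" "connected D" "log_deriv D \<Phi> = log_deriv D \<Psi>"
  obtains a where "a \<in> SL2" "\<And>p. p \<in> D \<Longrightarrow> \<Psi> p = a ** \<Phi> p"
proof (cases "D = {}")
  case True
  then show ?thesis using that[OF mat_1_SL2] by simp
next
  case False
  then obtain p0 where p0: "p0 \<in> D" by blast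
  interpret \<Phi>: SL2_map D \<Phi> by (rule assms)
  interpret \<Psi>: SL2_map D \<Psi> by (rule assms)
  have "((\<lambda>q. \<Psi> q ** adjugate2 (\<Phi> q)) has_derivative (\<lambda>v. 0)) (at p)" if p: "p \<in> D" for p
    by (rule has_derivative_eq_rhs[OF mat_mult.FDERIV[OF \<Psi>.d_\<Psi>[OF p] \<Phi>.d_adjugate_\<Psi>[OF p]]])
      (simp add: assms(4) mat_mult.minus_right matrix_mul_assoc)
  from has_derivative_zero_unique_connected[OF \<Phi>.open_D assms(3) this _ p0]
  have *: "\<Psi> p ** adjugate2 (\<Phi> p) = \<Psi> p0 ** adjugate2 (\<Phi> p0)" if "p \<in> D" for p
    using that by blast
  show ?thesis
  proof (rule that)
    show "\<Psi> p0 ** adjugate2 (\<Phi> p0) \<in> SL2"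
      by (intro mult_SL2 adjugate2_SL2 \<Phi>.SL2 \<Psi>.SL2 p0)
    show "\<Psi> p = \<Psi> p0 ** adjugate2 (\<Phi> p0) ** \<Phi> p" if "p \<in> D" for p
      unfolding *[OF that, symmetric]
      by (simp add: matrix_mul_assoc[symmetric] SL2_adjugate2_mult \<Phi>.SL2 that)
  qed
qed

lemma admissible_form_integrable:
  assumes D: "open D" "simply_connected D" "D \<noteq> {}" and \<alpha>: "\<alpha> \<in> admissible_forms D"
  obtains \<Psi> where "SL2_map D \<Psi>" "log_deriv D \<Psi> = \<alpha>"
proof -
  have f: "\<alpha> \<in> extensional D" "\<And>p. p \<in> D \<Longrightarrow> linear (\<alpha> p)" "\<And>p v. p \<in> D \<Longrightarrow> trace (\<alpha> p v) = 0"
    "\<And>v. smooth_on D (\<lambda>p. \<alpha> p v)"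
    using \<alpha> by (auto simp: admissible_forms_def forms1_def sl2_def)
  have flat: "frechet_derivative (\<lambda>q. \<alpha> q (0, 1)) (at p) (1, 0) - frechet_derivative (\<lambda>q. \<alpha> q (1, 0)) (at p) (0, 1) +
      (\<alpha> p (1, 0) ** \<alpha> p (0, 1) - \<alpha> p (0, 1) ** \<alpha> p (1, 0)) = 0" if "p \<in> D" for p
  proof -
    have "ext_d \<alpha> p (1, 0) (0, 1) + (1/2) *\<^sub>R wedge_lie \<alpha> \<alpha> p (1, 0) (0, 1) = 0"
      using \<alpha> that by (auto simp: admissible_forms_def)
    moreover have "wedge_lie \<alpha> \<alpha> p (1, 0) (0, 1) = 2 *\<^sub>R lie (\<alpha> p (1, 0)) (\<alpha> p (0, 1))"
      by (simp add: wedge_lie_def lie_def scaleR_2)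
    ultimately show ?thesis by (simp add: ext_d_def lie_def)
  qed
  have "\<exists>\<Psi>. (\<forall>p\<in>D. det (\<Psi> p) = 1) \<and>
      (\<forall>p\<in>D. (\<Psi> has_derivative (\<lambda>w. \<Psi> p ** (fst w *\<^sub>R \<alpha> p (1, 0) + snd w *\<^sub>R \<alpha> p (0, 1)))) (at p))"
    by (rule flat_connection_trivial[OF D smooth_on_has_derivative[OF f(4)] smooth_on_has_derivative[OF f(4)]
          smooth_on_imp_continuous_on[OF smooth_on_frechet_derivative[OF f(4)]]
          smooth_on_imp_continuous_on[OF smooth_on_frechet_derivative[OF f(4)]] f(3) f(3) flat])
  then obtain \<Psi>0 where \<Psi>0: "\<forall>p\<in>D. det (\<Psi>0 p) = 1"
      "\<forall>p\<in>D. (\<Psi>0 has_derivative (\<lambda>w. \<Psi>0 p ** (fst w *\<^sub>R \<alpha> p (1, 0) + snd w *\<^sub>R \<alpha> p (0, 1)))) (at p)"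
    by auto
  have d: "(\<Psi>0 has_derivative (\<lambda>w. \<Psi>0 p ** \<alpha> p w)) (at p)" if "p \<in> D" for p
    using \<Psi>0(2)[THEN bspec, OF that] by (simp add: linear_expand2[OF f(2)[OF that], symmetric])
  \<comment> \<open>The derivative of \<open>\<Psi>0\<close> is its product with the smooth form
    \<alpha>, so smoothness bootstraps.\<close>
  have "smooth_on D \<Psi>0"
  proof (rule smooth_on_SucI[OF D(1) d])
    show "Ck_on k D (\<lambda>p. \<Psi>0 p ** \<alpha> p v)" if "Ck_on k D \<Psi>0" for k v
      using f(4)[of v] by (intro Ck_on_bounded_bilinear[OF D(1) bounded_bilinear_matrix_mult] that)
        (simp add: smooth_on_def)
  qed
  then have s: "smooth_on D (restrict \<Psi>0 D)"
    using smooth_on_cong[OF D(1), of "restrict \<Psi>0 D" \<Psi>0] by simp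
  have \<Psi>: "SL2_map D (restrict \<Psi>0 D)"
    using D(1) s \<Psi>0(1) by (auto simp: SL2_map_def SL2_def)
  interpret \<Psi>: SL2_map D "restrict \<Psi>0 D" by (rule \<Psi>)
  have "log_deriv D (restrict \<Psi>0 D) p v = \<alpha> p v" for p v
  proof (cases "p \<in> D")
    case True
    have "(restrict \<Psi>0 D has_derivative (\<lambda>w. \<Psi>0 p ** \<alpha> p w)) (at p)"
      by (rule has_derivative_cong_open[OF D(1) True, THEN iffD2, OF _ d[OF True]]) simp
    from frechet_derivative_at[OF this, symmetric] show ?thesis
      using \<Psi>0(1) True
      by (simp add: \<Psi>.log_deriv_eq matrix_mul_assoc adjugate2_mult)
  next
    case False
    then show ?thesis by (simp add: log_deriv_def extensional_arb[OF f(1)])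
  qed
  then have "log_deriv D (restrict \<Psi>0 D) = \<alpha>" by blast
  with \<Psi> show ?thesis by (rule that)
qed

text \<open>The framings of one map form a single orbit under right multiplication by the gauge
  group: the quotient of two framings fixes \<open>kk\<close>. Through \<open>log_deriv_mult\<close>
  the orbit becomes a gauge class.\<close>

lemma gauge_class_log_deriv:
  assumes D: "open D" and \<Psi>: "\<Psi> \<in> framings D \<psi>"
  shows "gauge_rel D `` {log_deriv D \<Psi>} = log_deriv D ` framings D \<psi>"
proof -
  have m: "SL2_map D \<Psi>" and fr: "\<And>p. p \<in> D \<Longrightarrow> \<psi> p = Ad (\<Psi> p) kk"
    using \<Psi> by (simp_all add: framings_iff D)
  interpret \<Psi>: SL2_map D \<Psi> by (rule m)
  have gauge: "g \<in> gauge_group D \<longleftrightarrow> SL2_map D g \<and> (\<forall>p\<in>D. Ad (g p) kk = kk)" for g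
    using D by (auto simp: gauge_group_def SL2_map_def K_group_def)
  show ?thesis
  proof (intro equalityI subsetI)
    fix \<beta> assume "\<beta> \<in> gauge_rel D `` {log_deriv D \<Psi>}"
    then obtain g where g: "SL2_map D g" "\<And>p. p \<in> D \<Longrightarrow> Ad (g p) kk = kk"
      and \<beta>: "\<beta> = gauge_act D g (log_deriv D \<Psi>)"
      by (auto simp: gauge_rel_def gauge)
    interpret g: SL2_map D g by (rule g)
    have "(\<lambda>p\<in>D. \<Psi> p ** g p) \<in> framings D \<psi>"
      by (simp add: framings_iff D SL2_map_mult m g fr Ad_mult \<Psi>.SL2 g.SL2)
    then show "\<beta> \<in> log_deriv D ` framings D \<psi>"
      unfolding \<beta> log_deriv_mult[OF m g(1), symmetric] by (rule imageI)
  next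
    fix \<beta> assume "\<beta> \<in> log_deriv D ` framings D \<psi>"
    then obtain \<Phi> where \<Phi>: "SL2_map D \<Phi>" "\<And>p. p \<in> D \<Longrightarrow> \<psi> p = Ad (\<Phi> p) kk" and \<beta>: "\<beta> = log_deriv D \<Phi>"
      by (auto simp: framings_iff D)
    interpret \<Phi>: SL2_map D \<Phi> by (rule \<Phi>)
    define g where "g = (\<lambda>p\<in>D. adjugate2 (\<Psi> p) ** \<Phi> p)"
    have g: "SL2_map D g"
      using SL2_map_mult[OF SL2_map_adjugate2[OF m] \<Phi>(1)] by (simp add: g_def cong: restrict_cong)
    have "Ad (g p) kk = kk" if p: "p \<in> D" for p
    proof -
      have "Ad (g p) kk = Ad (adjugate2 (\<Psi> p)) (Ad (\<Phi> p) kk)"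
        by (simp add: g_def p Ad_mult adjugate2_SL2 \<Psi>.SL2 \<Phi>.SL2)
      also have "\<dots> = Ad (adjugate2 (\<Psi> p)) (Ad (\<Psi> p) kk)"
        using fr[OF p] \<Phi>(2)[OF p] by simp
      finally show ?thesis by (simp add: Ad_adjugate2_cancel \<Psi>.SL2 p)
    qed
    then have "g \<in> gauge_group D" using g by (simp add: gauge)
    moreover have "(\<lambda>p\<in>D. \<Psi> p ** g p) = \<Phi>"
      using \<Phi>.\<Psi>_in by (auto simp: g_def fun_eq_iff SL2_adjugate2_cancel \<Psi>.SL2 PiE_def extensional_def)
    then have "\<beta> = gauge_act D g (log_deriv D \<Psi>)"
      using log_deriv_mult[OF m g] by (simp add: \<beta>)
    ultimately show "\<beta> \<in> gauge_rel D `` {log_deriv D \<Psi>}"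
      by (auto simp: gauge_rel_def)
  qed
qed

text \<open>\<open>congr_rel D\<close> need not be reflexive at maps that are not normalised outside
  \<open>D\<close>, so equality of classes is derived directly from the group laws of
  \<open>SL2\<close>.\<close>

lemma congr_class_eq:
  assumes a: "a \<in> SL2"
  shows "congr_rel D `` {\<lambda>p\<in>D. Ad a (\<psi> p)} = congr_rel D `` {\<psi>}"
proof (intro equalityI subsetI)
  fix \<phi> assume "\<phi> \<in> congr_rel D `` {\<lambda>p\<in>D. Ad a (\<psi> p)}"
  then obtain b where b: "b \<in> SL2" "\<phi> = (\<lambda>p\<in>D. Ad b ((\<lambda>p\<in>D. Ad a (\<psi> p)) p))"
    by (auto simp: congr_rel_def)
  then have "\<phi> = (\<lambda>p\<in>D. Ad (b ** a) (\<psi> p))" by (simp add: Ad_mult a cong: restrict_cong)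
  then show "\<phi> \<in> congr_rel D `` {\<psi>}" using mult_SL2[OF b(1) a] by (auto simp: congr_rel_def)
next
  fix \<phi> assume "\<phi> \<in> congr_rel D `` {\<psi>}"
  then obtain b where b: "b \<in> SL2" "\<phi> = (\<lambda>p\<in>D. Ad b (\<psi> p))"
    by (auto simp: congr_rel_def)
  have "\<phi> = (\<lambda>p\<in>D. Ad (b ** adjugate2 a) ((\<lambda>p\<in>D. Ad a (\<psi> p)) p))"
    unfolding b(2) by (simp add: Ad_mult a b(1) adjugate2_SL2 Ad_adjugate2_cancel cong: restrict_cong)
  then show "\<phi> \<in> congr_rel D `` {\<lambda>p\<in>D. Ad a (\<psi> p)}"
    using mult_SL2[OF b(1) adjugate2_SL2[OF a]] unfolding congr_rel_def by blast
qed

text \<open>Framings of the moved map are left translates of framings of \<psi>, and left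
  translation preserves logarithmic derivatives. Hence the union over a class is already attained at
  any normalised representative.\<close>

lemma log_deriv_framings_congr:
  assumes D: "open D" and \<psi>: "\<psi> \<in> extensional D"
  shows "(\<Union>\<phi>\<in>congr_rel D `` {\<psi>}. log_deriv D ` framings D \<phi>) = log_deriv D ` framings D \<psi>"
proof (intro equalityI subsetI)
  fix \<beta> assume "\<beta> \<in> (\<Union>\<phi>\<in>congr_rel D `` {\<psi>}. log_deriv D ` framings D \<phi>)"
  then obtain a \<Phi> where a: "a \<in> SL2" and \<Phi>: "SL2_map D \<Phi>"
    "\<And>p. p \<in> D \<Longrightarrow> Ad a (\<psi> p) = Ad (\<Phi> p) kk" and \<beta>: "\<beta> = log_deriv D \<Phi>"
    by (auto simp: congr_rel_def framings_iff D)
  interpret \<Phi>: SL2_map D \<Phi> by (rule \<Phi>)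
  have "\<psi> p = Ad (adjugate2 a ** \<Phi> p) kk" if "p \<in> D" for p
    using Ad_adjugate2_cancel[OF a, of "\<psi> p"] \<Phi>(2)[OF that]
    by (simp add: Ad_mult adjugate2_SL2 a \<Phi>.SL2 that)
  then have "(\<lambda>p\<in>D. adjugate2 a ** \<Phi> p) \<in> framings D \<psi>"
    by (simp add: framings_iff D SL2_map_left_translate \<Phi>(1) adjugate2_SL2 a)
  from imageI[OF this, of "log_deriv D"] show "\<beta> \<in> log_deriv D ` framings D \<psi>"
    by (simp add: log_deriv_left_translate \<Phi>(1) adjugate2_SL2 a \<beta>)
next
  fix \<beta> assume \<beta>: "\<beta> \<in> log_deriv D ` framings D \<psi>"
  \<comment> \<open>Extensionality makes \<psi> a member of its own class.\<close>
  have id: "(\<lambda>p\<in>D. Ad (mat 1) (\<psi> p)) = \<psi>"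
    using \<psi> by (simp add: Ad_mat_1 extensional_restrict)
  have "(\<psi>, \<psi>) \<in> congr_rel D"
    unfolding congr_rel_def mem_Collect_eq
    by (intro exI[of _ \<psi>] exI[of _ "mat 1"] conjI mat_1_SL2) (simp only: id)
  with \<beta> show "\<beta> \<in> (\<Union>\<phi>\<in>congr_rel D `` {\<psi>}. log_deriv D ` framings D \<phi>)" by blast
qed

text \<open>One argument for all four correspondences: \<open>HA\<close> says that membership in
  \<open>H\<close> can be read off the logarithmic derivative of any framing. Injectivity is
  uniqueness up to a left factor; surjectivity is integration of flat forms.\<close>

lemma bij_betw_quotients:
  fixes D :: "(real \<times> real) set"
  assumes D: "open D" "simply_connected D" "D \<noteq> {}"
    and H: "H \<subseteq> harmonic_maps D" and A: "A \<subseteq> admissible_forms D"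
    and HA: "\<And>\<psi> \<Psi>. \<psi> \<in> harmonic_maps D \<Longrightarrow> \<Psi> \<in> framings D \<psi> \<Longrightarrow> \<psi> \<in> H \<longleftrightarrow> log_deriv D \<Psi> \<in> A"
    and F: "\<And>\<psi>. \<psi> \<in> harmonic_maps D \<Longrightarrow> F (congr_rel D `` {\<psi>}) = log_deriv D ` framings D \<psi>"
  shows "bij_betw F (H // congr_rel D) (A // gauge_rel D)"
proof -
  have ne: "framings D \<psi> \<noteq> {}" if "\<psi> \<in> harmonic_maps D" for \<psi>
    using that framings_nonempty[OF D(1,2)] by (simp add: harmonic_maps_def)
  have "inj_on F (H // congr_rel D)"
  proof (rule inj_onI)
    fix X Y assume "X \<in> H // congr_rel D" "Y \<in> H // congr_rel D" and eq: "F X = F Y"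
    then obtain \<phi> \<psi> where \<phi>: "\<phi> \<in> harmonic_maps D" "X = congr_rel D `` {\<phi>}"
      and \<psi>: "\<psi> \<in> harmonic_maps D" "Y = congr_rel D `` {\<psi>}"
      using H by (auto elim!: quotientE)
    obtain \<Phi> where \<Phi>: "\<Phi> \<in> framings D \<phi>" using ne[OF \<phi>(1)] by blast
    have "log_deriv D \<Phi> \<in> log_deriv D ` framings D \<psi>"
      using eq \<Phi> F[OF \<phi>(1)] F[OF \<psi>(1)] \<phi>(2) \<psi>(2) by auto
    then obtain \<Psi> where \<Psi>: "\<Psi> \<in> framings D \<psi>" "log_deriv D \<Phi> = log_deriv D \<Psi>" by blast
    have maps: "SL2_map D \<Phi>" "SL2_map D \<Psi>" using \<Phi> \<Psi> by (simp_all add: framings_iff D)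
    obtain a where a: "a \<in> SL2" "\<And>p. p \<in> D \<Longrightarrow> \<Psi> p = a ** \<Phi> p"
      using log_deriv_eq_imp_left_translate[OF maps simply_connected_imp_connected[OF D(2)] \<Psi>(2)] by blast
    have "\<psi> = (\<lambda>p\<in>D. Ad a (\<phi> p))"
    proof
      fix p
      show "\<psi> p = (\<lambda>p\<in>D. Ad a (\<phi> p)) p"
      proof (cases "p \<in> D")
        case True
        then show ?thesis
          using \<Phi> \<Psi>(1) by (simp add: framings_iff D a Ad_mult SL2_map.SL2[OF maps(1)])
      next
        case False
        have "\<psi> \<in> extensional D" using \<psi>(1) by (auto simp: harmonic_maps_def PiE_def)
        from extensional_arb[OF this False] False show ?thesis by simp
      qed
    qed
    then show "X = Y" using congr_class_eq[OF a(1), of D \<phi>] \<phi>(2) \<psi>(2) by simp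
  qed
  moreover have "C \<in> A // gauge_rel D" if "C \<in> F ` (H // congr_rel D)" for C
  proof -
    from that obtain \<psi> where \<psi>: "\<psi> \<in> H" "C = F (congr_rel D `` {\<psi>})" by (auto elim!: quotientE)
    have h: "\<psi> \<in> harmonic_maps D" using \<psi>(1) H by blast
    obtain \<Psi> where \<Psi>: "\<Psi> \<in> framings D \<psi>" using ne[OF h] by blast
    have "C = gauge_rel D `` {log_deriv D \<Psi>}"
      using \<psi>(2) F[OF h] gauge_class_log_deriv[OF D(1) \<Psi>] by simp
    then show ?thesis using HA[OF h \<Psi>] \<psi>(1) by (simp add: quotientI)
  qed
  moreover have "C \<in> F ` (H // congr_rel D)" if "C \<in> A // gauge_rel D" for C
  proof -
    from that obtain \<alpha> where \<alpha>: "\<alpha> \<in> A" "C = gauge_rel D `` {\<alpha>}" by (auto elim!: quotientE)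
    obtain \<Psi> where \<Psi>: "SL2_map D \<Psi>" "log_deriv D \<Psi> = \<alpha>"
      using admissible_form_integrable[OF D] \<alpha>(1) A by blast
    interpret \<Psi>: SL2_map D \<Psi> by (rule \<Psi>)
    \<comment> \<open>The preimage is the map framed by an integral of \<alpha>; admissibility of
      \<alpha> makes it harmonic.\<close>
    define \<psi> where "\<psi> = (\<lambda>p\<in>D. Ad (\<Psi> p) kk)"
    have \<psi>: "\<psi> p = Ad (\<Psi> p) kk" if "p \<in> D" for p using that by (simp add: \<psi>_def)
    have fr: "\<Psi> \<in> framings D \<psi>" by (simp add: framings_iff D \<Psi> \<psi>)
    have "\<psi> \<in> extensional D" unfolding \<psi>_def by (rule restrict_extensional)
    from \<Psi>.harmonic_iff_admissible[OF \<psi> this] have h: "\<psi> \<in> harmonic_maps D"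
      using \<alpha>(1) A \<Psi>(2) by blast
    have "\<psi> \<in> H" using HA[OF h fr] \<alpha>(1) \<Psi>(2) by simp
    moreover have "C = F (congr_rel D `` {\<psi>})"
      using F[OF h] gauge_class_log_deriv[OF D(1) fr] \<alpha>(2) \<Psi>(2) by simp
    ultimately show ?thesis by (simp add: quotientI)
  qed
  ultimately show ?thesis unfolding bij_betw_def by blast
qed

theorem proposition3p5:
  fixes D :: "(real \<times> real) set"
  assumes "open D" and "simply_connected D" and "(0, 0) \<in> D"
  shows "\<exists>F.
     (\<forall>\<psi>\<in>harmonic_maps D. framings D \<psi> \<noteq> {} \<and>
        (\<forall>\<Psi>\<in>framings D \<psi>. F (congr_rel D `` {\<psi>}) = gauge_rel D `` {log_deriv D \<Psi>})) \<and>
     bij_betw F (harmonic_maps D // congr_rel D) (admissible_forms D // gauge_rel D) \<and>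
     bij_betw F (H_plus D // congr_rel D) (A_plus D // gauge_rel D) \<and>
     bij_betw F (H_minus D // congr_rel D) (A_minus D // gauge_rel D) \<and>
     bij_betw F (H_zero D // congr_rel D) (A_zero D // gauge_rel D)"
proof -
  \<comment> \<open>The union makes \<open>F\<close> a function of the class itself. By
    \<open>log_deriv_framings_congr\<close> and \<open>gauge_class_log_deriv\<close> its value at
    the class of a harmonic map is one gauge class.\<close>
  define F where "F = (\<lambda>C. \<Union>\<psi>\<in>C. log_deriv D ` framings D \<psi>)"
  have ext: "\<psi> \<in> extensional D" if "\<psi> \<in> harmonic_maps D" for \<psi>
    using that by (auto simp: harmonic_maps_def PiE_def)
  have F: "F (congr_rel D `` {\<psi>}) = log_deriv D ` framings D \<psi>" if "\<psi> \<in> harmonic_maps D" for \<psi>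
    unfolding F_def by (rule log_deriv_framings_congr[OF assms(1) ext[OF that]])
  have adm: "log_deriv D \<Psi> \<in> admissible_forms D"
    and prod: "p \<in> D \<Longrightarrow> H_prod \<psi> p = 16 * A_prod (log_deriv D \<Psi>) p"
    if "\<psi> \<in> harmonic_maps D" "\<Psi> \<in> framings D \<psi>" for \<psi> \<Psi> p
  proof -
    have m: "SL2_map D \<Psi>" and fr: "\<And>p. p \<in> D \<Longrightarrow> \<psi> p = Ad (\<Psi> p) kk"
      using that(2) by (simp_all add: framings_iff assms(1))
    show "log_deriv D \<Psi> \<in> admissible_forms D"
      using SL2_map.harmonic_iff_admissible[OF m fr ext[OF that(1)]] that(1) by simp
    show "p \<in> D \<Longrightarrow> H_prod \<psi> p = 16 * A_prod (log_deriv D \<Psi>) p"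
      by (rule SL2_map.H_prod_frame[OF m fr])
  qed
  \<comment> \<open>The two products differ by the positive factor 16, so all three sign conditions
    carry over pointwise.\<close>
  have sgn: "(\<forall>p\<in>D. H_prod \<psi> p > 0) \<longleftrightarrow> (\<forall>p\<in>D. A_prod (log_deriv D \<Psi>) p > 0)"
      "(\<forall>p\<in>D. H_prod \<psi> p < 0) \<longleftrightarrow> (\<forall>p\<in>D. A_prod (log_deriv D \<Psi>) p < 0)"
      "(\<forall>p\<in>D. H_prod \<psi> p = 0) \<longleftrightarrow> (\<forall>p\<in>D. A_prod (log_deriv D \<Psi>) p = 0)"
    if "\<psi> \<in> harmonic_maps D" "\<Psi> \<in> framings D \<psi>" for \<psi> \<Psi>
    by (intro ball_cong refl, simp add: prod[OF that])+
  have "D \<noteq> {}" using assms(3) by blast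
  note bij = bij_betw_quotients[OF assms(1,2) this _ _ _ F]
  show ?thesis
  proof (intro exI[of _ F] conjI ballI)
    show "framings D \<psi> \<noteq> {}" if "\<psi> \<in> harmonic_maps D" for \<psi>
      using that framings_nonempty[OF assms(1,2)] by (simp add: harmonic_maps_def)
    show "F (congr_rel D `` {\<psi>}) = gauge_rel D `` {log_deriv D \<Psi>}"
      if "\<psi> \<in> harmonic_maps D" "\<Psi> \<in> framings D \<psi>" for \<psi> \<Psi>
      using F[OF that(1)] gauge_class_log_deriv[OF assms(1) that(2)] by simp
    show "bij_betw F (harmonic_maps D // congr_rel D) (admissible_forms D // gauge_rel D)"
      by (rule bij) (simp_all add: adm)
    show "bij_betw F (H_plus D // congr_rel D) (A_plus D // gauge_rel D)"
      by (rule bij) (simp_all add: H_plus_def A_plus_def adm sgn Collect_conj_eq)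
    show "bij_betw F (H_minus D // congr_rel D) (A_minus D // gauge_rel D)"
      by (rule bij) (simp_all add: H_minus_def A_minus_def adm sgn Collect_conj_eq)
    show "bij_betw F (H_zero D // congr_rel D) (A_zero D // gauge_rel D)"
      by (rule bij) (simp_all add: H_zero_def A_zero_def adm sgn Collect_conj_eq)
  qed
qed

end
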